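(* Let $\xi\in C_c^\infty[0,\infty[$ with $\xi=1$ near $0$. If $\alpha=m^2\in\mathbb{C}$ with $|\mathrm{Re}\sqrt\alpha|<1$ and $\alpha\neq0$, then $$\mathcal{D}(L_\alpha^{\max})=\mathcal{H}_0^2(\mathbb{R}_+)+\mathbb{C}\,x^{\frac12+m}\xi+\mathbb{C}\,x^{\frac12-m}\xi,$$ and for $\alpha=0$, $$\mathcal{D}(L_0^{\max})=\mathcal{H}_0^2(\mathbb{R}_+)+\mathbb{C}\,x^{\frac12}\xi+\mathbb{C}\,x^{\frac12}\log(x)\,\xi.$$ Besides, $\mathcal{D}(L_{\alpha_1}^{\max})\neq\mathcal{D}(L_{\alpha_2}^{\max})$ whenever $\alpha_1\neq\alpha_2$ and $|\mathrm{Re}\sqrt{\alpha_i}|<1$ for $i=1,2$. Furthermore, $$\{\alpha\in\mathbb{C} : |\mathrm{Re}\sqrt\alpha|<1\}\ni\alpha\mapsto L_\alpha^{\max}$$ is a holomorphic family of closed operators.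
   Context: $\mathbb{R}_+=]0,\infty[$; all operators act in the complex Hilbert space $L^2(\mathbb{R}_+)$, and $\mathcal{D}(T)$ is the domain of $T$. For $\alpha\in\mathbb{C}$, $L_\alpha$ is the differential expression $L_\alpha=-\frac{d^2}{dx^2}+\left(\alpha-\frac14\right)\frac1{x^2}$ (in the distributional sense on $\mathbb{R}_+$). $L_\alpha^{\max}$ is the operator given by $L_\alpha$ on $\mathcal{D}(L_\alpha^{\max})=\{f\in L^2(\mathbb{R}_+) : L_\alpha f\in L^2(\mathbb{R}_+)\}$. $m$ denotes one of the square roots of $\alpha$; $|\mathrm{Re}\sqrt\alpha|$ does not depend on the choice of the square root. $\mathcal{H}^2(\mathbb{R}_+)=\{f\in L^2(\mathbb{R}_+) : f''\in L^2(\mathbb{R}_+)\}$ and $\mathcal{H}^2_0(\mathbb{R}_+)=\{f\in\mathcal{H}^2(\mathbb{R}_+) : f(0)=f'(0)=0\}$. Holomorphic family of closed operators: let $\Theta\subset\mathbb{C}$ be open, $\mathcal{H}$ a Banach space and $\Theta\ni z\mapsto H(z)$ a function whose values are closed operators on $\mathcal{H}$. It is a holomorphic family of closed operators if for each $z_0\in\Theta$ there exist a neighborhood $\Theta_0$ of $z_0$, a Banach space $\mathcal{K}$ and a holomorphic family of bounded operators $\Theta_0\ni z\mapsto A(z)\in B(\mathcal{K},\mathcal{H})$ such that $\mathrm{Ran}\,A(z)=\mathcal{D}(H(z))$ and $\Theta_0\ni z\mapsto H(z)A(z)\in B(\mathcal{K},\mathcal{H})$ is a holomorphic family of bounded operators.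 *)

theory Defs
  imports "HOL-Analysis.Analysis" "HOL-Library.Set_Algebras"
begin

section \<open>Complex Banach spaces\<close>

class complex_banach = banach +
  fixes scaleC :: "complex \<Rightarrow> 'a \<Rightarrow> 'a"  (infixr \<open>*\<^sub>C\<close> 75)
  assumes scaleC_add_right: "a *\<^sub>C (x + y) = a *\<^sub>C x + a *\<^sub>C y"
    and scaleC_add_left: "(a + b) *\<^sub>C x = a *\<^sub>C x + b *\<^sub>C x"
    and scaleC_scaleC: "a *\<^sub>C b *\<^sub>C x = (a * b) *\<^sub>C x"
    and scaleC_of_real: "complex_of_real r *\<^sub>C x = r *\<^sub>R x"
    and norm_scaleC: "norm (a *\<^sub>C x) = cmod a * norm x"


section \<open>The Hilbert space of square integrable functions on the half-line\<close>

abbreviation half_line :: "real measure" where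
  "half_line \<equiv> lebesgue_on {0<..}"

definition square_integrable :: "(real \<Rightarrow> complex) \<Rightarrow> bool" where
  "square_integrable f \<longleftrightarrow>
     f \<in> borel_measurable half_line \<and> integrable half_line (\<lambda>x. (cmod (f x))\<^sup>2)"

definition L2_rel :: "(real \<Rightarrow> complex) \<Rightarrow> (real \<Rightarrow> complex) \<Rightarrow> bool" where
  "L2_rel f g \<longleftrightarrow>
     square_integrable f \<and> square_integrable g \<and> (AE x in half_line. f x = g x)"

text \<open>\<^term>\<open>abs_L2 f\<close> is the class of a square integrable function \<^term>\<open>f\<close> (and is
  unspecified for other \<^term>\<open>f\<close>); \<^term>\<open>rep_L2 u\<close> is some representative of \<^term>\<open>u\<close>.\<close>

quotient_type L2 = "real \<Rightarrow> complex" / partial: L2_rel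
proof (rule part_equivpI)
  show "\<exists>f. L2_rel f f" by (rule exI[of _ "\<lambda>_. 0"]) (simp add: L2_rel_def square_integrable_def)
  show "symp L2_rel" by (auto simp: symp_def L2_rel_def)
  show "transp L2_rel" unfolding transp_def L2_rel_def by (auto elim: AE_mp)
qed


lemma square_integrable_zero: "square_integrable (\<lambda>_. 0)"
  by (simp add: square_integrable_def)

lemma square_integrable_scale:
  assumes "square_integrable f"
  shows "square_integrable (\<lambda>x. c * f x)"
  using assms by (auto simp: square_integrable_def norm_mult power_mult_distrib)

lemma square_integrable_add:
  assumes "square_integrable f" "square_integrable g"
  shows "square_integrable (\<lambda>x. f x + g x)"
proof -
  have [measurable]: "f \<in> borel_measurable half_line" "g \<in> borel_measurable half_line"
    using assms by (auto simp: square_integrable_def)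
  have "integrable half_line (\<lambda>x. 2 * (cmod (f x))\<^sup>2 + 2 * (cmod (g x))\<^sup>2)"
    using assms by (auto simp: square_integrable_def)
  then have "integrable half_line (\<lambda>x. (cmod (f x + g x))\<^sup>2)"
  proof (rule Bochner_Integration.integrable_bound)
    have "(cmod (u + v))\<^sup>2 \<le> 2 * (cmod u)\<^sup>2 + 2 * (cmod v)\<^sup>2" for u v
    proof -
      have "(cmod (u + v))\<^sup>2 \<le> (cmod u + cmod v)\<^sup>2"
        by (simp add: norm_triangle_ineq power_mono)
      also have "\<dots> \<le> 2 * (cmod u)\<^sup>2 + 2 * (cmod v)\<^sup>2"
        using zero_le_power2[of "cmod u - cmod v"] by (simp add: power2_eq_square algebra_simps)
      finally show ?thesis .
    qed
    then show "AE x in half_line. norm ((cmod (f x + g x))\<^sup>2)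
        \<le> norm (2 * (cmod (f x))\<^sup>2 + 2 * (cmod (g x))\<^sup>2)"
      by auto
  qed measurable
  then show ?thesis by (simp add: square_integrable_def)
qed

lemma square_integrable_uminus:
  "square_integrable f \<Longrightarrow> square_integrable (\<lambda>x. - f x)"
  using square_integrable_scale[of f "-1"] by simp

lemma square_integrable_diff:
  assumes "square_integrable f" "square_integrable g"
  shows "square_integrable (\<lambda>x. f x - g x)"
  using square_integrable_add[OF assms(1) square_integrable_uminus[OF assms(2)]] by simp

lemma integrable_inner_square_integrable:
  assumes "square_integrable f" "square_integrable g"
  shows "integrable half_line (\<lambda>x. f x \<bullet> g x)"
proof (rule Bochner_Integration.integrable_bound)
  show "integrable half_line (\<lambda>x. (cmod (f x))\<^sup>2 + (cmod (g x))\<^sup>2)"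
    using assms by (auto simp: square_integrable_def)
  have [measurable]: "f \<in> borel_measurable half_line" "g \<in> borel_measurable half_line"
    using assms by (auto simp: square_integrable_def)
  show "(\<lambda>x. f x \<bullet> g x) \<in> borel_measurable half_line" by measurable
  have "\<bar>u \<bullet> v\<bar> \<le> (cmod u)\<^sup>2 + (cmod v)\<^sup>2" for u v
  proof -
    have "\<bar>u \<bullet> v\<bar> \<le> cmod u * cmod v" by (rule Cauchy_Schwarz_ineq2)
    also have "\<dots> \<le> 2 * cmod u * cmod v" by simp
    also have "\<dots> \<le> (cmod u)\<^sup>2 + (cmod v)\<^sup>2" by (rule sum_squares_bound)
    finally show ?thesis .
  qed
  then show "AE x in half_line. norm (f x \<bullet> g x) \<le> norm ((cmod (f x))\<^sup>2 + (cmod (g x))\<^sup>2)"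
    by auto
qed

instantiation L2 :: real_vector
begin

lift_definition zero_L2 :: L2 is "\<lambda>_. 0"
  by (simp add: L2_rel_def square_integrable_zero)

lift_definition plus_L2 :: "L2 \<Rightarrow> L2 \<Rightarrow> L2" is "\<lambda>f g x. f x + g x"
  by (auto simp: L2_rel_def square_integrable_add)

lift_definition minus_L2 :: "L2 \<Rightarrow> L2 \<Rightarrow> L2" is "\<lambda>f g x. f x - g x"
  by (auto simp: L2_rel_def square_integrable_diff)

lift_definition uminus_L2 :: "L2 \<Rightarrow> L2" is "\<lambda>f x. - f x"
  by (auto simp: L2_rel_def square_integrable_uminus)

lift_definition scaleR_L2 :: "real \<Rightarrow> L2 \<Rightarrow> L2" is "\<lambda>r f x. complex_of_real r * f x"
  by (auto simp: L2_rel_def square_integrable_scale)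

instance
proof
  fix a b c :: L2 and r s :: real
  note L2_rel_def [simp] square_integrable_add [simp] square_integrable_scale [simp]
    square_integrable_zero [simp] square_integrable_uminus [simp] square_integrable_diff [simp]
  show "a + b + c = a + (b + c)" by transfer (auto simp: algebra_simps)
  show "a + b = b + a" by transfer (auto simp: algebra_simps)
  show "0 + a = a" by transfer auto
  show "- a + a = 0" by transfer auto
  show "a - b = a + - b" by transfer auto
  show "r *\<^sub>R (a + b) = r *\<^sub>R a + r *\<^sub>R b" by transfer (auto simp: distrib_left)
  show "(r + s) *\<^sub>R a = r *\<^sub>R a + s *\<^sub>R a" by transfer (auto simp: distrib_right)
  show "r *\<^sub>R s *\<^sub>R a = (r * s) *\<^sub>R a" by transfer (auto simp: mult.assoc)
  show "1 *\<^sub>R a = a" by transfer auto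
qed

end

text \<open>\<^class>\<open>real_inner\<close> asks for a real bilinear form: this is the real part of the usual complex
  inner product, which induces the usual norm.\<close>

instantiation L2 :: real_inner
begin

lift_definition inner_L2 :: "L2 \<Rightarrow> L2 \<Rightarrow> real" is "\<lambda>f g. \<integral>x. f x \<bullet> g x \<partial>half_line"
proof -
  fix f f' g g' assume *: "L2_rel f f'" "L2_rel g g'"
  then have [measurable]: "f \<in> borel_measurable half_line" "f' \<in> borel_measurable half_line"
    "g \<in> borel_measurable half_line" "g' \<in> borel_measurable half_line"
    by (auto simp: L2_rel_def square_integrable_def)
  show "(\<integral>x. f x \<bullet> g x \<partial>half_line) = (\<integral>x. f' x \<bullet> g' x \<partial>half_line)"
    by (rule integral_cong_AE) (use * in \<open>auto simp: L2_rel_def\<close>)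
qed

definition norm_L2 :: "L2 \<Rightarrow> real" where "norm_L2 u = sqrt (u \<bullet> u)"

definition sgn_L2 :: "L2 \<Rightarrow> L2" where "sgn_L2 u = u /\<^sub>R norm u"

definition dist_L2 :: "L2 \<Rightarrow> L2 \<Rightarrow> real" where "dist_L2 u v = norm (u - v)"

definition uniformity_L2 :: "(L2 \<times> L2) filter" where
  "uniformity_L2 = (INF e\<in>{0<..}. principal {(x, y). dist x y < e})"

definition open_L2 :: "L2 set \<Rightarrow> bool" where
  "open_L2 U \<longleftrightarrow> (\<forall>x\<in>U. eventually (\<lambda>(x', y). x' = x \<longrightarrow> y \<in> U) uniformity)"

instance
proof
  fix a b c :: L2 and r s :: real
  note L2_rel_def [simp] square_integrable_add [simp] square_integrable_scale [simp]
    square_integrable_zero [simp] square_integrable_uminus [simp] square_integrable_diff [simp]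
  show "sgn a = a /\<^sub>R norm a" by (rule sgn_L2_def)
  show "dist a b = norm (a - b)" by (rule dist_L2_def)
  show "uniformity = (INF e\<in>{0<..}. principal {(x, y :: L2). dist x y < e})"
    by (rule uniformity_L2_def)
  show "open U = (\<forall>x\<in>U. eventually (\<lambda>(x', y). x' = x \<longrightarrow> y \<in> U) uniformity)" for U :: "L2 set"
    by (rule open_L2_def)
  show "a \<bullet> b = b \<bullet> a" by transfer (simp add: inner_commute)
  show "(a + b) \<bullet> c = a \<bullet> c + b \<bullet> c"
    by transfer (simp add: inner_add_left integrable_inner_square_integrable)
  show "(r *\<^sub>R a) \<bullet> b = r * (a \<bullet> b)"
    by transfer (simp flip: scaleR_conv_of_real)
  show "0 \<le> a \<bullet> a" by transfer (rule integral_nonneg_AE, simp)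
  show "a \<bullet> a = 0 \<longleftrightarrow> a = 0"
  proof (transfer, goal_cases)
    case (1 f)
    then have "(\<integral>x. f x \<bullet> f x \<partial>half_line) = 0 \<longleftrightarrow> (AE x in half_line. f x \<bullet> f x = 0)"
      by (intro integral_nonneg_eq_0_iff_AE) (auto intro: integrable_inner_square_integrable)
    with 1 show ?case by simp
  qed
  show "norm a = sqrt (a \<bullet> a)" by (rule norm_L2_def)
qed

end

lemma L2_norm_square: "(norm (u :: L2))\<^sup>2 = (\<integral>x. (cmod (rep_L2 u x))\<^sup>2 \<partial>half_line)"
  unfolding power2_norm_eq_inner
  by (simp add: inner_L2.rep_eq dot_square_norm)

lemma square_integrable_rep: "square_integrable (rep_L2 u)"
  using Quotient3_L2 Quotient3_rep_reflp L2_rel_def by metis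

lemma abs_rep_L2: "abs_L2 (rep_L2 u) = u"
  using Quotient3_L2 Quotient3_abs_rep by metis

lemma L2_norm_abs_square:
  assumes "square_integrable f"
  shows "(norm (abs_L2 f))\<^sup>2 = (\<integral>x. (cmod (f x))\<^sup>2 \<partial>half_line)"
proof -
  have "abs_L2 f \<bullet> abs_L2 f = (\<integral>x. f x \<bullet> f x \<partial>half_line)"
    by (rule inner_L2.abs_eq) (use assms in \<open>auto simp: L2_rel_def\<close>)
  then show ?thesis unfolding power2_norm_eq_inner by (simp add: dot_square_norm)
qed

lemma L2_dist_abs:
  assumes "square_integrable f" "square_integrable g"
  shows "ennreal ((dist (abs_L2 f) (abs_L2 g))\<^sup>2)
    = (\<integral>\<^sup>+x. ennreal ((cmod (f x - g x))\<^sup>2) \<partial>half_line)"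
proof -
  have "abs_L2 f - abs_L2 g = abs_L2 (\<lambda>x. f x - g x)"
    using assms by (simp add: minus_L2.abs_eq L2_rel_def)
  then have "(dist (abs_L2 f) (abs_L2 g))\<^sup>2 = (\<integral>x. (cmod (f x - g x))\<^sup>2 \<partial>half_line)"
    by (simp add: dist_norm L2_norm_abs_square square_integrable_diff assms)
  moreover have "integrable half_line (\<lambda>x. (cmod (f x - g x))\<^sup>2)"
    using square_integrable_diff[OF assms] by (simp add: square_integrable_def)
  ultimately show ?thesis by (simp add: nn_integral_eq_integral)
qed

instance L2 :: banach
proof
  fix X :: "nat \<Rightarrow> L2"
  assume X: "Cauchy X"
  have ex: "\<exists>n. \<forall>i\<ge>n. \<forall>j\<ge>n. dist (X i) (X j) < (1/2)^k" for k :: nat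
    using X unfolding Cauchy_def by (metis half_gt_zero_iff zero_less_one zero_less_power)
  have "\<exists>r::nat \<Rightarrow> nat. \<forall>k. (\<forall>i\<ge>r k. \<forall>j\<ge>r k. dist (X i) (X j) < (1/2)^k) \<and> r k < r (Suc k)"
  proof (rule dependent_nat_choice)
    show "\<exists>n. \<forall>i\<ge>n. \<forall>j\<ge>n. dist (X i) (X j) < (1/2)^0" by (rule ex)
    fix n k :: nat
    obtain m where "\<forall>i\<ge>m. \<forall>j\<ge>m. dist (X i) (X j) < (1/2)^Suc k" using ex by blast
    then show "\<exists>m. (\<forall>i\<ge>m. \<forall>j\<ge>m. dist (X i) (X j) < (1/2)^Suc k) \<and> n < m"
      by (intro exI[of _ "max m (Suc n)"]) auto
  qed
  then obtain r :: "nat \<Rightarrow> nat"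
    where r: "\<And>k i j. i \<ge> r k \<Longrightarrow> j \<ge> r k \<Longrightarrow> dist (X i) (X j) < (1/2)^k"
      and "\<And>k. r k < r (Suc k)"
    by blast
  then have mono: "strict_mono r" by (simp add: strict_mono_Suc_iff)
  define F where "F k = rep_L2 (X (r k))" for k
  have F: "square_integrable (F k)" for k by (simp add: F_def square_integrable_rep)
  have XF: "X (r k) = abs_L2 (F k)" for k by (simp add: F_def abs_rep_L2)
  have [measurable]: "F k \<in> borel_measurable half_line" for k
    using F by (auto simp: square_integrable_def)
  have close: "(\<integral>\<^sup>+x. ennreal ((cmod (F i x - F j x))\<^sup>2) \<partial>half_line) \<le> ennreal ((1/4)^k)"
    if "i \<ge> k" "j \<ge> k" for i j k
  proof -
    have "dist (X (r i)) (X (r j)) \<le> (1/2)^k"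
      using r[of k "r i" "r j"] that mono by (simp add: strict_mono_less_eq less_imp_le)
    then have "(dist (X (r i)) (X (r j)))\<^sup>2 \<le> ((1/2)^k)\<^sup>2" by (simp add: power_mono)
    also have "\<dots> = (1/4)^k" by (simp add: power2_eq_square flip: power_mult_distrib)
    finally have "ennreal ((dist (X (r i)) (X (r j)))\<^sup>2) \<le> ennreal ((1/4)^k)"
      by (rule ennreal_leI)
    then show ?thesis by (simp add: L2_dist_abs[OF F F] XF)
  qed
  have "(\<integral>\<^sup>+x. (\<Sum>k. ennreal (2^k * (cmod (F (Suc k) x - F k x))\<^sup>2)) \<partial>half_line)
      = (\<Sum>k. \<integral>\<^sup>+x. ennreal (2^k * (cmod (F (Suc k) x - F k x))\<^sup>2) \<partial>half_line)"
    by (rule nn_integral_suminf) measurable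
  also have "\<dots> \<le> (\<Sum>k. ennreal ((1/2)^k))"
  proof (rule suminf_le)
    fix k :: nat
    have "(\<integral>\<^sup>+x. ennreal (2^k * (cmod (F (Suc k) x - F k x))\<^sup>2) \<partial>half_line)
        = ennreal (2^k) * (\<integral>\<^sup>+x. ennreal ((cmod (F (Suc k) x - F k x))\<^sup>2) \<partial>half_line)"
      by (subst nn_integral_cmult[symmetric]) (simp_all add: ennreal_mult)
    also have "\<dots> \<le> ennreal (2^k) * ennreal ((1/4)^k)"
      by (rule mult_left_mono[OF close]) auto
    also have "\<dots> = ennreal ((1/2)^k)"
      by (simp flip: ennreal_mult power_mult_distrib)
    finally show "(\<integral>\<^sup>+x. ennreal (2^k * (cmod (F (Suc k) x - F k x))\<^sup>2) \<partial>half_line)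
        \<le> ennreal ((1/2)^k)" .
  qed auto
  also have "\<dots> = ennreal (\<Sum>k. (1/2)^k)"
    by (rule suminf_ennreal_eq) (auto intro: summable_sums summable_geometric)
  also have "\<dots> < \<infinity>" by simp
  finally have "AE x in half_line. (\<Sum>k. ennreal (2^k * (cmod (F (Suc k) x - F k x))\<^sup>2)) \<noteq> \<infinity>"
    by (intro nn_integral_PInf_AE) auto
  then have conv: "AE x in half_line. convergent (\<lambda>k. F k x)"
  proof (rule AE_mp, intro AE_I2 impI)
    fix x assume "(\<Sum>k. ennreal (2^k * (cmod (F (Suc k) x - F k x))\<^sup>2)) \<noteq> \<infinity>"
    then have "summable (\<lambda>k. 2^k * (cmod (F (Suc k) x - F k x))\<^sup>2)"
      by (intro summable_suminf_not_top) auto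
    moreover have "summable (\<lambda>k. (1/2::real)^k)" by (rule summable_geometric) simp
    ultimately have "summable (\<lambda>k. 2^k * (cmod (F (Suc k) x - F k x))\<^sup>2 + (1/2)^k)"
      by (rule summable_add)
    then have "summable (\<lambda>k. F (Suc k) x - F k x)"
    proof (rule summable_comparison_test[rotated], intro exI allI impI)
      fix k :: nat
      define t where "t = cmod (F (Suc k) x - F k x)"
      have "t * 2 \<le> 2^k * t\<^sup>2 * 2 + (1/2)^k * 2"
      proof -
        have "0 \<le> (1/2)^k * (2^k * t - 1)\<^sup>2" by simp
        also have "\<dots> = 2^k * t\<^sup>2 - 2 * t + (1/2)^k"
          by (simp add: power2_eq_square algebra_simps power_divide)
        finally have "2 * t \<le> 2^k * t\<^sup>2 + (1/2)^k" by simp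
        moreover have "0 \<le> 2^k * t\<^sup>2" "0 \<le> (1/2::real)^k" by auto
        ultimately show ?thesis by linarith
      qed
      then show "norm (F (Suc k) x - F k x) \<le> 2^k * (cmod (F (Suc k) x - F k x))\<^sup>2 + (1/2)^k"
        by (simp add: t_def)
    qed
    then have "convergent (\<lambda>n. \<Sum>k<n. F (Suc k) x - F k x)" by (simp add: summable_iff_convergent)
    then have "convergent (\<lambda>n. F n x - F 0 x)" 
      by (simp only: sum_lessThan_telescope[of "\<lambda>k. F k x"])
    then have "convergent (\<lambda>n. (F n x - F 0 x) + F 0 x)" by (rule convergent_add) (rule convergent_const)
    then show "convergent (\<lambda>n. F n x)" by simp
  qed
  define G where "G x = (if Cauchy (\<lambda>k. F k x) then lim (\<lambda>k. F k x) else 0)" for x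
  have [measurable]: "G \<in> borel_measurable half_line"
    unfolding G_def by measurable
  have limG: "AE x in half_line. (\<lambda>k. F k x) \<longlonglongrightarrow> G x"
    using conv by eventually_elim (simp add: G_def Cauchy_convergent_iff convergent_LIMSEQ_iff)
  have fatou: "(\<integral>\<^sup>+x. ennreal ((cmod (F k x - G x))\<^sup>2) \<partial>half_line) \<le> ennreal ((1/4)^k)" for k
  proof -
    have "(\<integral>\<^sup>+x. ennreal ((cmod (F k x - G x))\<^sup>2) \<partial>half_line)
        = (\<integral>\<^sup>+x. liminf (\<lambda>n. ennreal ((cmod (F k x - F n x))\<^sup>2)) \<partial>half_line)"
    proof (rule nn_integral_cong_AE, use limG in eventually_elim)
      fix x assume "(\<lambda>k. F k x) \<longlonglongrightarrow> G x"
      then have "(\<lambda>n. ennreal ((cmod (F k x - F n x))\<^sup>2)) \<longlonglongrightarrow> ennreal ((cmod (F k x - G x))\<^sup>2)"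
        by (intro tendsto_intros)
      then show "ennreal ((cmod (F k x - G x))\<^sup>2) = liminf (\<lambda>n. ennreal ((cmod (F k x - F n x))\<^sup>2))"
        by (rule lim_imp_Liminf[OF sequentially_bot, symmetric])
    qed
    also have "\<dots> \<le> liminf (\<lambda>n. \<integral>\<^sup>+x. ennreal ((cmod (F k x - F n x))\<^sup>2) \<partial>half_line)"
      by (rule nn_integral_liminf) measurable
    also have "\<dots> \<le> limsup (\<lambda>n. \<integral>\<^sup>+x. ennreal ((cmod (F k x - F n x))\<^sup>2) \<partial>half_line)"
      by (rule Liminf_le_Limsup) simp
    also have "\<dots> \<le> ennreal ((1/4)^k)"
      by (rule Limsup_bounded) (auto simp: eventually_sequentially intro!: close exI[of _ k])
    finally show ?thesis .
  qed
  have "integrable half_line (\<lambda>x. (cmod (F 0 x - G x))\<^sup>2)"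
    using fatou[of 0] by (intro integrableI_bounded) (auto intro: le_less_trans)
  then have "square_integrable (\<lambda>x. F 0 x - G x)" by (simp add: square_integrable_def)
  then have G: "square_integrable G" using square_integrable_diff[OF F[of 0]] by fastforce
  have bound: "dist (X (r k)) (abs_L2 G) \<le> (1/2)^k" for k
  proof (rule power2_le_imp_le)
    have "ennreal ((dist (X (r k)) (abs_L2 G))\<^sup>2) \<le> ennreal ((1/4)^k)"
      unfolding XF using fatou L2_dist_abs[OF F G] by simp
    then have "(dist (X (r k)) (abs_L2 G))\<^sup>2 \<le> (1/4)^k" by (subst (asm) ennreal_le_iff) auto
    also have "(1/4::real)^k = ((1/2)^k)\<^sup>2" by (simp add: power2_eq_square flip: power_mult_distrib)
    finally show "(dist (X (r k)) (abs_L2 G))\<^sup>2 \<le> ((1/2)^k)\<^sup>2" .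
  qed simp
  have "(\<lambda>k. (1/2::real)^k) \<longlonglongrightarrow> 0" by (rule LIMSEQ_power_zero) simp
  then have "(\<lambda>k. dist (X (r k)) (abs_L2 G)) \<longlonglongrightarrow> 0"
    by (rule tendsto_sandwich[OF _ _ tendsto_const, rotated 2]) (auto intro!: always_eventually bound)
  then have "(X \<circ> r) \<longlonglongrightarrow> abs_L2 G"
    by (subst tendsto_dist_iff) (simp add: o_def)
  then show "convergent X"
    using Cauchy_converges_subseq[OF X mono] by (auto simp: convergent_def)
qed

instantiation L2 :: complex_banach
begin

lift_definition scaleC_L2 :: "complex \<Rightarrow> L2 \<Rightarrow> L2" is "\<lambda>c f x. c * f x"
  by (auto simp: L2_rel_def square_integrable_scale)

instance
proof
  fix a b :: complex and u v :: L2 and r :: real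
  note L2_rel_def [simp] square_integrable_add [simp] square_integrable_scale [simp]
  show "a *\<^sub>C (u + v) = a *\<^sub>C u + a *\<^sub>C v" by transfer (auto simp: distrib_left)
  show "(a + b) *\<^sub>C u = a *\<^sub>C u + b *\<^sub>C u" by transfer (auto simp: distrib_right)
  show "a *\<^sub>C b *\<^sub>C u = (a * b) *\<^sub>C u" by transfer (auto simp: mult.assoc)
  show "complex_of_real r *\<^sub>C u = r *\<^sub>R u" by transfer auto
  have "(a *\<^sub>C u) \<bullet> (a *\<^sub>C u) = (cmod a)\<^sup>2 * (u \<bullet> u)"
    by transfer (simp add: dot_square_norm norm_mult power_mult_distrib)
  then show "norm (a *\<^sub>C u) = cmod a * norm u"
    by (simp add: norm_eq_sqrt_inner real_sqrt_mult)
qed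

end


section \<open>Smooth functions and distributions on the half-line\<close>

text \<open>At a boundary point of \<^term>\<open>S\<close> the derivatives are one-sided, so \<^term>\<open>smooth_on {0..} f\<close>
  means smoothness up to the boundary.\<close>

definition smooth_on :: "real set \<Rightarrow> (real \<Rightarrow> complex) \<Rightarrow> bool" where
  "smooth_on S f \<longleftrightarrow>
     (\<exists>D :: nat \<Rightarrow> real \<Rightarrow> complex. (\<forall>x\<in>S. D 0 x = f x) \<and>
        (\<forall>n. \<forall>x\<in>S. (D n has_vector_derivative D (Suc n) x) (at x within S)))"

text \<open>Elements are functions on all of the real line; their values outside \<^term>\<open>S\<close> are
  arbitrary and play no role.\<close>

definition smooth_compact_support :: "real set \<Rightarrow> (real \<Rightarrow> complex) set" where
  "smooth_compact_support S =
     {\<phi>. smooth_on S \<phi> \<and> compact (closure {x\<in>S. \<phi> x \<noteq> 0}) \<and> closure {x\<in>S. \<phi> x \<noteq> 0} \<subseteq> S}"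

abbreviation test_functions :: "(real \<Rightarrow> complex) set" where
  "test_functions \<equiv> smooth_compact_support {0<..}"

text \<open>Distributions are represented as functionals on functions; only their values on
  \<^term>\<open>test_functions\<close> matter. All of them below are built from the regular distributions
  given by elements of \<^typ>\<open>L2\<close>.\<close>

type_synonym distribution = "(real \<Rightarrow> complex) \<Rightarrow> complex"

definition distribution_eq :: "distribution \<Rightarrow> distribution \<Rightarrow> bool" where
  "distribution_eq S T \<longleftrightarrow> (\<forall>\<phi>\<in>test_functions. S \<phi> = T \<phi>)"

definition distribution_of :: "L2 \<Rightarrow> distribution" where
  "distribution_of f \<phi> = (\<integral>x. rep_L2 f x * \<phi> x \<partial>half_line)"

definition distribution_deriv :: "distribution \<Rightarrow> distribution" where
  "distribution_deriv T \<phi> = - T (\<lambda>x. vector_derivative \<phi> (at x))"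

definition distribution_mult :: "(real \<Rightarrow> complex) \<Rightarrow> distribution \<Rightarrow> distribution" where
  "distribution_mult a T \<phi> = T (\<lambda>x. a x * \<phi> x)"


section \<open>The Bessel operators and the Sobolev spaces\<close>

definition L_expr :: "complex \<Rightarrow> distribution \<Rightarrow> distribution" where
  "L_expr \<alpha> T \<phi> = - distribution_deriv (distribution_deriv T) \<phi>
     + distribution_mult (\<lambda>x. (\<alpha> - 1/4) * (1 / (complex_of_real x)\<^sup>2)) T \<phi>"

text \<open>Operators in a space are given by their graphs, so that the domain of an operator is
  the \<^const>\<open>Domain\<close> of the relation.\<close>

definition L_max :: "complex \<Rightarrow> (L2 \<times> L2) set" where
  "L_max \<alpha> = {(f, g). distribution_eq (L_expr \<alpha> (distribution_of f)) (distribution_of g)}"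

definition H2 :: "L2 set" where
  "H2 = {f. \<exists>g. distribution_eq
     (distribution_deriv (distribution_deriv (distribution_of f))) (distribution_of g)}"

text \<open>Every element of \<^const>\<open>H2\<close> has a unique representative that is continuously differentiable on
  the closed half-line; the boundary values are those of this representative.\<close>

definition H2_0 :: "L2 set" where
  "H2_0 = {f\<in>H2. \<exists>F F'. (AE x in half_line. rep_L2 f x = F x) \<and>
     (\<forall>x\<ge>0. (F has_vector_derivative F' x) (at x within {0..})) \<and>
     continuous_on {0..} F' \<and> F 0 = 0 \<and> F' 0 = 0}"


section \<open>Holomorphic families of closed operators\<close>

definition closed_operator :: "('h::complex_banach \<times> 'h) set \<Rightarrow> bool" where
  "closed_operator T \<longleftrightarrow> single_valued T \<and> (0, 0) \<in> T \<and>
     (\<forall>x y x' y'. (x, y) \<in> T \<longrightarrow> (x', y') \<in> T \<longrightarrow> (x + x', y + y') \<in> T) \<and>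
     (\<forall>c x y. (x, y) \<in> T \<longrightarrow> (c *\<^sub>C x, c *\<^sub>C y) \<in> T) \<and>
     closed T"

definition op_apply :: "('h \<times> 'h) set \<Rightarrow> 'h \<Rightarrow> 'h" where
  "op_apply T x = (THE y. (x, y) \<in> T)"

text \<open>The auxiliary Banach spaces in the definition of a holomorphic family are existentially
  quantified and may vary with the base point. They are therefore given by an explicit carrier set
  with operations of their own; the operations matter only on the carrier.\<close>

record 'k normed_structure =
  carr :: "'k set"
  zer :: 'k
  add :: "'k \<Rightarrow> 'k \<Rightarrow> 'k"
  scl :: "complex \<Rightarrow> 'k \<Rightarrow> 'k"
  nrm :: "'k \<Rightarrow> real"

definition minus_of :: "'k normed_structure \<Rightarrow> 'k \<Rightarrow> 'k \<Rightarrow> 'k" where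
  "minus_of K x y = add K x (scl K (-1) y)"

definition normed_structure_banach :: "'k normed_structure \<Rightarrow> bool" where
  "normed_structure_banach K \<longleftrightarrow>
     zer K \<in> carr K \<and>
     (\<forall>x\<in>carr K. \<forall>y\<in>carr K. add K x y \<in> carr K) \<and>
     (\<forall>a. \<forall>x\<in>carr K. scl K a x \<in> carr K) \<and>
     (\<forall>x\<in>carr K. \<forall>y\<in>carr K. \<forall>z\<in>carr K. add K (add K x y) z = add K x (add K y z)) \<and>
     (\<forall>x\<in>carr K. \<forall>y\<in>carr K. add K x y = add K y x) \<and>
     (\<forall>x\<in>carr K. add K (zer K) x = x) \<and>
     (\<forall>x\<in>carr K. minus_of K x x = zer K) \<and>
     (\<forall>a. \<forall>x\<in>carr K. \<forall>y\<in>carr K. scl K a (add K x y) = add K (scl K a x) (scl K a y)) \<and>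
     (\<forall>a b. \<forall>x\<in>carr K. scl K (a + b) x = add K (scl K a x) (scl K b x)) \<and>
     (\<forall>a b. \<forall>x\<in>carr K. scl K a (scl K b x) = scl K (a * b) x) \<and>
     (\<forall>x\<in>carr K. scl K 1 x = x) \<and>
     (\<forall>x\<in>carr K. 0 \<le> nrm K x) \<and>
     (\<forall>x\<in>carr K. nrm K x = 0 \<longleftrightarrow> x = zer K) \<and>
     (\<forall>x\<in>carr K. \<forall>y\<in>carr K. nrm K (add K x y) \<le> nrm K x + nrm K y) \<and>
     (\<forall>a. \<forall>x\<in>carr K. nrm K (scl K a x) = cmod a * nrm K x) \<and>
     (\<forall>s :: nat \<Rightarrow> 'k. range s \<subseteq> carr K \<and>
        (\<forall>e>0. \<exists>N. \<forall>i\<ge>N. \<forall>j\<ge>N. nrm K (minus_of K (s i) (s j)) < e) \<longrightarrow>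
        (\<exists>l\<in>carr K. (\<lambda>n. nrm K (minus_of K (s n) l)) \<longlonglongrightarrow> 0))"

definition bounded_operator :: "'k normed_structure \<Rightarrow> ('k \<Rightarrow> 'h::complex_banach) \<Rightarrow> bool" where
  "bounded_operator K A \<longleftrightarrow>
     (\<forall>x\<in>carr K. \<forall>y\<in>carr K. A (add K x y) = A x + A y) \<and>
     (\<forall>c. \<forall>x\<in>carr K. A (scl K c x) = c *\<^sub>C A x) \<and>
     (\<exists>B. \<forall>x\<in>carr K. norm (A x) \<le> B * nrm K x)"

definition operator_norm :: "'k normed_structure \<Rightarrow> ('k \<Rightarrow> 'h::complex_banach) \<Rightarrow> real" where
  "operator_norm K A = (SUP x\<in>{x\<in>carr K. nrm K x \<le> 1}. norm (A x))"

definition holomorphic_bounded_family ::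
    "'k normed_structure \<Rightarrow> complex set \<Rightarrow> (complex \<Rightarrow> 'k \<Rightarrow> 'h::complex_banach) \<Rightarrow> bool" where
  "holomorphic_bounded_family K \<Theta> A \<longleftrightarrow>
     (\<forall>z\<in>\<Theta>. bounded_operator K (A z)) \<and>
     (\<forall>z\<in>\<Theta>. \<exists>D. bounded_operator K D \<and>
        ((\<lambda>w. operator_norm K (\<lambda>x. inverse (w - z) *\<^sub>C (A w x - A z x) - D x)) \<longlongrightarrow> 0) (at z))"

text \<open>HOL cannot quantify over types inside a formula, so the type \<^typ>\<open>'k\<close> from which the points
  of the auxiliary Banach spaces are taken is a parameter; their carriers and operations are
  arbitrary. Since the spaces occur existentially, the property for one type implies the property
  with arbitrary Banach spaces.\<close>

definition holomorphic_family_closed ::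
    "'k itself \<Rightarrow> complex set \<Rightarrow> (complex \<Rightarrow> ('h::complex_banach \<times> 'h) set) \<Rightarrow> bool" where
  "holomorphic_family_closed _ \<Theta> H \<longleftrightarrow>
     open \<Theta> \<and> (\<forall>z\<in>\<Theta>. closed_operator (H z)) \<and>
     (\<forall>z\<^sub>0\<in>\<Theta>. \<exists>\<Theta>\<^sub>0 (K :: 'k normed_structure) A.
        open \<Theta>\<^sub>0 \<and> z\<^sub>0 \<in> \<Theta>\<^sub>0 \<and> \<Theta>\<^sub>0 \<subseteq> \<Theta> \<and> normed_structure_banach K \<and>
        holomorphic_bounded_family K \<Theta>\<^sub>0 A \<and>
        (\<forall>z\<in>\<Theta>\<^sub>0. A z ` carr K = Domain (H z)) \<and>
        holomorphic_bounded_family K \<Theta>\<^sub>0 (\<lambda>z x. op_apply (H z) (A z x)))"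

end

theory Submission
  imports Defs "HOL-Complex_Analysis.Complex_Analysis"
begin

text \<open>The homogeneous equation has the solutions \<open>sqrt x * cosh (m * ln x)\<close> and
  \<open>sqrt x * sinh (m * ln x) / m\<close>, which are entire in \<open>\<alpha> = m\<^sup>2\<close> (no choice of the root is involved, and
  \<open>\<alpha> = 0\<close> is not exceptional) and square integrable near zero because \<open>\<bar>Re m\<bar> < 1\<close>. Variation of constants
  from zero gives a right inverse of \<open>L\<^sub>\<alpha>\<close>, and by a Hardy inequality its values stay square integrable
  after division by \<open>x\<^sup>2\<close>. Hence an element of the maximal domain is, near zero, a combination of the two
  solutions plus some \<open>h\<close> such that \<open>h / x\<^sup>2\<close> is square integrable. As \<open>L\<^sub>\<alpha> h = L\<^sub>\<beta> h + (\<alpha> - \<beta>) h / x\<^sup>2\<close>, the space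
  of these \<open>h\<close> does not depend on \<open>\<alpha>\<close>; for \<open>\<alpha> = 1/4\<close> it is seen to be \<open>H2_0\<close>.

  An element \<open>f\<close> of two of the domains has a square integrable quotient \<open>f / x\<^sup>2\<close>, which fails for
  \<open>f = x powr (1/2 + m) * \<xi>\<close> when \<open>0 \<le> Re m < 1\<close>. The holomorphic parametrization of the domains acts on the
  domain of \<open>L_max (1/4)\<close> with its graph norm: it keeps the \<open>H2_0\<close> component and replaces the two cut off
  solutions for \<open>1/4\<close> by those for \<open>z\<close>.\<close>

section \<open>Smooth functions\<close>

text \<open>That a distributional solution is a combination of the two classical ones is obtained by
  duality, not from regularity theory: up to multiples of two fixed test functions, every test
  function is the image of a test function under the expression (\<open>solve_test\<close>). This
  also yields the coefficients as integrals against fixed test functions, hence as continuous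
  functionals of the graph norm, which the parametrization of the domains relies on. The other
  obstacle is that estimates must survive \<alpha> = 0 and be locally uniform in \<alpha>. So the
  division by the root of \<alpha> is never estimated directly; the logarithm that appears instead
  is absorbed by an exponent \<rho> with |Re m| < \<rho> < 1. For y < x the kernel is then dominated
  by \<open>x powr (1/2 + \<rho>) * y powr (1/2 - \<rho>)\<close>, and \<rho> < 1 is what
  Cauchy-Schwarz at zero and Hardy's inequality need. Coefficients are shown to vanish by comparing
  orders at zero: the variation of constants integral is O(x^(3/2)), while for \<alpha> = 1/4 the
  solutions are spanned by 1 and x.\<close>

lemma smooth_onD:
  assumes "smooth_on S f"
  obtains f' where "smooth_on S f'" "\<And>x. x \<in> S \<Longrightarrow> (f has_vector_derivative f' x) (at x within S)"
proof -
  obtain D where D: "\<And>x. x \<in> S \<Longrightarrow> D 0 x = f x"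
    "\<And>n x. x \<in> S \<Longrightarrow> (D n has_vector_derivative D (Suc n) x) (at x within S)"
    using assms unfolding smooth_on_def by blast
  show thesis
  proof
    show "smooth_on S (D 1)"
      unfolding smooth_on_def by (rule exI[of _ "\<lambda>n. D (Suc n)"]) (use D in auto)
    show "(f has_vector_derivative D 1 x) (at x within S)" if "x \<in> S" for x
      using D(2)[OF that, of 0] has_vector_derivative_transform[OF that D(1)[symmetric]] by simp
  qed
qed

text \<open>Smoothness as a greatest fixed point: if \<open>P\<close> always leads to some
  derivative that again satisfies \<open>P\<close>, dependent choice builds the whole sequence of
  derivatives. The closure properties of smooth functions then reduce to finding a suitable
  \<open>P\<close>.\<close>

lemma smooth_on_coinduct:
  assumes "P f"
    and "\<And>f. P f \<Longrightarrow> \<exists>f'. P f' \<and> (\<forall>x\<in>S. (f has_vector_derivative f' x) (at x within S))"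
  shows "smooth_on S f"
proof -
  have "\<exists>D. \<forall>n. (P (D n) \<and> (n = 0 \<longrightarrow> D n = f)) \<and>
      (\<forall>x\<in>S. (D n has_vector_derivative D (Suc n) x) (at x within S))"
    by (rule dependent_nat_choice) (use assms in auto)
  then show ?thesis unfolding smooth_on_def by metis
qed

lemma smooth_on_cong: "smooth_on S f \<Longrightarrow> (\<And>x. x \<in> S \<Longrightarrow> f x = g x) \<Longrightarrow> smooth_on S g"
  unfolding smooth_on_def by metis

lemma smooth_on_subset:
  assumes "smooth_on S f" "T \<subseteq> S"
  shows "smooth_on T f"
proof (rule smooth_on_coinduct[where P = "smooth_on S"])
  show "\<exists>g. smooth_on S g \<and> (\<forall>x\<in>T. (h has_vector_derivative g x) (at x within T))"
    if "smooth_on S h" for h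
    using that
  proof (rule smooth_onD)
    fix g assume "smooth_on S g" "\<And>x. x \<in> S \<Longrightarrow> (h has_vector_derivative g x) (at x within S)"
    then show ?thesis
      using has_vector_derivative_within_subset[OF _ assms(2)] assms(2) by blast
  qed
qed (rule assms)

lemma smooth_on_imp_continuous_on: "smooth_on S f \<Longrightarrow> continuous_on S f"
  by (erule smooth_onD) (rule continuous_on_vector_derivative)

lemma smooth_on_const: "smooth_on S (\<lambda>_. c)"
  by (rule smooth_on_coinduct[where P = "\<lambda>f. \<exists>c. f = (\<lambda>_. c)"])
     (use has_vector_derivative_const in blast)+

lemma smooth_on_antiderivative:
  assumes "smooth_on S f" "\<And>x. x \<in> S \<Longrightarrow> (F has_vector_derivative f x) (at x within S)"
  shows "smooth_on S F"
proof (rule smooth_on_coinduct[where P = "\<lambda>h. h = F \<or> smooth_on S h"])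
  fix h assume "h = F \<or> smooth_on S h"
  then show "\<exists>f'. (f' = F \<or> smooth_on S f') \<and> (\<forall>x\<in>S. (h has_vector_derivative f' x) (at x within S))"
  proof
    assume "h = F"
    then show ?thesis using assms by blast
  next
    assume "smooth_on S h"
    then show ?thesis by (rule smooth_onD) blast
  qed
qed simp

text \<open>The derivative of a product is a sum of products, so an invariant for products has to be
  closed under both operations. Taking the closure avoids the binomial formula for higher
  derivatives.\<close>

inductive smooth_algebra :: "real set \<Rightarrow> (real \<Rightarrow> complex) \<Rightarrow> bool" for S where
  base: "smooth_on S f \<Longrightarrow> smooth_algebra S f"
| add: "smooth_algebra S f \<Longrightarrow> smooth_algebra S g \<Longrightarrow> smooth_algebra S (\<lambda>x. f x + g x)"
| mult: "smooth_algebra S f \<Longrightarrow> smooth_algebra S g \<Longrightarrow> smooth_algebra S (\<lambda>x. f x * g x)"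

lemma smooth_algebra_imp_smooth:
  assumes "smooth_algebra S f"
  shows "smooth_on S f"
proof (rule smooth_on_coinduct[where P = "smooth_algebra S"])
  show "\<exists>f'. smooth_algebra S f' \<and> (\<forall>x\<in>S. (f has_vector_derivative f' x) (at x within S))"
    if "smooth_algebra S f" for f
    using that
  proof induction
    case (base f)
    then show ?case by (rule smooth_onD) (use smooth_algebra.base in blast)
  next
    case (add f g)
    then obtain f' g' where s: "smooth_algebra S f'" "smooth_algebra S g'"
      and d: "\<forall>x\<in>S. (f has_vector_derivative f' x) (at x within S)"
        "\<forall>x\<in>S. (g has_vector_derivative g' x) (at x within S)" by blast
    have "smooth_algebra S (\<lambda>x. f' x + g' x)" by (rule smooth_algebra.add[OF s])
    moreover have "\<forall>x\<in>S. ((\<lambda>x. f x + g x) has_vector_derivative f' x + g' x) (at x within S)"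
      using d has_vector_derivative_add by blast
    ultimately show ?case by (intro exI conjI)
  next
    case (mult f g)
    then obtain f' g' where s: "smooth_algebra S f'" "smooth_algebra S g'"
      and d: "\<forall>x\<in>S. (f has_vector_derivative f' x) (at x within S)"
        "\<forall>x\<in>S. (g has_vector_derivative g' x) (at x within S)" by blast
    have "smooth_algebra S (\<lambda>x. f x * g' x + f' x * g x)"
      by (rule smooth_algebra.add[OF smooth_algebra.mult smooth_algebra.mult]) (use mult s in auto)
    moreover have "\<forall>x\<in>S. ((\<lambda>x. f x * g x) has_vector_derivative f x * g' x + f' x * g x) (at x within S)"
      using d has_vector_derivative_mult by blast
    ultimately show ?case by (intro exI conjI)
  qed
qed (rule assms)

lemma smooth_on_add: "smooth_on S f \<Longrightarrow> smooth_on S g \<Longrightarrow> smooth_on S (\<lambda>x. f x + g x)"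
  by (rule smooth_algebra_imp_smooth[OF smooth_algebra.add[OF smooth_algebra.base smooth_algebra.base]])

lemma smooth_on_mult: "smooth_on S f \<Longrightarrow> smooth_on S g \<Longrightarrow> smooth_on S (\<lambda>x. f x * g x)"
  by (rule smooth_algebra_imp_smooth[OF smooth_algebra.mult[OF smooth_algebra.base smooth_algebra.base]])

lemma smooth_on_uminus: "smooth_on S f \<Longrightarrow> smooth_on S (\<lambda>x. - f x)"
  using smooth_on_mult[OF smooth_on_const[of S "-1"]] by simp

lemma smooth_on_diff: "smooth_on S f \<Longrightarrow> smooth_on S g \<Longrightarrow> smooth_on S (\<lambda>x. f x - g x)"
  using smooth_on_add[OF _ smooth_on_uminus] by simp

text \<open>Derivatives of holomorphic functions are holomorphic, so the restrictions of functions
  holomorphic on the right half-plane form a coinductive invariant.\<close>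

lemma smooth_on_holomorphic:
  assumes "F holomorphic_on {w. 0 < Re w}"
  shows "smooth_on {0<..} (\<lambda>x. F (complex_of_real x))"
proof (rule smooth_on_coinduct[where
      P = "\<lambda>f. \<exists>F. F holomorphic_on {w. 0 < Re w} \<and> f = (\<lambda>x. F (complex_of_real x))"])
  fix f assume "\<exists>F. F holomorphic_on {w. 0 < Re w} \<and> f = (\<lambda>x. F (complex_of_real x))"
  then obtain F where F: "F holomorphic_on {w. 0 < Re w}" "f = (\<lambda>x. F (complex_of_real x))" by blast
  have op: "open {w. 0 < Re w}" by (rule open_halfspace_Re_gt)
  have "(f has_vector_derivative deriv F (complex_of_real x)) (at x within {0<..})" if "0 < x" for x
    unfolding F(2)
    by (rule has_vector_derivative_real_field)
      (use holomorphic_derivI[OF F(1) op, of "of_real x"] that in auto)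
  then show "\<exists>f'. (\<exists>F. F holomorphic_on {w. 0 < Re w} \<and> f' = (\<lambda>x. F (complex_of_real x))) \<and>
      (\<forall>x\<in>{0<..}. (f has_vector_derivative f' x) (at x within {0<..}))"
    using holomorphic_deriv[OF F(1) op]
    by (intro exI[of _ "\<lambda>x. deriv F (complex_of_real x)"]) auto
qed (use assms in auto)

lemma smooth_on_affine:
  assumes "smooth_on UNIV f"
  shows "smooth_on UNIV (\<lambda>x. f ((x - a) / d))"
\<comment> \<open>The scalar \<open>k\<close> in the invariant collects the factors
  \<open>1 / d\<close> of the chain rule.\<close>
proof (rule smooth_on_coinduct[where
      P = "\<lambda>h. \<exists>f k. smooth_on UNIV f \<and> h = (\<lambda>x. complex_of_real k * f ((x - a) / d))"])
  show "\<exists>g k. smooth_on UNIV g \<and> (\<lambda>x. f ((x - a) / d)) = (\<lambda>x. complex_of_real k * g ((x - a) / d))"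
    using assms by (intro exI[of _ f] exI[of _ 1]) auto
  fix h assume "\<exists>f k. smooth_on UNIV f \<and> h = (\<lambda>x. complex_of_real k * f ((x - a) / d))"
  then obtain f k where f: "smooth_on UNIV f" and h: "h = (\<lambda>x. complex_of_real k * f ((x - a) / d))"
    by blast
  obtain f' where f': "smooth_on UNIV f'" "\<And>x. (f has_vector_derivative f' x) (at x)"
    using smooth_onD[OF f] by auto
  have "(h has_vector_derivative complex_of_real (k / d) * f' ((x - a) / d)) (at x)" for x
  proof -
    \<comment> \<open>For \<open>d = 0\<close> division returns 0: the function is constant and its
      claimed derivative is 0 as well.\<close>
    have "((\<lambda>x. (x - a) / d) has_real_derivative 1 / d) (at x)"
      by (cases "d = 0") (auto intro!: derivative_eq_intros)
    then have "((\<lambda>x. f ((x - a) / d)) has_vector_derivative (1 / d) *\<^sub>R f' ((x - a) / d)) (at x)"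
      using vector_diff_chain_at[of "\<lambda>x. (x - a) / d" "1 / d" x f "f' ((x - a) / d)"] f'(2)
      by (simp add: o_def has_real_derivative_iff_has_vector_derivative)
    then have "((\<lambda>x. complex_of_real k * f ((x - a) / d)) has_vector_derivative
        complex_of_real k * ((1 / d) *\<^sub>R f' ((x - a) / d))) (at x)"
      by (rule has_vector_derivative_mult_right)
    then show ?thesis unfolding h by (simp add: scaleR_conv_of_real field_simps)
  qed
  then show "\<exists>g. (\<exists>f k. smooth_on UNIV f \<and> g = (\<lambda>x. complex_of_real k * f ((x - a) / d))) \<and>
      (\<forall>x\<in>UNIV. (h has_vector_derivative g x) (at x))"
    using f'(1) by (intro exI[of _ "\<lambda>x. complex_of_real (k / d) * f' ((x - a) / d)"] conjI
        exI[of _ f'] exI[of _ "k / d"]) auto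
qed

text \<open>The switch at \<open>e / 2\<close> lies inside the interval where \<open>f\<close> is
  constant, so every point has a neighbourhood on which the new function is either constant or equal
  to \<open>f\<close>. Its derivative has the same form, with constant 0, which closes the
  coinduction.\<close>

lemma smooth_on_extend_const:
  fixes e :: real
  assumes "smooth_on {0<..} f" "0 < e" "\<And>x. 0 < x \<Longrightarrow> x < e \<Longrightarrow> f x = c"
  shows "smooth_on UNIV (\<lambda>x. if x < e / 2 then c else f x)"
proof (rule smooth_on_coinduct[where
      P = "\<lambda>h. \<exists>f c. smooth_on {0<..} f \<and> (\<forall>x. 0 < x \<longrightarrow> x < e \<longrightarrow> f x = c) \<and>
        h = (\<lambda>x. if x < e / 2 then c else f x)"])
  fix h assume "\<exists>f c. smooth_on {0<..} f \<and> (\<forall>x. 0 < x \<longrightarrow> x < e \<longrightarrow> f x = c) \<and>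
        h = (\<lambda>x. if x < e / 2 then c else f x)"
  then obtain f c where f: "smooth_on {0<..} f" and c: "\<And>x. 0 < x \<Longrightarrow> x < e \<Longrightarrow> f x = c"
    and h: "h = (\<lambda>x. if x < e / 2 then c else f x)" by blast
  obtain f' where f': "smooth_on {0<..} f'"
    "\<And>x. 0 < x \<Longrightarrow> (f has_vector_derivative f' x) (at x)"
    using smooth_onD[OF f] by (metis at_within_open greaterThan_iff open_greaterThan)
  have f'0: "f' x = 0" if "0 < x" "x < e" for x
  proof -
    have "(f has_vector_derivative 0) (at x)"
      by (rule has_vector_derivative_transform_within_open[of "\<lambda>_. c" 0 x "{0<..<e}"])
        (use that c in auto)
    then show ?thesis using f'(2) that vector_derivative_unique_at by blast
  qed
  have "(h has_vector_derivative (if x < e / 2 then 0 else f' x)) (at x)" for x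
  proof (cases "x < e / 2")
    case True
    have "(h has_vector_derivative 0) (at x)"
      by (rule has_vector_derivative_transform_within_open[of "\<lambda>_. c" 0 x "{..<e/2}"])
        (use True in \<open>auto simp: h\<close>)
    then show ?thesis using True by simp
  next
    case False
    then have x: "0 < x" using \<open>0 < e\<close> by auto
    have "(h has_vector_derivative f' x) (at x)"
      by (rule has_vector_derivative_transform_within_open[OF f'(2), of x "{0<..}"])
        (use x c \<open>0 < e\<close> in \<open>auto simp: h\<close>)
    then show ?thesis using False by simp
  qed
  then show "\<exists>g. (\<exists>f c. smooth_on {0<..} f \<and> (\<forall>x. 0 < x \<longrightarrow> x < e \<longrightarrow> f x = c) \<and>
        g = (\<lambda>x. if x < e / 2 then c else f x)) \<and> (\<forall>x\<in>UNIV. (h has_vector_derivative g x) (at x))"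
    using f'(1) f'0 by (intro exI[of _ "\<lambda>x. if x < e / 2 then 0 else f' x"]) auto
qed (use assms in auto)

section \<open>Test functions as smooth functions vanishing outside a compact interval of the open
  half-line\<close>

lemma test_functions_iff:
  "\<phi> \<in> test_functions \<longleftrightarrow>
     smooth_on {0<..} \<phi> \<and> (\<exists>a b. 0 < a \<and> a < b \<and> (\<forall>x>0. x \<notin> {a..b} \<longrightarrow> \<phi> x = 0))"
proof -
  let ?A = "{x \<in> {0<..}. \<phi> x \<noteq> 0}"
  have "\<exists>a b. 0 < a \<and> a < b \<and> (\<forall>x>0. x \<notin> {a..b} \<longrightarrow> \<phi> x = 0)"
    if K: "compact (closure ?A)" "closure ?A \<subseteq> {0<..}"
  proof (cases "?A = {}")
    case True
    then show ?thesis by (intro exI[of _ 1] exI[of _ 2]) auto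
  next
    case False
    then have "closure ?A \<noteq> {}" by simp
    from compact_attains_inf[OF K(1) this] obtain a
      where a: "a \<in> closure ?A" "\<And>x. x \<in> closure ?A \<Longrightarrow> a \<le> x" by blast
    from compact_attains_sup[OF K(1) \<open>closure ?A \<noteq> {}\<close>] obtain b
      where b: "b \<in> closure ?A" "\<And>x. x \<in> closure ?A \<Longrightarrow> x \<le> b" by blast
    \<comment> \<open>The minimum \<open>a\<close> and the maximum \<open>b\<close> of the support
      are only known to satisfy \<open>a \<le> b\<close>; passing to \<open>b + 1\<close> gives the
      strict inequality.\<close>
    have "\<phi> x = 0" if "0 < x" "x \<notin> {a..b+1}" for x
    proof (rule ccontr)
      assume "\<phi> x \<noteq> 0"
      then have "x \<in> closure ?A" using closure_subset[of ?A] that by blast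
      then show False using a(2)[of x] b(2)[of x] that by auto
    qed
    moreover have "0 < a" "a < b + 1" using K(2) a(1) a(2)[OF b(1)] by auto
    ultimately show ?thesis by blast
  qed
  moreover have "compact (closure ?A) \<and> closure ?A \<subseteq> {0<..}"
    if "0 < a" "\<And>x. x > 0 \<Longrightarrow> x \<notin> {a..b} \<Longrightarrow> \<phi> x = 0" for a b
  proof -
    have A: "?A \<subseteq> {a..b}" using that(2) by blast
    then have "closure ?A \<subseteq> {a..b}" by (rule closure_minimal) simp
    moreover have "bounded ?A" using A bounded_closed_interval bounded_subset by blast
    ultimately show ?thesis using \<open>0 < a\<close> by auto
  qed
  ultimately show ?thesis unfolding smooth_compact_support_def by blast
qed

lemma test_functionsE:
  assumes "\<phi> \<in> test_functions"
  obtains a b where "0 < a" "a < b" "\<And>x. 0 < x \<Longrightarrow> x \<notin> {a..b} \<Longrightarrow> \<phi> x = 0" "smooth_on {0<..} \<phi>"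
  using assms unfolding test_functions_iff by blast

lemma test_functionsI:
  assumes "smooth_on {0<..} \<phi>" "0 < a" "a < b" "\<And>x. 0 < x \<Longrightarrow> x \<notin> {a..b} \<Longrightarrow> \<phi> x = 0"
  shows "\<phi> \<in> test_functions"
  using assms unfolding test_functions_iff by blast

section \<open>Locally integrable functions\<close>

text \<open>The intervals stay away from zero because test functions vanish near zero. This admits
  the weight \<open>1 / x\<^sup>2\<close> and any other function continuous on the open half-line as
  a factor.\<close>

definition locally_integrable :: "(real \<Rightarrow> complex) \<Rightarrow> bool" where
  "locally_integrable w \<longleftrightarrow>
     w \<in> borel_measurable half_line \<and> (\<forall>a b. 0 < a \<longrightarrow> set_integrable half_line {a..b} w)"

lemma half_line_Icc_sets: "0 < a \<Longrightarrow> {a..b} \<in> sets half_line"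
  by (simp add: sets_restrict_space_iff subset_iff)

lemma finite_half_line_Icc:
  assumes "0 < a"
  shows "emeasure half_line {a..b} < \<infinity>"
  using assms
  by (subst emeasure_restrict_space) (auto simp: subset_iff emeasure_lborel_Icc_eq)

lemma set_integrable_const_half_line:
  fixes c :: "'b::{banach, second_countable_topology}"
  assumes "0 < a"
  shows "set_integrable half_line {a..b} (\<lambda>_. c)"
  unfolding set_integrable_def
  using assms half_line_Icc_sets[OF assms, of b] finite_half_line_Icc[OF assms, of b]
  by (intro integrable_scaleR_left integrable_real_indicator) auto

lemma continuous_on_half_line_measurable [intro]:
  fixes f :: "real \<Rightarrow> 'b::{second_countable_topology, topological_space, euclidean_space}"
  assumes "continuous_on {0<..} f"
  shows "f \<in> borel_measurable half_line"
  by (rule continuous_imp_measurable_on_sets_lebesgue) (use assms in auto)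

lemma locally_integrable_mult_continuous:
  assumes w: "locally_integrable w" and f: "continuous_on {0<..} f"
  shows "locally_integrable (\<lambda>x. w x * f x)"
  unfolding locally_integrable_def
proof (intro conjI allI impI)
  have [measurable]: "w \<in> borel_measurable half_line" "f \<in> borel_measurable half_line"
    using w f by (auto simp: locally_integrable_def)
  show "(\<lambda>x. w x * f x) \<in> borel_measurable half_line" by measurable
  fix a b :: real assume a: "0 < a"
  have [measurable]: "{a..b} \<in> sets half_line" using a by (rule half_line_Icc_sets)
  have "bounded (f ` {a..b})"
    by (rule compact_imp_bounded, rule compact_continuous_image)
      (use a in \<open>auto intro: continuous_on_subset[OF f]\<close>)
  then obtain B where B: "\<And>x. x \<in> {a..b} \<Longrightarrow> norm (f x) \<le> B"
    unfolding bounded_iff by blast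
  have "integrable half_line (\<lambda>x. B *\<^sub>R norm (indicator {a..b} x *\<^sub>R w x))"
    using w a unfolding locally_integrable_def set_integrable_def
    by (intro integrable_scaleR_right integrable_norm) auto
  then show "set_integrable half_line {a..b} (\<lambda>x. w x * f x)"
    unfolding set_integrable_def
  proof (rule Bochner_Integration.integrable_bound)
    show "AE x in half_line. norm (indicat_real {a..b} x *\<^sub>R (w x * f x))
         \<le> norm (B *\<^sub>R norm (indicator {a..b} x *\<^sub>R w x))"
    proof (rule AE_I2)
      fix x
      show "norm (indicat_real {a..b} x *\<^sub>R (w x * f x)) \<le> norm (B *\<^sub>R norm (indicator {a..b} x *\<^sub>R w x))"
      proof (cases "x \<in> {a..b}")
        case True
        with B[OF True] have "norm (f x) * norm (w x) \<le> \<bar>B\<bar> * norm (w x)"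
          by (intro mult_right_mono) auto
        then show ?thesis using True by (simp add: norm_mult mult.commute)
      qed simp
    qed
  qed measurable
qed

lemma locally_integrable_const: "locally_integrable (\<lambda>_. c)"
  by (simp add: locally_integrable_def set_integrable_const_half_line)

lemma locally_integrable_continuous:
  "continuous_on {0<..} f \<Longrightarrow> locally_integrable f"
  using locally_integrable_mult_continuous[OF locally_integrable_const[of 1]] by simp

lemma locally_integrable_add:
  "locally_integrable f \<Longrightarrow> locally_integrable g \<Longrightarrow> locally_integrable (\<lambda>x. f x + g x)"
  unfolding locally_integrable_def
  by (intro conjI allI impI borel_measurable_add set_integral_add) auto

lemma locally_integrable_scale: "locally_integrable f \<Longrightarrow> locally_integrable (\<lambda>x. c * f x)"
  unfolding locally_integrable_def
  by (intro conjI allI impI borel_measurable_times borel_measurable_const set_integrable_mult_right) auto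

lemma locally_integrable_diff:
  "locally_integrable f \<Longrightarrow> locally_integrable g \<Longrightarrow> locally_integrable (\<lambda>x. f x - g x)"
  unfolding locally_integrable_def
  by (intro conjI allI impI borel_measurable_diff set_integral_diff) auto

lemma square_integrable_imp_locally_integrable:
  assumes "square_integrable f"
  shows "locally_integrable f"
  unfolding locally_integrable_def
proof (intro conjI allI impI)
  show [measurable]: "f \<in> borel_measurable half_line" using assms by (simp add: square_integrable_def)
  fix a b :: real assume a: "0 < a"
  have [measurable]: "{a..b} \<in> sets half_line" using a by (rule half_line_Icc_sets)
  have "integrable half_line (\<lambda>x. indicat_real {a..b} x + (cmod (f x))\<^sup>2)"
    using assms set_integrable_const_half_line[OF a, of b "1::real"]
    by (auto simp: square_integrable_def set_integrable_def)
  then show "set_integrable half_line {a..b} f"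
    unfolding set_integrable_def
  proof (rule Bochner_Integration.integrable_bound)
    have "t \<le> 1 + t\<^sup>2" for t :: real
      using zero_le_power2[of "t - 1/2"] by (simp add: power2_eq_square algebra_simps)
    then show "AE x in half_line. norm (indicat_real {a..b} x *\<^sub>R f x)
        \<le> norm (indicat_real {a..b} x + (cmod (f x))\<^sup>2)"
      by (auto simp: indicator_def)
  qed measurable
qed

lemma locally_integrable_imp_integrable:
  assumes "locally_integrable w" "0 < a" "\<And>x. 0 < x \<Longrightarrow> x \<notin> {a..b} \<Longrightarrow> w x = 0"
  shows "integrable half_line w"
proof -
  have "integrable half_line (\<lambda>x. indicator {a..b} x *\<^sub>R w x)"
    using assms by (simp add: locally_integrable_def set_integrable_def)
  then show ?thesis
    by (rule Bochner_Integration.integrable_cong[THEN iffD1, rotated -1])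
      (use assms(3) in \<open>auto simp: indicator_def\<close>)
qed

lemma integrable_mult_test:
  assumes "locally_integrable w" "\<phi> \<in> test_functions"
  shows "integrable half_line (\<lambda>x. w x * \<phi> x)"
proof -
  obtain a b where ab: "0 < a" "\<And>x. 0 < x \<Longrightarrow> x \<notin> {a..b} \<Longrightarrow> \<phi> x = 0" "smooth_on {0<..} \<phi>"
    using test_functionsE[OF assms(2)] by metis
  show ?thesis
    by (rule locally_integrable_imp_integrable[OF _ ab(1)])
      (use ab in \<open>auto intro!: locally_integrable_mult_continuous assms smooth_on_imp_continuous_on\<close>)
qed

lemma AE_half_line_iff: "(AE x in half_line. P x) \<longleftrightarrow> (AE x in lebesgue. 0 < x \<longrightarrow> P x)"
  by (subst AE_restrict_space_iff) auto

lemma sigma_finite_half_line: "sigma_finite_measure half_line"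
proof
  have "(\<Union>n::nat. {1 / real (Suc n)..real n}) = {0<..}"
  proof (intro equalityI subsetI)
    fix x :: real assume "x \<in> {0<..}"
    moreover obtain n :: nat where "max x (1 / x) < n" using reals_Archimedean2 by blast
    ultimately have "x \<in> {1 / real (Suc n)..real n}" by (auto simp: field_simps)
    then show "x \<in> (\<Union>n::nat. {1 / real (Suc n)..real n})" by blast
  qed (auto intro: less_le_trans[rotated])
  then show "\<exists>A. countable A \<and> A \<subseteq> sets half_line \<and> \<Union> A = space half_line \<and>
      (\<forall>a\<in>A. emeasure half_line a \<noteq> \<infinity>)"
    using finite_half_line_Icc
    by (intro exI[of _ "range (\<lambda>n::nat. {1 / real (Suc n)..real n})"])
      (auto simp: half_line_Icc_sets less_top)
qed

interpretation half_line: sigma_finite_measure half_line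
  by (rule sigma_finite_half_line)

section \<open>The fundamental lemma of the calculus of variations\<close>

text \<open>The half-rays \<open>{..c}\<close> form an intersection-stable generator of the Borel
  sets, so by the pi-lambda theorem all integrals over Borel sets vanish. The integral over the
  whole space has to be assumed for the complements.\<close>

lemma AE_zero_if_integral_Ioc_zero:
  assumes h: "integrable half_line h"
    and zero: "\<And>c. (\<integral>x. indicator {..c} x *\<^sub>R h x \<partial>half_line) = (0::complex)"
    and total: "(\<integral>x. h x \<partial>half_line) = 0"
  shows "AE x in half_line. h x = 0"
proof (rule half_line.density_zero[OF h])
  have [measurable]: "h \<in> borel_measurable half_line" using h by auto
  have sets: "S \<inter> {0<..} \<in> sets half_line" if "S \<in> sets borel" for S :: "real set"
    using that by (auto simp: sets_restrict_space)
  have borel: "(\<integral>x. indicator S x *\<^sub>R h x \<partial>half_line) = 0" if "S \<in> sets borel" for S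
  proof -
    have "sets (borel :: real measure) = sigma_sets UNIV (range (\<lambda>a. {..a}))"
      by (subst borel_eq_atMost) simp
    then have S: "S \<in> sigma_sets UNIV (range (\<lambda>a. {..a}))" using that by simp
    have int: "integrable half_line (\<lambda>x. indicator T x *\<^sub>R h x)" if "T \<in> sets borel" for T :: "real set"
    proof -
      have "integrable half_line (\<lambda>x. indicator (T \<inter> {0<..}) x *\<^sub>R h x)"
        by (rule integrable_mult_indicator[OF sets[OF that] h])
      then show ?thesis
        by (rule Bochner_Integration.integrable_cong[THEN iffD1, rotated -1])
          (auto simp: indicator_def)
    qed
    have "Int_stable (range (\<lambda>a::real. {..a}))" by (auto simp: Int_stable_def intro!: image_eqI)
    from this _ S show ?thesis
    proof (rule sigma_sets_induct_disjoint)
      fix A assume A: "A \<in> sigma_sets UNIV (range (\<lambda>a::real. {..a}))"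
        "(\<integral>x. indicator A x *\<^sub>R h x \<partial>half_line) = 0"
      have Ab: "A \<in> sets borel" using A(1) by (simp add: borel_eq_atMost)
      have "(\<integral>x. indicator (UNIV - A) x *\<^sub>R h x \<partial>half_line)
          = (\<integral>x. h x - indicator A x *\<^sub>R h x \<partial>half_line)"
        by (rule Bochner_Integration.integral_cong) (auto simp: indicator_def)
      also have "\<dots> = 0" using A(2) total h int[OF Ab] by simp
      finally show "(\<integral>x. indicator (UNIV - A) x *\<^sub>R h x \<partial>half_line) = 0" .
    next
      fix A :: "nat \<Rightarrow> real set"
      assume A: "disjoint_family A" "range A \<subseteq> sigma_sets UNIV (range (\<lambda>a::real. {..a}))"
        "\<And>i. (\<integral>x. indicator (A i) x *\<^sub>R h x \<partial>half_line) = 0"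
      have Ab: "A i \<in> sets borel" for i using A(2) by (auto simp: borel_eq_atMost)
      let ?B = "\<lambda>i. A i \<inter> {0<..}"
      have "(LINT x:(\<Union>i. ?B i)|half_line. h x) = (\<Sum>i. (LINT x:(?B i)|half_line. h x))"
      proof (rule lebesgue_integral_countable_add)
        show "?B i \<in> sets half_line" for i using Ab sets by blast
        show "i \<noteq> j \<Longrightarrow> ?B i \<inter> ?B j = {}" for i j
          using A(1) by (auto simp: disjoint_family_on_def)
        have "(\<Union>i. ?B i) \<in> sets half_line" using Ab sets by (intro sets.countable_UN) blast
        then show "set_integrable half_line (\<Union>i. ?B i) h"
          unfolding set_integrable_def by (rule integrable_mult_indicator[OF _ h])
      qed
      moreover have "(LINT x:(T \<inter> {0<..})|half_line. h x) = (\<integral>x. indicator T x *\<^sub>R h x \<partial>half_line)" for T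
        unfolding set_lebesgue_integral_def
        by (rule Bochner_Integration.integral_cong) (auto simp: indicator_def)
      moreover have "(\<Union>i. ?B i) = (\<Union>i. A i) \<inter> {0<..}" by auto
      ultimately show "(\<integral>x. indicator (\<Union>i. A i) x *\<^sub>R h x \<partial>half_line) = 0"
        by (simp only: A(3) suminf_zero)
    qed (use zero in auto)
  qed
  fix A assume A: "A \<in> sets half_line"
  then have "A \<in> sets lebesgue" by (auto simp: sets_restrict_space)
  \<comment> \<open>A Lebesgue set differs from a Borel set by a null set, so the Borel case
    suffices.\<close>
  then obtain S N N' where S: "A = S \<union> N" "N \<subseteq> N'" "N' \<in> null_sets lborel" "S \<in> sets lborel"
    by (rule sets_completionE)
  have "AE x in lebesgue. x \<notin> N'" by (rule AE_not_in) (use S in \<open>auto intro: null_sets_completionI\<close>)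
  then have "AE x in half_line. x \<notin> N'" by (auto simp: AE_half_line_iff)
  moreover have "S \<in> sets borel" using S(4) by simp
  ultimately have "set_lebesgue_integral half_line A h = (\<integral>x. indicator (S \<inter> {0<..}) x *\<^sub>R h x \<partial>half_line)"
    unfolding set_lebesgue_integral_def
  proof (intro integral_cong_AE)
    have [measurable]: "A \<in> sets half_line" "S \<inter> {0<..} \<in> sets half_line"
      using A sets S(4) by auto
    show "(\<lambda>x. indicat_real A x *\<^sub>R h x) \<in> borel_measurable half_line" by measurable
    show "(\<lambda>x. indicat_real (S \<inter> {0<..}) x *\<^sub>R h x) \<in> borel_measurable half_line" by measurable
    assume "AE x in half_line. x \<notin> N'"
    moreover have "AE x in half_line. 0 < x" by (rule AE_I2) simp
    ultimately show "AE x in half_line. indicator A x *\<^sub>R h x = indicator (S \<inter> {0<..}) x *\<^sub>R h x"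
      by eventually_elim (use S in \<open>auto simp: indicator_def\<close>)
  qed
  also have "\<dots> = 0" using borel[of "S \<inter> {0<..}"] S(4) by simp
  finally show "set_lebesgue_integral half_line A h = 0" .
qed

text \<open>Besides cutting off the solutions, \<open>\<xi>\<close> supplies the profile of the
  smooth steps in the fundamental lemma, so no bump function has to be constructed.\<close>

locale cutoff =
  fixes \<xi> :: "real \<Rightarrow> complex" and \<epsilon> R :: real
  assumes smooth: "smooth_on {0<..} \<xi>"
    and eps: "0 < \<epsilon>" "\<epsilon> < R"
    and one: "\<And>x. 0 < x \<Longrightarrow> x < \<epsilon> \<Longrightarrow> \<xi> x = 1"
    and zero: "\<And>x. R \<le> x \<Longrightarrow> \<xi> x = 0"
begin

lemma bounded: obtains B where "0 < B" "\<And>x. 0 < x \<Longrightarrow> norm (\<xi> x) \<le> B"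
proof -
  have "bounded (\<xi> ` {\<epsilon>..R})"
    by (rule compact_imp_bounded, rule compact_continuous_image)
      (use eps in \<open>auto intro: continuous_on_subset[OF smooth_on_imp_continuous_on[OF smooth]]\<close>)
  then obtain B where B: "\<And>x. x \<in> {\<epsilon>..R} \<Longrightarrow> norm (\<xi> x) \<le> B" unfolding bounded_iff by blast
  have "norm (\<xi> x) \<le> max B 1" if "0 < x" for x
    using B[of x] one[of x] zero[of x] that by (cases "x < \<epsilon>"; cases "x > R") auto
  then show thesis by (intro that[of "max B 1"]) auto
qed

text \<open>Smooth steps that are rescalings of \<open>\<xi>\<close> converge boundedly to
  indicators of half-rays. Differences of two of them are test functions, so all integrals of
  \<open>w\<close> over intervals (a, b] with a > 0 vanish, and these determine \<open>w\<close>
  almost everywhere.\<close>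

lemma fundamental_lemma:
  assumes w: "locally_integrable w"
    and orth: "\<And>\<phi>. \<phi> \<in> test_functions \<Longrightarrow> (\<integral>x. w x * \<phi> x \<partial>half_line) = 0"
  shows "AE x in half_line. w x = 0"
proof -
  have [measurable]: "w \<in> borel_measurable half_line" using w by (simp add: locally_integrable_def)
  \<comment> \<open>The extension of \<open>\<xi>\<close> to the whole line by the value 1, needed
    because the steps are translates.\<close>
  define \<eta> where "\<eta> x = (if x < \<epsilon> / 2 then 1 else \<xi> x)" for x
  have \<eta>_smooth: "smooth_on UNIV \<eta>"
    unfolding \<eta>_def by (rule smooth_on_extend_const[OF smooth]) (use eps one in auto)
  obtain B where B: "0 < B" "\<And>x. 0 < x \<Longrightarrow> norm (\<xi> x) \<le> B" using bounded by blast
  have \<eta>B: "norm (\<eta> x) \<le> B + 1" for x using B eps by (auto simp: \<eta>_def intro: order_trans[OF B(2)])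
  have \<eta>1: "\<eta> x = 1" if "x \<le> 0" for x using that eps by (simp add: \<eta>_def)
  have \<eta>0: "\<eta> x = 0" if "R \<le> x" for x using that eps zero by (simp add: \<eta>_def)
  \<comment> \<open>The profile is compressed towards \<open>c\<close>: the value is 1 up to
    \<open>c\<close> and 0 from \<open>c + R / Suc n\<close> on, so the pointwise limit is the
    indicator of \<open>{..c}\<close>. The quotient form fits
    \<open>smooth_on_affine\<close>.\<close>
  define e where "e n c x = \<eta> ((x - c) / (1 / real (Suc n)))" for n c x
  have eB: "norm (e n c x) \<le> B + 1" for n c x unfolding e_def by (rule \<eta>B)
  have e_lim: "(\<lambda>n. e n c x) \<longlonglongrightarrow> indicator {..c} x" for c x
  proof (cases "x \<le> c")
    case True
    then have "e n c x = 1" for n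
      unfolding e_def by (intro \<eta>1) (simp add: mult_nonpos_nonneg)
    then show ?thesis using True by simp
  next
    case False
    obtain N :: nat where N: "R / (x - c) < N" using reals_Archimedean2 by blast
    have "e n c x = 0" if "N \<le> n" for n
    proof -
      have "R / (x - c) \<le> real (Suc n)" using N that by linarith
      then show ?thesis unfolding e_def
        using False by (intro \<eta>0) (simp add: field_simps)
    qed
    then show ?thesis using False
      by (intro tendsto_eventually) (auto simp: eventually_sequentially)
  qed
  have Ioc: "(\<integral>x. (indicator {..b} x - indicator {..a} x) * w x \<partial>half_line) = 0"
    if ab: "0 < a" "a \<le> b" for a b :: real
  proof -
    let ?e = "\<lambda>n x. e n b x - e n a x"
    have supp: "?e n x = 0" if "0 < x" "x \<notin> {a..b + R}" for n x
    proof (cases "x < a")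
      case True
      then show ?thesis using ab unfolding e_def
        by (subst (1 2) \<eta>1) (auto simp: mult_nonpos_nonneg)
    next
      case False
      then have x: "b + R < x" using that by auto
      have "R \<le> (x - c) / (1 / real (Suc n))" if "c \<le> b" for c
      proof -
        have "R \<le> (x - c) * 1" using x that by simp
        also have "\<dots> \<le> (x - c) * real (Suc n)" using x that eps by (intro mult_left_mono) auto
        finally show ?thesis by simp
      qed
      then show ?thesis using ab by (simp add: e_def \<eta>0)
    qed
    have smooth_e: "smooth_on {0<..} (?e n)" for n
      unfolding e_def
      by (intro smooth_on_diff smooth_on_subset[OF smooth_on_affine[OF \<eta>_smooth]]) auto
    have test: "?e n \<in> test_functions" for n
      unfolding test_functions_iff using supp smooth_e ab eps
      by (intro conjI exI[of _ a] exI[of _ "b + R"]) auto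
    have "(\<lambda>n. \<integral>x. w x * ?e n x \<partial>half_line)
        \<longlonglongrightarrow> (\<integral>x. w x * (indicator {..b} x - indicator {..a} x) \<partial>half_line)"
    proof (rule integral_dominated_convergence)
      have [measurable]: "?e n \<in> borel_measurable half_line" for n
        by (rule continuous_on_half_line_measurable) (intro smooth_on_imp_continuous_on smooth_e)
      show "(\<lambda>x. w x * ?e n x) \<in> borel_measurable half_line" for n by measurable
      have "(\<lambda>x. indicator {..c} x) \<in> borel_measurable half_line" for c :: real
        by (rule measurable_restrict_space1[OF measurable_completion]) measurable
      then show "(\<lambda>x. w x * (indicator {..b} x - indicator {..a} x)) \<in> borel_measurable half_line"
        by measurable
      show "integrable half_line (\<lambda>x. (2 * (B + 1)) * norm (indicator {a..b + R} x *\<^sub>R w x))"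
        using w ab by (intro integrable_mult_right integrable_norm)
          (auto simp: locally_integrable_def set_integrable_def)
      show "AE x in half_line. (\<lambda>n. w x * ?e n x) \<longlonglongrightarrow> w x * (indicator {..b} x - indicator {..a} x)"
        by (intro AE_I2 tendsto_intros e_lim)
      have "norm (w x * ?e n x) \<le> (2 * (B + 1)) * norm (indicator {a..b + R} x *\<^sub>R w x)" if "0 < x" for n x
      proof (cases "x \<in> {a..b + R}")
        case True
        have "norm (?e n x) \<le> 2 * (B + 1)"
          using order_trans[OF norm_triangle_ineq4 add_mono[OF eB eB]] by (simp add: algebra_simps)
        then have "norm (?e n x) * norm (w x) \<le> 2 * (B + 1) * norm (w x)" by (rule mult_right_mono) simp
        then show ?thesis using True by (simp add: norm_mult mult.commute)
      next
        case False
        then show ?thesis using supp[OF that] by simp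
      qed
      then show "AE x in half_line. norm (w x * ?e n x) \<le> (2 * (B + 1)) * norm (indicator {a..b + R} x *\<^sub>R w x)" for n
        by (intro AE_I2) simp
    qed
    then have "(\<integral>x. w x * (indicator {..b} x - indicator {..a} x) \<partial>half_line) = 0"
      by (simp add: orth[OF test] LIMSEQ_const_iff)
    then show ?thesis by (simp add: mult.commute)
  qed
  have AE: "AE x in half_line. (indicator {..b} x - indicator {..a} x) * w x = 0"
    if ab: "0 < a" "a \<le> b" for a b :: real
  proof (rule AE_zero_if_integral_Ioc_zero)
    have "integrable half_line (\<lambda>x. indicator {a..b} x *\<^sub>R w x)"
      using w ab by (auto simp: locally_integrable_def set_integrable_def)
    moreover have [measurable]: "(indicator {..c} :: real \<Rightarrow> complex) \<in> borel_measurable half_line" for c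
      by (rule measurable_restrict_space1[OF measurable_completion]) measurable
    have "(\<lambda>x. (indicator {..b} x - indicator {..a} x) * w x) \<in> borel_measurable half_line"
      by measurable
    ultimately show "integrable half_line (\<lambda>x. (indicator {..b} x - indicator {..a} x) * w x)"
      by (rule Bochner_Integration.integrable_bound) (use ab in \<open>auto simp: indicator_def\<close>)
    fix c :: real
    \<comment> \<open>Cutting (a, b] at \<open>c\<close> leaves an interval with right end
      \<open>max a (min b c)\<close>, which is empty for \<open>c \<le> a\<close>.\<close>
    have "(\<integral>x. indicator {..c} x *\<^sub>R ((indicator {..b} x - indicator {..a} x) * w x) \<partial>half_line)
      = (\<integral>x. (indicator {..max a (min b c)} x - indicator {..a} x) * w x \<partial>half_line)"
      using ab by (intro Bochner_Integration.integral_cong) (auto simp: indicator_def)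
    also have "\<dots> = 0" by (rule Ioc) (use ab in auto)
    finally show "(\<integral>x. indicator {..c} x *\<^sub>R ((indicator {..b} x - indicator {..a} x) * w x) \<partial>half_line) = 0" .
  qed (rule Ioc[OF ab])
  \<comment> \<open>Countably many of these intervals exhaust the half-line, so one null set serves
    for all.\<close>
  have "AE x in half_line. \<forall>n. (indicator {..real (Suc n)} x - indicator {..1 / real (Suc n)} x) * w x = 0"
    unfolding AE_all_countable
  proof
    fix n :: nat
    have "1 / real (Suc n) \<le> 1" by simp
    also have "\<dots> \<le> real (Suc n)" by simp
    finally show "AE x in half_line. (indicator {..real (Suc n)} x - indicator {..1 / real (Suc n)} x) * w x = 0"
      by (intro AE) simp
  qed
  moreover have "AE x in half_line. 0 < x" by (rule AE_I2) simp
  ultimately show ?thesis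
  proof eventually_elim
    case (elim x)
    obtain n :: nat where n: "max x (1 / x) < n" using reals_Archimedean2 by blast
    then have "x \<le> real (Suc n)" "1 / real (Suc n) < x" using elim(2) by (auto simp: field_simps)
    then show ?case using elim(1)[rule_format, of n] by simp
  qed
qed

end

section \<open>The Bessel expression\<close>

text \<open>The differential expression in the classical sense. Being formally symmetric, it is also
  what appears on the test function when the distributional expression is transposed.\<close>

definition bessel :: "complex \<Rightarrow> (real \<Rightarrow> complex) \<Rightarrow> real \<Rightarrow> complex" where
  "bessel \<alpha> \<phi> x = - vector_derivative (\<lambda>x. vector_derivative \<phi> (at x)) (at x)
     + (\<alpha> - 1/4) * (1 / (complex_of_real x)\<^sup>2) * \<phi> x"

lemma vector_derivative_cong_half_line:
  assumes "\<And>x. 0 < x \<Longrightarrow> f x = g x" "0 < x"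
  shows "vector_derivative f (at x) = vector_derivative g (at x)"
proof -
  have "(f has_vector_derivative d) (at x) \<longleftrightarrow> (g has_vector_derivative d) (at x)" for d
    using has_vector_derivative_transform_within_open[of f d x "{0<..}" g]
      has_vector_derivative_transform_within_open[of g d x "{0<..}" f] assms
    by auto
  then show ?thesis by (simp add: vector_derivative_def)
qed

lemma smooth_half_lineD:
  assumes "smooth_on {0<..} f"
  shows "smooth_on {0<..} (\<lambda>x. vector_derivative f (at x))"
    and "\<And>x. 0 < x \<Longrightarrow> (f has_vector_derivative vector_derivative f (at x)) (at x)"
proof -
  obtain f' where f': "smooth_on {0<..} f'"
    "\<And>x. x \<in> {0<..} \<Longrightarrow> (f has_vector_derivative f' x) (at x within {0<..})"
    by (rule smooth_onD[OF assms]) (rule that)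
  have d: "(f has_vector_derivative f' x) (at x)" if "0 < x" for x
    using f'(2)[of x] that at_within_open[of x "{0<..}"] by simp
  then have eq: "vector_derivative f (at x) = f' x" if "0 < x" for x
    using that vector_derivative_at by blast
  show "smooth_on {0<..} (\<lambda>x. vector_derivative f (at x))"
    by (rule smooth_on_cong[OF f'(1)]) (simp add: eq)
  show "0 < x \<Longrightarrow> (f has_vector_derivative vector_derivative f (at x)) (at x)" for x
    using d eq by simp
qed

lemma bessel_eq:
  assumes "\<And>x. 0 < x \<Longrightarrow> (f has_vector_derivative f' x) (at x)"
    and "\<And>x. 0 < x \<Longrightarrow> (f' has_vector_derivative f'' x) (at x)" and "0 < x"
  shows "bessel \<alpha> f x = - f'' x + (\<alpha> - 1/4) * (1 / (complex_of_real x)\<^sup>2) * f x"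
proof -
  have "vector_derivative f (at x) = f' x" if "0 < x" for x
    using assms(1)[OF that] vector_derivative_at by blast
  then have "vector_derivative (\<lambda>x. vector_derivative f (at x)) (at x) = vector_derivative f' (at x)"
    using assms(3) by (rule vector_derivative_cong_half_line)
  also have "\<dots> = f'' x" using assms(2)[OF assms(3)] vector_derivative_at by blast
  finally show ?thesis by (simp add: bessel_def)
qed

lemma smooth_inverse_square: "smooth_on {0<..} (\<lambda>x. 1 / (complex_of_real x)\<^sup>2)"
  by (rule smooth_on_holomorphic[where F = "\<lambda>w. 1 / w\<^sup>2"]) (auto intro!: holomorphic_intros)

lemma smooth_bessel:
  assumes "smooth_on {0<..} f"
  shows "smooth_on {0<..} (bessel \<alpha> f)"
  unfolding bessel_def
  by (rule smooth_on_add[OF smooth_on_uminus[OF smooth_half_lineD(1)[OF smooth_half_lineD(1)[OF assms]]]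
    smooth_on_mult[OF smooth_on_mult[OF smooth_on_const smooth_inverse_square] assms]])

lemma vector_derivative_zero_open:
  assumes "open S" "\<And>x. x \<in> S \<Longrightarrow> f x = c" "x \<in> S"
  shows "vector_derivative f (at x) = 0"
proof (rule vector_derivative_at)
  show "(f has_vector_derivative 0) (at x)"
    by (rule has_vector_derivative_transform_within_open[OF has_vector_derivative_const[of c] assms(1,3)])
      (simp add: assms(2))
qed

lemma vector_derivative_zero_outside:
  assumes "\<And>x. 0 < x \<Longrightarrow> x \<notin> {a..b} \<Longrightarrow> f x = 0" "0 < x" "x \<notin> {a..b}"
  shows "vector_derivative f (at x) = 0"
  by (rule vector_derivative_zero_open[where S = "{0<..} - {a..b}" and c = 0])
    (use assms in \<open>auto intro: open_Diff\<close>)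

lemma vector_derivative_test:
  assumes "\<phi> \<in> test_functions"
  shows "(\<lambda>x. vector_derivative \<phi> (at x)) \<in> test_functions"
proof -
  obtain a b where ab: "0 < a" "a < b" "\<And>x. 0 < x \<Longrightarrow> x \<notin> {a..b} \<Longrightarrow> \<phi> x = 0" "smooth_on {0<..} \<phi>"
    using test_functionsE[OF assms] by metis
  show ?thesis
    by (rule test_functionsI[OF smooth_half_lineD(1)[OF ab(4)] ab(1,2)])
      (rule vector_derivative_zero_outside[OF ab(3)])
qed

lemma mult_test:
  assumes "\<phi> \<in> test_functions" "smooth_on {0<..} f"
  shows "(\<lambda>x. f x * \<phi> x) \<in> test_functions"
proof -
  obtain a b where "0 < a" "a < b" "\<And>x. 0 < x \<Longrightarrow> x \<notin> {a..b} \<Longrightarrow> \<phi> x = 0" "smooth_on {0<..} \<phi>"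
    using test_functionsE[OF assms(1)] by metis
  then show ?thesis
    by (intro test_functionsI[OF smooth_on_mult[OF assms(2)], of _ a b]) auto
qed

lemma add_test:
  assumes "\<phi> \<in> test_functions" "\<psi> \<in> test_functions"
  shows "(\<lambda>x. \<phi> x + \<psi> x) \<in> test_functions"
proof -
  obtain a b where 1: "0 < a" "a < b" "\<And>x. 0 < x \<Longrightarrow> x \<notin> {a..b} \<Longrightarrow> \<phi> x = 0" "smooth_on {0<..} \<phi>"
    using test_functionsE[OF assms(1)] by metis
  obtain c d where 2: "0 < c" "c < d" "\<And>x. 0 < x \<Longrightarrow> x \<notin> {c..d} \<Longrightarrow> \<psi> x = 0" "smooth_on {0<..} \<psi>"
    using test_functionsE[OF assms(2)] by metis
  show ?thesis
  proof (rule test_functionsI[OF smooth_on_add[OF 1(4) 2(4)], of "min a c" "max b d"])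
    fix x assume x: "0 < x" "x \<notin> {min a c..max b d}"
    then have n: "x \<notin> {a..b}" "x \<notin> {c..d}" by auto
    show "\<phi> x + \<psi> x = 0" unfolding 1(3)[OF x(1) n(1)] 2(3)[OF x(1) n(2)] by simp
  qed (use 1(1,2) 2(1,2) in auto)
qed

lemma scale_test: "\<phi> \<in> test_functions \<Longrightarrow> (\<lambda>x. c * \<phi> x) \<in> test_functions"
  by (rule mult_test[OF _ smooth_on_const])

lemma bessel_test:
  assumes "\<phi> \<in> test_functions"
  shows "bessel \<alpha> \<phi> \<in> test_functions"
proof -
  have "(\<lambda>x. (-1) * vector_derivative (\<lambda>x. vector_derivative \<phi> (at x)) (at x)
      + ((\<alpha> - 1/4) * (1 / (complex_of_real x)\<^sup>2)) * \<phi> x) \<in> test_functions"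
    by (rule add_test[OF scale_test[OF vector_derivative_test[OF vector_derivative_test[OF assms]]]
      mult_test[OF assms smooth_on_mult[OF smooth_on_const smooth_inverse_square]]])
  then show ?thesis by (simp add: bessel_def[abs_def])
qed

section \<open>Classes and representatives, and \<open>L_max\<close> as a condition on
  integrals\<close>

lemma abs_L2_eqI:
  assumes "square_integrable f" "square_integrable g" "AE x in half_line. f x = g x"
  shows "abs_L2 f = abs_L2 g"
  using assms by (intro Quotient3_rel_abs[OF Quotient3_L2]) (simp add: L2_rel_def)

lemma AE_rep_abs_L2:
  assumes "square_integrable f"
  shows "AE x in half_line. rep_L2 (abs_L2 f) x = f x"
  using Quotient3_rep_abs[OF Quotient3_L2, of f] assms by (simp add: L2_rel_def)

lemma L2_eqI:
  assumes "AE x in half_line. rep_L2 u x = rep_L2 v x"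
  shows "u = v"
  using abs_L2_eqI[OF square_integrable_rep square_integrable_rep assms] by (simp add: abs_rep_L2)

lemma abs_L2_add:
  "square_integrable f \<Longrightarrow> square_integrable g \<Longrightarrow> abs_L2 f + abs_L2 g = abs_L2 (\<lambda>x. f x + g x)"
  by (simp add: plus_L2.abs_eq L2_rel_def)

lemma abs_L2_diff:
  "square_integrable f \<Longrightarrow> square_integrable g \<Longrightarrow> abs_L2 f - abs_L2 g = abs_L2 (\<lambda>x. f x - g x)"
  by (simp add: minus_L2.abs_eq L2_rel_def)

lemma abs_L2_scale:
  "square_integrable f \<Longrightarrow> c *\<^sub>C abs_L2 f = abs_L2 (\<lambda>x. c * f x)"
  by (simp add: scaleC_L2.abs_eq L2_rel_def)

lemma square_integrable_cong_AE:
  assumes "square_integrable f" "g \<in> borel_measurable half_line" "AE x in half_line. f x = g x"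
  shows "square_integrable g"
proof -
  have [measurable]: "f \<in> borel_measurable half_line" "g \<in> borel_measurable half_line"
    using assms by (auto simp: square_integrable_def)
  have "integrable half_line (\<lambda>x. (cmod (g x))\<^sup>2) = integrable half_line (\<lambda>x. (cmod (f x))\<^sup>2)"
    by (rule integrable_cong_AE) (use assms(3) in auto)
  then show ?thesis using assms by (simp add: square_integrable_def)
qed

lemma distribution_of_cong:
  assumes "AE x in half_line. rep_L2 f x = g x" "g \<in> borel_measurable half_line" "\<phi> \<in> borel_measurable half_line"
  shows "distribution_of f \<phi> = (\<integral>x. g x * \<phi> x \<partial>half_line)"
proof -
  have [measurable]: "rep_L2 f \<in> borel_measurable half_line" "g \<in> borel_measurable half_line"
    "\<phi> \<in> borel_measurable half_line"
    using square_integrable_rep[of f] assms by (auto simp: square_integrable_def)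
  show ?thesis unfolding distribution_of_def
    by (rule integral_cong_AE) (use assms(1) in auto)
qed

lemma test_measurable: "\<phi> \<in> test_functions \<Longrightarrow> \<phi> \<in> borel_measurable half_line"
  by (erule test_functionsE) (intro continuous_on_half_line_measurable smooth_on_imp_continuous_on)

text \<open>The two signs from the distributional derivatives cancel. Joining the two terms into one
  integral uses that each is integrable by itself, being a locally integrable function times a test
  function.\<close>

lemma L_max_iff:
  "(f, g) \<in> L_max \<alpha> \<longleftrightarrow> (\<forall>\<phi>\<in>test_functions. distribution_of f (bessel \<alpha> \<phi>) = distribution_of g \<phi>)"
proof -
  have "L_expr \<alpha> (distribution_of f) \<phi> = distribution_of f (bessel \<alpha> \<phi>)" if t: "\<phi> \<in> test_functions" for \<phi>
  proof -
    note f = square_integrable_imp_locally_integrable[OF square_integrable_rep[of f]]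
    let ?d = "\<lambda>x. vector_derivative (\<lambda>x. vector_derivative \<phi> (at x)) (at x)"
    let ?v = "\<lambda>x. (\<alpha> - 1/4) * (1 / (complex_of_real x)\<^sup>2) * \<phi> x"
    have 1: "integrable half_line (\<lambda>x. rep_L2 f x * ?d x)"
      by (rule integrable_mult_test[OF f vector_derivative_test[OF vector_derivative_test[OF t]]])
    have 2: "integrable half_line (\<lambda>x. rep_L2 f x * ?v x)"
      by (rule integrable_mult_test[OF f mult_test[OF t smooth_on_mult[OF smooth_on_const smooth_inverse_square]]])
    have "(\<integral>x. rep_L2 f x * bessel \<alpha> \<phi> x \<partial>half_line)
        = (\<integral>x. - (rep_L2 f x * ?d x) + rep_L2 f x * ?v x \<partial>half_line)"
      by (rule Bochner_Integration.integral_cong) (auto simp: bessel_def algebra_simps)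
    also have "\<dots> = - (\<integral>x. rep_L2 f x * ?d x \<partial>half_line) + (\<integral>x. rep_L2 f x * ?v x \<partial>half_line)"
      using 1 2 by simp
    finally show ?thesis
      by (simp add: L_expr_def distribution_deriv_def distribution_mult_def distribution_of_def)
  qed
  then show ?thesis by (auto simp: L_max_def distribution_eq_def)
qed

lemma L_max_abs_iff:
  assumes "square_integrable F" "square_integrable G"
  shows "(abs_L2 F, abs_L2 G) \<in> L_max \<alpha> \<longleftrightarrow>
    (\<forall>\<phi>\<in>test_functions. (\<integral>x. F x * bessel \<alpha> \<phi> x \<partial>half_line) = (\<integral>x. G x * \<phi> x \<partial>half_line))"
proof -
  have "F \<in> borel_measurable half_line" "G \<in> borel_measurable half_line"
    using assms by (auto simp: square_integrable_def)
  then show ?thesis unfolding L_max_iff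
    by (intro ball_cong refl arg_cong2[where f = "(=)"] distribution_of_cong AE_rep_abs_L2 assms
        test_measurable[OF bessel_test]) (auto intro: test_measurable)
qed

text \<open>A bridge from the Lebesgue integral over the half-line to the gauge integral over an
  interval, where the fundamental theorem of calculus applies.\<close>

lemma half_line_integral_eq:
  fixes F :: "real \<Rightarrow> complex"
  assumes "integrable half_line F" "0 < a" "\<And>x. 0 < x \<Longrightarrow> x \<notin> {a..b} \<Longrightarrow> F x = 0"
    and I: "(F has_integral I) {a..b}"
  shows "(\<integral>x. F x \<partial>half_line) = I"
proof -
  have "(F has_integral (\<integral>x. F x \<partial>half_line)) {0<..}"
    by (rule has_integral_integral_lebesgue_on[OF assms(1)]) auto
  moreover have "((\<lambda>x. if x \<in> {a..b} then F x else 0) has_integral I) {0<..}"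
    using I \<open>0 < a\<close> by (subst has_integral_restrict) auto
  then have "(F has_integral I) {0<..}"
    by (rule has_integral_eq[rotated]) (use assms(3) in auto)
  ultimately show ?thesis by (rule has_integral_unique)
qed

text \<open>Lagrange's identity: the potential cancels, and what remains is the derivative of f'g -
  fg'.\<close>

lemma green_identity:
  assumes f: "\<And>x. 0 < x \<Longrightarrow> (f has_vector_derivative f' x) (at x)"
      "\<And>x. 0 < x \<Longrightarrow> (f' has_vector_derivative f'' x) (at x)"
    and g: "\<And>x. 0 < x \<Longrightarrow> (g has_vector_derivative g' x) (at x)"
      "\<And>x. 0 < x \<Longrightarrow> (g' has_vector_derivative g'' x) (at x)"
    and ab: "0 < a" "a \<le> b"
  shows "((\<lambda>x. f x * bessel \<alpha> g x - bessel \<alpha> f x * g x) has_integral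
    (f' b * g b - f b * g' b) - (f' a * g a - f a * g' a)) {a..b}"
proof (rule fundamental_theorem_of_calculus)
  fix x assume "x \<in> {a..b}"
  then have x: "0 < x" using ab by auto
  have "((\<lambda>x. f' x * g x - f x * g' x) has_vector_derivative
      (f' x * g' x + f'' x * g x) - (f x * g'' x + f' x * g' x)) (at x)"
    by (intro has_vector_derivative_diff has_vector_derivative_mult f g x)
  then have "((\<lambda>x. f' x * g x - f x * g' x) has_vector_derivative
      f x * bessel \<alpha> g x - bessel \<alpha> f x * g x) (at x)"
    by (simp add: bessel_eq[OF f x] bessel_eq[OF g x] algebra_simps)
  then show "((\<lambda>x. f' x * g x - f x * g' x) has_vector_derivative
      f x * bessel \<alpha> g x - bessel \<alpha> f x * g x) (at x within {a..b})"
    by (rule has_vector_derivative_at_within)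
qed (rule ab)

lemma integral_bessel_symmetric:
  assumes f: "smooth_on {0<..} f" and t: "\<phi> \<in> test_functions"
  shows "(\<integral>x. f x * bessel \<alpha> \<phi> x \<partial>half_line) = (\<integral>x. bessel \<alpha> f x * \<phi> x \<partial>half_line)"
proof -
  obtain a b where ab: "0 < a" "a < b" "\<And>x. 0 < x \<Longrightarrow> x \<notin> {a..b} \<Longrightarrow> \<phi> x = 0" and s: "smooth_on {0<..} \<phi>"
    using test_functionsE[OF t] by metis
  let ?d = "\<lambda>h x. vector_derivative h (at x)"
  have d0: "?d \<phi> x = 0" if "0 < x" "x \<notin> {a..b}" for x
    by (rule vector_derivative_zero_outside[OF ab(3) that])
  have dd0: "?d (?d \<phi>) x = 0" if "0 < x" "x \<notin> {a..b}" for x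
    by (rule vector_derivative_zero_outside[OF d0 that])
  have I1: "integrable half_line (\<lambda>x. f x * bessel \<alpha> \<phi> x)"
    by (intro integrable_mult_test locally_integrable_continuous smooth_on_imp_continuous_on f bessel_test t)
  have I2: "integrable half_line (\<lambda>x. bessel \<alpha> f x * \<phi> x)"
    by (intro integrable_mult_test locally_integrable_continuous smooth_on_imp_continuous_on f smooth_bessel t)
  have "(\<integral>x. f x * bessel \<alpha> \<phi> x - bessel \<alpha> f x * \<phi> x \<partial>half_line) = 0"
  proof (rule half_line_integral_eq)
    show "integrable half_line (\<lambda>x. f x * bessel \<alpha> \<phi> x - bessel \<alpha> f x * \<phi> x)"
      using I1 I2 by simp
    \<comment> \<open>The interval is widened to \<open>{a / 2..b + 1}\<close> so that its endpoints
      lie outside \<open>{a..b}\<close> and all boundary terms vanish.\<close>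
    show "0 < a / 2" using ab by simp
    show "f x * bessel \<alpha> \<phi> x - bessel \<alpha> f x * \<phi> x = 0" if "0 < x" "x \<notin> {a / 2..b + 1}" for x
    proof -
      have x: "x \<notin> {a..b}" using that ab(1) by auto
      show ?thesis unfolding bessel_def dd0[OF that(1) x] ab(3)[OF that(1) x] by simp
    qed
    have G: "((\<lambda>x. f x * bessel \<alpha> \<phi> x - bessel \<alpha> f x * \<phi> x) has_integral
       (?d f (b+1) * \<phi> (b+1) - f (b+1) * ?d \<phi> (b+1)) - (?d f (a/2) * \<phi> (a/2) - f (a/2) * ?d \<phi> (a/2)))
       {a/2..b+1}"
      by (rule green_identity[OF smooth_half_lineD(2)[OF f] smooth_half_lineD(2)[OF smooth_half_lineD(1)[OF f]]
          smooth_half_lineD(2)[OF s] smooth_half_lineD(2)[OF smooth_half_lineD(1)[OF s]]])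
        (use ab(1,2) in simp_all)
    have n: "0 < b + 1" "b + 1 \<notin> {a..b}" "0 < a / 2" "a / 2 \<notin> {a..b}" using ab(1,2) by auto
    show "((\<lambda>x. f x * bessel \<alpha> \<phi> x - bessel \<alpha> f x * \<phi> x) has_integral 0) {a/2..b+1}"
      using G unfolding ab(3)[OF n(1,2)] d0[OF n(1,2)] ab(3)[OF n(3,4)] d0[OF n(3,4)]
      by (simp only: mult_zero_right diff_self)
  qed
  then show ?thesis
    unfolding Bochner_Integration.integral_diff[OF I1 I2] by (simp only: right_minus_eq)
qed

lemma smooth_in_L_max:
  assumes "smooth_on {0<..} f" "square_integrable f" "square_integrable (bessel \<alpha> f)"
  shows "(abs_L2 f, abs_L2 (bessel \<alpha> f)) \<in> L_max \<alpha>"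
  unfolding L_max_abs_iff[OF assms(2,3)] by (intro ballI integral_bessel_symmetric assms(1))

section \<open>The solutions of the homogeneous equation\<close>

text \<open>Being even in \<open>csqrt \<alpha>\<close>, both functions are entire in \<open>\<alpha>\<close>.\<close>

definition ch :: "complex \<Rightarrow> real \<Rightarrow> complex" where
  "ch \<alpha> t = cosh (csqrt \<alpha> * complex_of_real t)"

definition sh :: "complex \<Rightarrow> real \<Rightarrow> complex" where
  "sh \<alpha> t = (if \<alpha> = 0 then complex_of_real t else sinh (csqrt \<alpha> * complex_of_real t) / csqrt \<alpha>)"

definition sol1 :: "complex \<Rightarrow> real \<Rightarrow> complex" where
  "sol1 \<alpha> x = complex_of_real (sqrt x) * ch \<alpha> (ln x)"

definition sol2 :: "complex \<Rightarrow> real \<Rightarrow> complex" where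
  "sol2 \<alpha> x = complex_of_real (sqrt x) * sh \<alpha> (ln x)"

lemma square_eq_csqrt: "m\<^sup>2 = \<alpha> \<Longrightarrow> m = csqrt \<alpha> \<or> m = - csqrt \<alpha>"
  by (metis power2_csqrt power2_eq_iff)

lemma ch_square: "m\<^sup>2 = \<alpha> \<Longrightarrow> ch \<alpha> t = cosh (m * complex_of_real t)"
  by (drule square_eq_csqrt, erule disjE) (simp_all add: ch_def)

lemma sh_square: "m\<^sup>2 = \<alpha> \<Longrightarrow> m \<noteq> 0 \<Longrightarrow> sh \<alpha> t = sinh (m * complex_of_real t) / m"
  by (drule square_eq_csqrt, erule disjE) (auto simp: sh_def)

lemma ch_sh_square: "(ch \<alpha> t)\<^sup>2 - \<alpha> * (sh \<alpha> t)\<^sup>2 = 1"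
proof (cases "\<alpha> = 0")
  case False
  then have "\<alpha> * (sh \<alpha> t)\<^sup>2 = (sinh (csqrt \<alpha> * complex_of_real t))\<^sup>2"
    by (simp add: sh_def power_divide)
  then show ?thesis by (simp add: ch_def cosh_square_eq)
qed (simp add: ch_def)

lemma sh_diff: "sh \<alpha> (s - t) = sh \<alpha> s * ch \<alpha> t - ch \<alpha> s * sh \<alpha> t"
  by (auto simp: sh_def ch_def algebra_simps sinh_diff diff_divide_distrib)

lemma solutions_square: "0 < x \<Longrightarrow> (sol1 \<alpha> x)\<^sup>2 - \<alpha> * (sol2 \<alpha> x)\<^sup>2 = complex_of_real x"
proof -
  assume x: "0 < x"
  have "(sol1 \<alpha> x)\<^sup>2 - \<alpha> * (sol2 \<alpha> x)\<^sup>2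
      = (complex_of_real (sqrt x))\<^sup>2 * ((ch \<alpha> (ln x))\<^sup>2 - \<alpha> * (sh \<alpha> (ln x))\<^sup>2)"
    by (simp add: sol1_def sol2_def power_mult_distrib algebra_simps)
  also have "\<dots> = complex_of_real x" using x by (simp add: ch_sh_square flip: of_real_power)
  finally show ?thesis .
qed

text \<open>In the variable t = ln x one has ch' = \<alpha> sh and sh' = ch. Hence x sol1' = sol1/2
  + \<alpha> sol2 and x sol2' = sol2/2 + sol1, a system in which \<alpha> = 0 is not
  singular.\<close>

definition dsol1 :: "complex \<Rightarrow> real \<Rightarrow> complex" where
  "dsol1 \<alpha> x = (sol1 \<alpha> x / 2 + \<alpha> * sol2 \<alpha> x) / complex_of_real x"

definition dsol2 :: "complex \<Rightarrow> real \<Rightarrow> complex" where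
  "dsol2 \<alpha> x = (sol2 \<alpha> x / 2 + sol1 \<alpha> x) / complex_of_real x"

text \<open>The left side is (sol1^2 - \<alpha> sol2^2)/x, so this is ch^2 - \<alpha> sh^2 = 1. The
  value 1 spares a normalizing factor in the variation of constants.\<close>

lemma wronskian: "0 < x \<Longrightarrow> sol1 \<alpha> x * dsol2 \<alpha> x - dsol1 \<alpha> x * sol2 \<alpha> x = 1"
  using solutions_square[of x \<alpha>]
  by (simp add: dsol1_def dsol2_def field_simps power2_eq_square)

text \<open>The extension to the right half-plane, \<open>exp (Ln w / 2)\<close> being the branch of
  the square root. Smoothness and derivatives on the half-line are then read off from complex
  differentiation.\<close>

definition sol1_complex :: "complex \<Rightarrow> complex \<Rightarrow> complex" where
  "sol1_complex \<alpha> w = exp (Ln w / 2) * cosh (csqrt \<alpha> * Ln w)"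

definition sol2_complex :: "complex \<Rightarrow> complex \<Rightarrow> complex" where
  "sol2_complex \<alpha> w =
     exp (Ln w / 2) * (if \<alpha> = 0 then Ln w else sinh (csqrt \<alpha> * Ln w) / csqrt \<alpha>)"

lemma exp_half_ln: "0 < x \<Longrightarrow> exp (complex_of_real (ln x) / 2) = complex_of_real (sqrt x)"
proof -
  assume x: "0 < x"
  have "exp (complex_of_real (ln x / 2)) = complex_of_real (exp (ln x / 2))" by (rule exp_of_real)
  also have "exp (ln x / 2) = sqrt x"
  proof (rule real_sqrt_unique[symmetric])
    have "(exp (ln x / 2))\<^sup>2 = exp (ln x / 2 + ln x / 2)" by (simp only: power2_eq_square exp_add)
    then show "(exp (ln x / 2))\<^sup>2 = x" using x by simp
  qed simp
  finally show ?thesis by simp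
qed

lemma sol1_complex_of_real: "0 < x \<Longrightarrow> sol1_complex \<alpha> (complex_of_real x) = sol1 \<alpha> x"
  by (simp add: sol1_complex_def sol1_def ch_def exp_half_ln Ln_of_real)

lemma sol2_complex_of_real: "0 < x \<Longrightarrow> sol2_complex \<alpha> (complex_of_real x) = sol2 \<alpha> x"
  by (simp add: sol2_complex_def sol2_def sh_def exp_half_ln Ln_of_real)

lemma sol1_complex_deriv:
  assumes "0 < Re w"
  shows "(sol1_complex \<alpha> has_field_derivative
    (sol1_complex \<alpha> w / 2 + \<alpha> * sol2_complex \<alpha> w) / w) (at w)"
proof -
  have w: "w \<notin> \<real>\<^sub>\<le>\<^sub>0" "w \<noteq> 0" using assms by (auto simp: complex_nonpos_Reals_iff)
  have "\<alpha> = csqrt \<alpha> * csqrt \<alpha>" by (metis power2_csqrt power2_eq_square)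
  \<comment> \<open>This turns the factor in \<open>\<alpha> * sol2_complex\<close> into the one
    from differentiating cosh; for \<alpha> = 0 both sides are 0.\<close>
  then have "\<alpha> / csqrt \<alpha> = csqrt \<alpha>" by (metis nonzero_eq_divide_eq csqrt_eq_0 div_by_0)
  then show ?thesis
    unfolding sol1_complex_def[abs_def] sol2_complex_def
    by (auto intro!: derivative_eq_intros simp: w field_simps)
qed

lemma sol2_complex_deriv:
  assumes "0 < Re w"
  shows "(sol2_complex \<alpha> has_field_derivative
    (sol2_complex \<alpha> w / 2 + sol1_complex \<alpha> w) / w) (at w)"
proof (cases "\<alpha> = 0")
  case True
  have w: "w \<notin> \<real>\<^sub>\<le>\<^sub>0" "w \<noteq> 0" using assms by (auto simp: complex_nonpos_Reals_iff)
  show ?thesis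
    unfolding sol1_complex_def sol2_complex_def[abs_def]
    by (auto intro!: derivative_eq_intros simp: w field_simps True)
next
  case False
  have w: "w \<notin> \<real>\<^sub>\<le>\<^sub>0" "w \<noteq> 0" using assms by (auto simp: complex_nonpos_Reals_iff)
  show ?thesis
    unfolding sol1_complex_def sol2_complex_def[abs_def]
    using False by (auto intro!: derivative_eq_intros simp: w field_simps)
qed

lemma has_vector_derivative_sol1:
  assumes "0 < x"
  shows "(sol1 \<alpha> has_vector_derivative dsol1 \<alpha> x) (at x)"
proof -
  have "((\<lambda>y. sol1_complex \<alpha> (complex_of_real y)) has_vector_derivative
     (sol1_complex \<alpha> (complex_of_real x) / 2 + \<alpha> * sol2_complex \<alpha> (complex_of_real x)) / complex_of_real x) (at x)"
    by (rule has_vector_derivative_real_field[OF sol1_complex_deriv]) (use assms in simp)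
  then have "((\<lambda>y. sol1_complex \<alpha> (complex_of_real y)) has_vector_derivative dsol1 \<alpha> x) (at x)"
    by (simp only: dsol1_def sol1_complex_of_real[OF assms] sol2_complex_of_real[OF assms])
  then show ?thesis
    by (rule has_vector_derivative_transform_within_open[where S = "{0<..}"])
      (use assms in \<open>simp_all add: sol1_complex_of_real\<close>)
qed

lemma has_vector_derivative_sol2:
  assumes "0 < x"
  shows "(sol2 \<alpha> has_vector_derivative dsol2 \<alpha> x) (at x)"
proof -
  have "((\<lambda>y. sol2_complex \<alpha> (complex_of_real y)) has_vector_derivative
     (sol2_complex \<alpha> (complex_of_real x) / 2 + sol1_complex \<alpha> (complex_of_real x)) / complex_of_real x) (at x)"
    by (rule has_vector_derivative_real_field[OF sol2_complex_deriv]) (use assms in simp)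
  then have "((\<lambda>y. sol2_complex \<alpha> (complex_of_real y)) has_vector_derivative dsol2 \<alpha> x) (at x)"
    by (simp only: dsol2_def sol1_complex_of_real[OF assms] sol2_complex_of_real[OF assms])
  then show ?thesis
    by (rule has_vector_derivative_transform_within_open[where S = "{0<..}"])
      (use assms in \<open>simp_all add: sol2_complex_of_real\<close>)
qed

lemma smooth_sol1: "smooth_on {0<..} (sol1 \<alpha>)"
proof (rule smooth_on_cong)
  have "open {w. 0 < Re w}" by (rule open_halfspace_Re_gt)
  then have "sol1_complex \<alpha> holomorphic_on {w. 0 < Re w}"
    using sol1_complex_deriv by (auto simp: holomorphic_on_open)
  then show "smooth_on {0<..} (\<lambda>x. sol1_complex \<alpha> (complex_of_real x))"
    by (rule smooth_on_holomorphic)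
qed (simp add: sol1_complex_of_real)

lemma smooth_sol2: "smooth_on {0<..} (sol2 \<alpha>)"
proof (rule smooth_on_cong)
  have "open {w. 0 < Re w}" by (rule open_halfspace_Re_gt)
  then have "sol2_complex \<alpha> holomorphic_on {w. 0 < Re w}"
    using sol2_complex_deriv by (auto simp: holomorphic_on_open)
  then show "smooth_on {0<..} (\<lambda>x. sol2_complex \<alpha> (complex_of_real x))"
    by (rule smooth_on_holomorphic)
qed (simp add: sol2_complex_of_real)

lemma has_vector_derivative_inverse_real:
  assumes "0 < x"
  shows "((\<lambda>x. 1 / complex_of_real x) has_vector_derivative - 1 / (complex_of_real x)\<^sup>2) (at x)"
  by (rule has_vector_derivative_real_field[where f = "\<lambda>w. 1 / w"])
    (use assms in \<open>auto intro!: derivative_eq_intros simp: field_simps power2_eq_square\<close>)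

lemma has_vector_derivative_dsol1:
  assumes "0 < x"
  shows "(dsol1 \<alpha> has_vector_derivative (\<alpha> - 1/4) * (1 / (complex_of_real x)\<^sup>2) * sol1 \<alpha> x) (at x)"
proof -
  have "((\<lambda>x. (1/2 * sol1 \<alpha> x + \<alpha> * sol2 \<alpha> x) * (1 / complex_of_real x)) has_vector_derivative
      (1/2 * sol1 \<alpha> x + \<alpha> * sol2 \<alpha> x) * (- 1 / (complex_of_real x)\<^sup>2)
      + (1/2 * dsol1 \<alpha> x + \<alpha> * dsol2 \<alpha> x) * (1 / complex_of_real x)) (at x)"
    by (intro has_vector_derivative_mult has_vector_derivative_add has_vector_derivative_mult_right
        has_vector_derivative_sol1 has_vector_derivative_sol2 has_vector_derivative_inverse_real assms)
  moreover have "(1/2 * sol1 \<alpha> x + \<alpha> * sol2 \<alpha> x) * (- 1 / (complex_of_real x)\<^sup>2)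
      + (1/2 * dsol1 \<alpha> x + \<alpha> * dsol2 \<alpha> x) * (1 / complex_of_real x)
      = (\<alpha> - 1/4) * (1 / (complex_of_real x)\<^sup>2) * sol1 \<alpha> x"
    using assms by (simp add: dsol1_def dsol2_def field_simps power2_eq_square)
  ultimately show ?thesis by (simp add: dsol1_def[abs_def])
qed

lemma has_vector_derivative_dsol2:
  assumes "0 < x"
  shows "(dsol2 \<alpha> has_vector_derivative (\<alpha> - 1/4) * (1 / (complex_of_real x)\<^sup>2) * sol2 \<alpha> x) (at x)"
proof -
  have "((\<lambda>x. (1/2 * sol2 \<alpha> x + sol1 \<alpha> x) * (1 / complex_of_real x)) has_vector_derivative
      (1/2 * sol2 \<alpha> x + sol1 \<alpha> x) * (- 1 / (complex_of_real x)\<^sup>2)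
      + (1/2 * dsol2 \<alpha> x + dsol1 \<alpha> x) * (1 / complex_of_real x)) (at x)"
    by (intro has_vector_derivative_mult has_vector_derivative_add has_vector_derivative_mult_right
        has_vector_derivative_sol1 has_vector_derivative_sol2 has_vector_derivative_inverse_real assms)
  moreover have "(1/2 * sol2 \<alpha> x + sol1 \<alpha> x) * (- 1 / (complex_of_real x)\<^sup>2)
      + (1/2 * dsol2 \<alpha> x + dsol1 \<alpha> x) * (1 / complex_of_real x)
      = (\<alpha> - 1/4) * (1 / (complex_of_real x)\<^sup>2) * sol2 \<alpha> x"
    using assms by (simp add: dsol1_def dsol2_def field_simps power2_eq_square)
  ultimately show ?thesis by (simp add: dsol2_def[abs_def])
qed

lemma bessel_sol1: "0 < x \<Longrightarrow> bessel \<alpha> (sol1 \<alpha>) x = 0"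
  by (subst bessel_eq[OF has_vector_derivative_sol1 has_vector_derivative_dsol1]) auto

lemma bessel_sol2: "0 < x \<Longrightarrow> bessel \<alpha> (sol2 \<alpha>) x = 0"
  by (subst bessel_eq[OF has_vector_derivative_sol2 has_vector_derivative_dsol2]) auto

section \<open>Growth of the solutions, uniformly in the parameter, and their power series in the
  parameter\<close>

lemma norm_ch_le:
  assumes "\<bar>Re (csqrt \<alpha>)\<bar> \<le> r"
  shows "norm (ch \<alpha> t) \<le> exp (r * \<bar>t\<bar>)"
proof -
  let ?z = "csqrt \<alpha> * complex_of_real t"
  have le: "\<bar>Re ?z\<bar> \<le> r * \<bar>t\<bar>" using assms by (simp add: abs_mult mult_right_mono)
  have "norm (exp ?z + exp (- ?z)) \<le> exp (Re ?z) + exp (- Re ?z)"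
    using norm_triangle_ineq[of "exp ?z" "exp (- ?z)"] by simp
  also have "\<dots> \<le> exp (r * \<bar>t\<bar>) + exp (r * \<bar>t\<bar>)" using le by (intro add_mono) auto
  finally show ?thesis by (simp add: ch_def cosh_def norm_divide scaleR_conv_of_real norm_mult)
qed

text \<open>\<open>sh\<close> is the antiderivative of \<open>ch\<close> vanishing at 0, so the mean
  value inequality bounds it. Dividing a bound for sinh by the root of \<alpha> would lose
  uniformity near \<alpha> = 0.\<close>

lemma norm_sh_le:
  assumes "\<bar>Re (csqrt \<alpha>)\<bar> \<le> r"
  shows "norm (sh \<alpha> t) \<le> \<bar>t\<bar> * exp (r * \<bar>t\<bar>)"
proof (cases "\<alpha> = 0")
  case True
  then have "0 \<le> r" using assms by simp
  then have "1 \<le> exp (r * \<bar>t\<bar>)" by simp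
  then have "\<bar>t\<bar> * 1 \<le> \<bar>t\<bar> * exp (r * \<bar>t\<bar>)" by (intro mult_left_mono) auto
  then show ?thesis using True by (simp add: sh_def)
next
  case False
  have "norm (sh \<alpha> t - sh \<alpha> 0) \<le> exp (r * \<bar>t\<bar>) * norm (t - 0)"
  proof (rule differentiable_bound)
    have "(sh \<alpha> has_vector_derivative ch \<alpha> s) (at s within {- \<bar>t\<bar>..\<bar>t\<bar>})" for s
      unfolding sh_def[abs_def]
    proof (rule has_vector_derivative_real_field[where f = "\<lambda>w. if \<alpha> = 0 then w else sinh (csqrt \<alpha> * w) / csqrt \<alpha>"])
      show "((\<lambda>w. if \<alpha> = 0 then w else sinh (csqrt \<alpha> * w) / csqrt \<alpha>) has_field_derivative
        ch \<alpha> s) (at (complex_of_real s))"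
        using False by (auto intro!: derivative_eq_intros simp: ch_def)
    qed
    then show "(sh \<alpha> has_derivative (\<lambda>h. h *\<^sub>R ch \<alpha> s)) (at s within {- \<bar>t\<bar>..\<bar>t\<bar>})" for s
      by (simp add: has_vector_derivative_def)
    fix s assume s: "s \<in> {- \<bar>t\<bar>..\<bar>t\<bar>}"
    have "norm (ch \<alpha> s) \<le> exp (r * \<bar>s\<bar>)" by (rule norm_ch_le[OF assms])
    also have "r * \<bar>s\<bar> \<le> r * \<bar>t\<bar>" using s assms by (intro mult_left_mono) auto
    finally have "norm (ch \<alpha> s) \<le> exp (r * \<bar>t\<bar>)" by simp
    then show "onorm (\<lambda>h. h *\<^sub>R ch \<alpha> s) \<le> exp (r * \<bar>t\<bar>)"
      by (intro onorm_bound) (auto intro: mult_left_mono simp: mult.commute[of "exp _"])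
  qed auto
  then show ?thesis using False by (simp add: sh_def mult.commute)
qed

text \<open>The linear factor, which is a logarithm in x, is paid for by raising the exponent from
  \<open>r\<close> to \<open>\<rho>\<close>, since u \<le> exp u.\<close>

lemma abs_mult_exp_le:
  fixes r \<rho> t :: real
  assumes "r < \<rho>"
  shows "\<bar>t\<bar> * exp (r * \<bar>t\<bar>) \<le> 1 / (\<rho> - r) * exp (\<rho> * \<bar>t\<bar>)"
proof -
  have "(\<rho> - r) * \<bar>t\<bar> \<le> exp ((\<rho> - r) * \<bar>t\<bar>)"
    using exp_ge_add_one_self[of "(\<rho> - r) * \<bar>t\<bar>"] by linarith
  then have "(\<rho> - r) * \<bar>t\<bar> * exp (r * \<bar>t\<bar>) \<le> exp ((\<rho> - r) * \<bar>t\<bar>) * exp (r * \<bar>t\<bar>)"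
    by (rule mult_right_mono) simp
  also have "\<dots> = exp (\<rho> * \<bar>t\<bar>)" by (simp add: algebra_simps flip: exp_add)
  finally show ?thesis using assms by (simp add: field_simps)
qed

lemma norm_solutions_le:
  assumes "\<bar>Re (csqrt \<alpha>)\<bar> \<le> r" "r < \<rho>" "0 < x"
  shows "norm (sol1 \<alpha> x) \<le> sqrt x * exp (\<rho> * \<bar>ln x\<bar>)"
    and "norm (sol2 \<alpha> x) \<le> 1 / (\<rho> - r) * (sqrt x * exp (\<rho> * \<bar>ln x\<bar>))"
proof -
  have "norm (ch \<alpha> (ln x)) \<le> exp (\<rho> * \<bar>ln x\<bar>)" using assms by (intro norm_ch_le) auto
  then have "sqrt x * norm (ch \<alpha> (ln x)) \<le> sqrt x * exp (\<rho> * \<bar>ln x\<bar>)"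
    by (rule mult_left_mono) (use assms in simp)
  then show "norm (sol1 \<alpha> x) \<le> sqrt x * exp (\<rho> * \<bar>ln x\<bar>)" using assms by (simp add: sol1_def norm_mult)
  have "norm (sh \<alpha> (ln x)) \<le> 1 / (\<rho> - r) * exp (\<rho> * \<bar>ln x\<bar>)"
    by (rule order_trans[OF norm_sh_le[OF assms(1)] abs_mult_exp_le[OF assms(2)]])
  then have "sqrt x * norm (sh \<alpha> (ln x)) \<le> sqrt x * (1 / (\<rho> - r) * exp (\<rho> * \<bar>ln x\<bar>))"
    by (rule mult_left_mono) (use assms in simp)
  then show "norm (sol2 \<alpha> x) \<le> 1 / (\<rho> - r) * (sqrt x * exp (\<rho> * \<bar>ln x\<bar>))"
    using assms by (simp add: sol2_def norm_mult mult_ac)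
qed

text \<open>Only even powers of \<open>csqrt w\<close> occur in cosh, so its expansion is a power
  series in \<open>w\<close>; the branch cut of the root disappears. For \<open>sh\<close> the odd
  powers lose one root to the denominator.\<close>

lemma ch_holomorphic: "(\<lambda>z. ch z t) holomorphic_on ball 0 r"
proof (rule power_series_holomorphic)
  fix w :: complex
  let ?x = "csqrt w * complex_of_real t"
  have "(\<lambda>n. if even n then ?x ^ n /\<^sub>R fact n else 0) sums cosh ?x" by (rule cosh_converges)
  then have "(\<lambda>k. (\<lambda>n. if even n then ?x ^ n /\<^sub>R fact n else 0) (2 * k)) sums cosh ?x"
    by (subst sums_mono_reindex) (auto simp: strict_mono_def elim!: evenE)
  moreover have "?x ^ (2 * k) = complex_of_real t ^ (2 * k) * w ^ k" for k
    by (simp add: power_mult_distrib power_mult)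
  ultimately show "(\<lambda>k. (complex_of_real t ^ (2 * k) /\<^sub>R fact (2 * k)) * (w - 0) ^ k) sums ch w t"
    by (simp add: ch_def)
qed

lemma sh_holomorphic: "(\<lambda>z. sh z t) holomorphic_on ball 0 r"
proof (rule power_series_holomorphic)
  fix w :: complex
  let ?a = "\<lambda>k::nat. complex_of_real t ^ (2 * k + 1) /\<^sub>R fact (2 * k + 1)"
  show "(\<lambda>k. ?a k * (w - 0) ^ k) sums sh w t"
  proof (cases "w = 0")
    case True
    then show ?thesis using powser_sums_zero[of ?a] by (simp add: sh_def)
  next
    case False
    let ?x = "csqrt w * complex_of_real t"
    have "(\<lambda>n. if even n then 0 else ?x ^ n /\<^sub>R fact n) sums sinh ?x" by (rule sinh_converges)
    then have "(\<lambda>k. (\<lambda>n. if even n then 0 else ?x ^ n /\<^sub>R fact n) (2 * k + 1)) sums sinh ?x"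
      by (subst sums_mono_reindex) (auto simp: strict_mono_def elim!: oddE)
    then have "(\<lambda>k. (?x ^ (2 * k + 1) /\<^sub>R fact (2 * k + 1)) / csqrt w) sums (sinh ?x / csqrt w)"
      by (intro sums_divide) simp
    moreover have "(?x ^ (2 * k + 1) /\<^sub>R fact (2 * k + 1)) / csqrt w = ?a k * (w - 0) ^ k" for k
    proof -
      have "?x ^ (2 * k + 1) = csqrt w * (complex_of_real t ^ (2 * k + 1) * w ^ k)"
        by (simp add: power_mult_distrib power_mult)
      then show ?thesis using False by (simp add: scaleR_conv_of_real)
    qed
    ultimately show ?thesis using False by (simp add: sh_def)
  qed
qed

section \<open>Variation of constants\<close>

interpretation half_line_pair: pair_sigma_finite half_line half_line ..

lemma id_half_line_measurable [measurable]: "(\<lambda>x. x) \<in> borel_measurable half_line"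
  by (rule continuous_on_half_line_measurable) (rule continuous_on_id)

section \<open>Integrals of powers, a weighted Cauchy-Schwarz inequality and Hardy's
  inequality\<close>

lemma nn_integral_half_line:
  "(\<integral>\<^sup>+x. f x \<partial>half_line) = (\<integral>\<^sup>+x. f x * indicator {0<..} x \<partial>lborel)"
  by (simp add: nn_integral_restrict_space nn_integral_completion)

lemma nn_integral_L2:
  assumes "square_integrable f"
  shows "(\<integral>\<^sup>+x. ennreal ((norm (f x))\<^sup>2) \<partial>half_line) = ennreal ((norm (abs_L2 f))\<^sup>2)"
  using assms by (simp add: L2_norm_abs_square nn_integral_eq_integral square_integrable_def)

lemma nn_integral_powr_from_0:
  fixes a x :: real
  assumes "- 1 < a" "0 < x"
  shows "(\<integral>\<^sup>+y. (if y < x then ennreal (y powr a) else 0) \<partial>half_line) \<le> ennreal (x powr (a + 1) / (a + 1))"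
proof -
  have "(\<integral>\<^sup>+y. (if y < x then ennreal (y powr a) else 0) \<partial>half_line)
      \<le> (\<integral>\<^sup>+y. ennreal (y powr a) * indicator {0..x} y \<partial>lborel)"
    unfolding nn_integral_half_line by (rule nn_integral_mono) (auto simp: indicator_def)
  also have "\<dots> = ennreal (x powr (a + 1) / (a + 1))"
    by (rule nn_integral_has_integral_lebesgue'[OF _ has_integral_powr_from_0]) (use assms in auto)
  finally show ?thesis .
qed

lemma nn_integral_powr_to_inf:
  fixes a y :: real
  assumes "a < - 1" "0 < y"
  shows "(\<integral>\<^sup>+x. (if y < x then ennreal (x powr a) else 0) \<partial>half_line) \<le> ennreal (- (y powr (a + 1)) / (a + 1))"
proof -
  have "(\<integral>\<^sup>+x. (if y < x then ennreal (x powr a) else 0) \<partial>half_line)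
      \<le> (\<integral>\<^sup>+x. ennreal (x powr a) * indicator {y..} x \<partial>lborel)"
    unfolding nn_integral_half_line by (rule nn_integral_mono) (auto simp: indicator_def)
  also have "\<dots> = ennreal (- (y powr (a + 1)) / (a + 1))"
    by (rule nn_integral_has_integral_lebesgue'[OF _ has_integral_powr_to_inf]) (use assms in auto)
  finally show ?thesis .
qed

text \<open>The power is split as y^(s/2) times y^(1/2-\<rho>-s/2), and s > -1 makes the first
  factor square integrable near zero. The free \<open>s\<close> is used twice: s = -\<rho> for
  Hardy's inequality, s = 1 - 2\<rho> for the pointwise bound.\<close>

lemma weighted_Cauchy_Schwarz:
  fixes G :: "real \<Rightarrow> real"
  assumes [measurable]: "G \<in> borel_measurable half_line" and G: "\<And>y. 0 \<le> G y"
    and s: "- 1 < s" and x: "0 < x"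
  shows "(\<integral>\<^sup>+y. (if y < x then ennreal (y powr (1/2 - \<rho>) * G y) else 0) \<partial>half_line)\<^sup>2
    \<le> ennreal (x powr (s + 1) / (s + 1)) *
      (\<integral>\<^sup>+y. (if y < x then ennreal (y powr (1 - 2 * \<rho> - s) * (G y)\<^sup>2) else 0) \<partial>half_line)"
proof -
  let ?f = "\<lambda>y. if y < x then ennreal (y powr (s / 2)) else 0"
  let ?g = "\<lambda>y. if y < x then ennreal (y powr (1/2 - \<rho> - s / 2) * G y) else 0"
  have "(\<integral>\<^sup>+y. ?f y * ?g y \<partial>half_line)\<^sup>2
      \<le> (\<integral>\<^sup>+y. (?f y)\<^sup>2 \<partial>half_line) * (\<integral>\<^sup>+y. (?g y)\<^sup>2 \<partial>half_line)"
    by (rule Cauchy_Schwarz_nn_integral) measurable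
  moreover have "(\<integral>\<^sup>+y. ?f y * ?g y \<partial>half_line)
      = (\<integral>\<^sup>+y. (if y < x then ennreal (y powr (1/2 - \<rho>) * G y) else 0) \<partial>half_line)"
    by (rule nn_integral_cong) (auto simp flip: ennreal_mult powr_add simp: G mult.assoc[symmetric])
  moreover have "(\<integral>\<^sup>+y. (?f y)\<^sup>2 \<partial>half_line) = (\<integral>\<^sup>+y. (if y < x then ennreal (y powr s) else 0) \<partial>half_line)"
    by (rule nn_integral_cong) (auto simp: power2_eq_square simp flip: ennreal_mult powr_add)
  moreover have "(\<integral>\<^sup>+y. (?g y)\<^sup>2 \<partial>half_line)
      = (\<integral>\<^sup>+y. (if y < x then ennreal (y powr (1 - 2 * \<rho> - s) * (G y)\<^sup>2) else 0) \<partial>half_line)"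
  proof (rule nn_integral_cong)
    fix y :: real
    have "(y powr (1/2 - \<rho> - s / 2))\<^sup>2 = y powr (1 - 2 * \<rho> - s)"
      by (simp add: power2_eq_square algebra_simps flip: powr_add)
    then show "(?g y)\<^sup>2 = (if y < x then ennreal (y powr (1 - 2 * \<rho> - s) * (G y)\<^sup>2) else 0)"
      by (simp add: ennreal_power G power_mult_distrib)
  qed
  ultimately have "(\<integral>\<^sup>+y. (if y < x then ennreal (y powr (1/2 - \<rho>) * G y) else 0) \<partial>half_line)\<^sup>2
    \<le> (\<integral>\<^sup>+y. (if y < x then ennreal (y powr s) else 0) \<partial>half_line) *
      (\<integral>\<^sup>+y. (if y < x then ennreal (y powr (1 - 2 * \<rho> - s) * (G y)\<^sup>2) else 0) \<partial>half_line)"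
    by (simp only:)
  also have "\<dots> \<le> ennreal (x powr (s + 1) / (s + 1)) *
      (\<integral>\<^sup>+y. (if y < x then ennreal (y powr (1 - 2 * \<rho> - s) * (G y)\<^sup>2) else 0) \<partial>half_line)"
    by (rule mult_right_mono[OF nn_integral_powr_from_0[OF s x]]) simp
  finally show ?thesis .
qed

text \<open>With s = -\<rho> the inner square is bounded by x^(1-\<rho>)/(1-\<rho>) times a weighted
  integral over y < x. After exchanging the integrals, the powers of y cancel and each integration
  contributes one factor 1/(1-\<rho>).\<close>

lemma Hardy_inequality:
  fixes G :: "real \<Rightarrow> real"
  assumes [measurable]: "G \<in> borel_measurable half_line" and G: "\<And>y. 0 \<le> G y" and \<rho>: "\<rho> < 1"
  shows "(\<integral>\<^sup>+x. ennreal (x powr (2 * \<rho> - 3)) *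
      (\<integral>\<^sup>+y. (if y < x then ennreal (y powr (1/2 - \<rho>) * G y) else 0) \<partial>half_line)\<^sup>2 \<partial>half_line)
    \<le> ennreal (1 / (1 - \<rho>)\<^sup>2) * (\<integral>\<^sup>+y. ennreal ((G y)\<^sup>2) \<partial>half_line)"
proof -
  have exponent: "1 - 2 * \<rho> - - \<rho> = 1 - \<rho>" by simp
  let ?h = "\<lambda>x y. if y < x then ennreal (x powr (\<rho> - 2) * (y powr (1 - \<rho>) * (G y)\<^sup>2 / (1 - \<rho>))) else 0"
  have "(\<integral>\<^sup>+x. ennreal (x powr (2 * \<rho> - 3)) *
      (\<integral>\<^sup>+y. (if y < x then ennreal (y powr (1/2 - \<rho>) * G y) else 0) \<partial>half_line)\<^sup>2 \<partial>half_line)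
    \<le> (\<integral>\<^sup>+x. (\<integral>\<^sup>+y. ?h x y \<partial>half_line) \<partial>half_line)"
  proof (rule nn_integral_mono)
    fix x assume "x \<in> space half_line"
    then have x: "0 < x" by simp
    let ?B = "\<integral>\<^sup>+y. (if y < x then ennreal (y powr (1 - \<rho>) * (G y)\<^sup>2) else 0) \<partial>half_line"
    have "(\<integral>\<^sup>+y. (if y < x then ennreal (y powr (1/2 - \<rho>) * G y) else 0) \<partial>half_line)\<^sup>2
        \<le> ennreal (x powr (1 - \<rho>) / (1 - \<rho>)) * ?B"
      using weighted_Cauchy_Schwarz[OF assms(1,2), of "- \<rho>" x \<rho>, unfolded exponent] \<rho> x by simp
    then have "ennreal (x powr (2 * \<rho> - 3)) *
        (\<integral>\<^sup>+y. (if y < x then ennreal (y powr (1/2 - \<rho>) * G y) else 0) \<partial>half_line)\<^sup>2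
        \<le> ennreal (x powr (2 * \<rho> - 3)) * (ennreal (x powr (1 - \<rho>) / (1 - \<rho>)) * ?B)"
      by (rule mult_left_mono) simp
    also have "\<dots> = ennreal (x powr (2 * \<rho> - 3) * (x powr (1 - \<rho>) / (1 - \<rho>))) * ?B"
      by (subst ennreal_mult) (use \<rho> in \<open>auto simp: mult.assoc\<close>)
    also have "x powr (2 * \<rho> - 3) * (x powr (1 - \<rho>) / (1 - \<rho>)) = x powr (\<rho> - 2) / (1 - \<rho>)"
      by (simp flip: powr_add)
    also have "ennreal (x powr (\<rho> - 2) / (1 - \<rho>)) * ?B = (\<integral>\<^sup>+y. ennreal (x powr (\<rho> - 2) / (1 - \<rho>)) *
        (if y < x then ennreal (y powr (1 - \<rho>) * (G y)\<^sup>2) else 0) \<partial>half_line)"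
      by (rule nn_integral_cmult[symmetric]) measurable
    also have "\<dots> = (\<integral>\<^sup>+y. ?h x y \<partial>half_line)"
      using \<rho> by (intro nn_integral_cong) (auto simp flip: ennreal_mult)
    finally show "ennreal (x powr (2 * \<rho> - 3)) *
        (\<integral>\<^sup>+y. (if y < x then ennreal (y powr (1/2 - \<rho>) * G y) else 0) \<partial>half_line)\<^sup>2
        \<le> (\<integral>\<^sup>+y. ?h x y \<partial>half_line)" .
  qed
  \<comment> \<open>The inner integral is now that of x^(\<rho>-2) from y to infinity, finite
    because \<rho> < 1, with value y^(\<rho>-1)/(1-\<rho>).\<close>
  also have "\<dots> = (\<integral>\<^sup>+y. (\<integral>\<^sup>+x. ?h x y \<partial>half_line) \<partial>half_line)"
    by (rule half_line_pair.Fubini'[symmetric]) measurable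
  also have "\<dots> \<le> (\<integral>\<^sup>+y. ennreal (1 / (1 - \<rho>)\<^sup>2) * ennreal ((G y)\<^sup>2) \<partial>half_line)"
  proof (rule nn_integral_mono)
    fix y assume "y \<in> space half_line"
    then have y: "0 < y" by simp
    let ?c = "y powr (1 - \<rho>) * (G y)\<^sup>2 / (1 - \<rho>)"
    have c: "0 \<le> ?c" using \<rho> by simp
    have "(\<integral>\<^sup>+x. ?h x y \<partial>half_line)
        = (\<integral>\<^sup>+x. ennreal ?c * (if y < x then ennreal (x powr (\<rho> - 2)) else 0) \<partial>half_line)"
      using c by (intro nn_integral_cong) (auto simp: mult.commute simp flip: ennreal_mult)
    also have "\<dots> = ennreal ?c * (\<integral>\<^sup>+x. (if y < x then ennreal (x powr (\<rho> - 2)) else 0) \<partial>half_line)"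
      by (rule nn_integral_cmult) measurable
    also have "\<dots> \<le> ennreal ?c * ennreal (- (y powr (\<rho> - 2 + 1)) / (\<rho> - 2 + 1))"
      by (rule mult_left_mono[OF nn_integral_powr_to_inf]) (use \<rho> y in auto)
    also have "- (y powr (\<rho> - 2 + 1)) / (\<rho> - 2 + 1) = y powr (\<rho> - 1) / (1 - \<rho>)"
      by (simp add: minus_divide_right)
    also have "ennreal ?c * ennreal (y powr (\<rho> - 1) / (1 - \<rho>)) = ennreal (?c * (y powr (\<rho> - 1) / (1 - \<rho>)))"
      by (rule ennreal_mult[symmetric]) (use c \<rho> in auto)
    also have "?c * (y powr (\<rho> - 1) / (1 - \<rho>)) = (y powr (1 - \<rho>) * y powr (\<rho> - 1)) * (1 / (1 - \<rho>)\<^sup>2 * (G y)\<^sup>2)"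
      by (simp add: power2_eq_square)
    also have "y powr (1 - \<rho>) * y powr (\<rho> - 1) = 1" using y by (simp flip: powr_add)
    also have "ennreal (1 * (1 / (1 - \<rho>)\<^sup>2 * (G y)\<^sup>2)) = ennreal (1 / (1 - \<rho>)\<^sup>2) * ennreal ((G y)\<^sup>2)"
      by (simp flip: ennreal_mult)
    finally show "(\<integral>\<^sup>+x. ?h x y \<partial>half_line) \<le> ennreal (1 / (1 - \<rho>)\<^sup>2) * ennreal ((G y)\<^sup>2)" .
  qed
  also have "\<dots> = ennreal (1 / (1 - \<rho>)\<^sup>2) * (\<integral>\<^sup>+y. ennreal ((G y)\<^sup>2) \<partial>half_line)"
    by (rule nn_integral_cmult) measurable
  finally show ?thesis .
qed

lemma ennreal_square_le:
  fixes a :: ennreal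
  assumes "a\<^sup>2 \<le> ennreal (c\<^sup>2)" "0 \<le> c"
  shows "a \<le> ennreal c"
proof (cases a)
  case (real r)
  then have "r\<^sup>2 \<le> c\<^sup>2" using assms by (simp add: ennreal_power)
  then have "r \<le> c" using assms(2) by (rule power2_le_imp_le)
  then show ?thesis using real assms(2) by simp
qed (use assms in \<open>simp add: power2_eq_square ennreal_mult_top top_unique\<close>)

text \<open>As a function of x it solves the homogeneous equation, vanishes at x = y and has
  derivative -1 there; the sign matches the minus sign in front of the second derivative.\<close>

definition green_kernel :: "complex \<Rightarrow> real \<Rightarrow> real \<Rightarrow> complex" where
  "green_kernel \<alpha> x y = sol1 \<alpha> x * sol2 \<alpha> y - sol2 \<alpha> x * sol1 \<alpha> y"

text \<open>By the addition theorem the kernel depends, up to the roots, only on x/y. Bounding the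
  four solutions separately would miss this cancellation when x and y are both small.\<close>

lemma green_kernel_eq: "green_kernel \<alpha> x y = - (complex_of_real (sqrt x * sqrt y) * sh \<alpha> (ln x - ln y))"
  by (simp add: green_kernel_def sol1_def sol2_def sh_diff algebra_simps)

text \<open>For y \<le> x the growth of \<open>sh\<close> is at most a constant times (x/y)^\<rho>.
  The exponent is taken halfway between |Re m| and 1, and the constant is the price of absorbing the
  logarithm.\<close>

lemma green_kernel_bound:
  assumes "\<bar>Re (csqrt \<alpha>)\<bar> < 1"
  obtains M \<rho> where "0 < M" "\<rho> < 1"
    "\<And>x y. 0 < y \<Longrightarrow> y \<le> x \<Longrightarrow> norm (green_kernel \<alpha> x y) \<le> M * (x powr (1/2 + \<rho>) * y powr (1/2 - \<rho>))"
proof -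
  define r where "r = \<bar>Re (csqrt \<alpha>)\<bar>"
  define \<rho> where "\<rho> = (1 + r) / 2"
  have r: "r < \<rho>" "\<rho> < 1" "\<bar>Re (csqrt \<alpha>)\<bar> \<le> r" using assms by (auto simp: r_def \<rho>_def)
  have "norm (green_kernel \<alpha> x y) \<le> 1 / (\<rho> - r) * (x powr (1/2 + \<rho>) * y powr (1/2 - \<rho>))"
    if y: "0 < y" "y \<le> x" for x y
  proof -
    have "\<bar>ln x - ln y\<bar> = ln x - ln y" using y by simp
    then have "norm (sh \<alpha> (ln x - ln y)) \<le> 1 / (\<rho> - r) * exp (\<rho> * (ln x - ln y))"
      using order_trans[OF norm_sh_le[OF r(3)] abs_mult_exp_le[OF r(1)], of "ln x - ln y"] by simp
    also have "exp (\<rho> * (ln x - ln y)) = x powr \<rho> * y powr (- \<rho>)"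
      using y by (simp add: powr_def algebra_simps flip: exp_add)
    finally have "sqrt x * sqrt y * norm (sh \<alpha> (ln x - ln y))
        \<le> sqrt x * sqrt y * (1 / (\<rho> - r) * (x powr \<rho> * y powr (- \<rho>)))"
      by (rule mult_left_mono) (use y in auto)
    also have "\<dots> = 1 / (\<rho> - r) * ((x powr (1/2) * x powr \<rho>) * (y powr (1/2) * y powr (- \<rho>)))"
      using y by (simp add: powr_half_sqrt mult_ac)
    also have "\<dots> = 1 / (\<rho> - r) * (x powr (1/2 + \<rho>) * y powr (1/2 - \<rho>))"
      by (simp flip: powr_add)
    finally show ?thesis using y by (simp add: green_kernel_eq norm_mult)
  qed
  then show thesis using r by (intro that[of "1 / (\<rho> - r)" \<rho>]) auto
qed

lemma sol_measurable [measurable]: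
  "sol1 \<alpha> \<in> borel_measurable half_line" "sol2 \<alpha> \<in> borel_measurable half_line"
  by (intro continuous_on_half_line_measurable smooth_on_imp_continuous_on smooth_sol1 smooth_sol2)+

definition green :: "complex \<Rightarrow> (real \<Rightarrow> complex) \<Rightarrow> real \<Rightarrow> real \<Rightarrow> complex" where
  "green \<alpha> g x y = (if y < x then green_kernel \<alpha> x y * g y else 0)"

definition green_op :: "complex \<Rightarrow> (real \<Rightarrow> complex) \<Rightarrow> real \<Rightarrow> complex" where
  "green_op \<alpha> g x = (\<integral>y. green \<alpha> g x y \<partial>half_line)"

lemma green_measurable_pair:
  assumes [measurable]: "g \<in> borel_measurable half_line"
  shows "(\<lambda>(x, y). green \<alpha> g x y) \<in> borel_measurable (half_line \<Otimes>\<^sub>M half_line)"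
  unfolding green_def green_kernel_def split_beta by measurable

lemma green_measurable:
  assumes [measurable]: "g \<in> borel_measurable half_line"
  shows "green \<alpha> g x \<in> borel_measurable half_line"
  unfolding green_def green_kernel_def by measurable

lemma green_op_measurable:
  assumes "g \<in> borel_measurable half_line"
  shows "green_op \<alpha> g \<in> borel_measurable half_line"
  unfolding green_op_def[abs_def]
  by (rule half_line.borel_measurable_lebesgue_integral) (rule green_measurable_pair[OF assms])

lemma nn_integral_green_le:
  assumes M: "\<And>x y. 0 < y \<Longrightarrow> y \<le> x \<Longrightarrow> norm (green_kernel \<alpha> x y) \<le> M * (x powr (1/2 + \<rho>) * y powr (1/2 - \<rho>))"
    and M0: "0 < M" and x: "0 < x" and [measurable]: "g \<in> borel_measurable half_line"
  shows "(\<integral>\<^sup>+y. norm (green \<alpha> g x y) \<partial>half_line) \<le> ennreal (M * x powr (1/2 + \<rho>)) *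
    (\<integral>\<^sup>+y. (if y < x then ennreal (y powr (1/2 - \<rho>) * norm (g y)) else 0) \<partial>half_line)"
proof -
  have "(\<integral>\<^sup>+y. norm (green \<alpha> g x y) \<partial>half_line) \<le> (\<integral>\<^sup>+y. ennreal (M * x powr (1/2 + \<rho>)) *
    (if y < x then ennreal (y powr (1/2 - \<rho>) * norm (g y)) else 0) \<partial>half_line)"
  proof (rule nn_integral_mono)
    fix y assume "y \<in> space half_line"
    then have y: "0 < y" by simp
    show "ennreal (norm (green \<alpha> g x y)) \<le> ennreal (M * x powr (1/2 + \<rho>)) *
      (if y < x then ennreal (y powr (1/2 - \<rho>) * norm (g y)) else 0)"
    proof (cases "y < x")
      case True
      then have "norm (green_kernel \<alpha> x y) * norm (g y) \<le> M * (x powr (1/2 + \<rho>) * y powr (1/2 - \<rho>)) * norm (g y)"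
        using y by (intro mult_right_mono M) auto
      also have "\<dots> = (M * x powr (1/2 + \<rho>)) * (y powr (1/2 - \<rho>) * norm (g y))" by (simp add: mult_ac)
      finally show ?thesis using True M0 by (simp add: green_def norm_mult flip: ennreal_mult)
    qed (simp add: green_def)
  qed
  also have "\<dots> = ennreal (M * x powr (1/2 + \<rho>)) *
    (\<integral>\<^sup>+y. (if y < x then ennreal (y powr (1/2 - \<rho>) * norm (g y)) else 0) \<partial>half_line)"
    by (rule nn_integral_cmult) measurable
  finally show ?thesis .
qed

text \<open>With s = 1 - 2\<rho> no weight is left on \<open>g\<close>, so its full norm appears,
  and the powers combine to x^(1/2+\<rho>) x^(1-\<rho>) = x^(3/2), whatever \<rho> is. This is the
  order of vanishing at zero used later.\<close>

lemma nn_integral_green_bound: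
  assumes "\<bar>Re (csqrt \<alpha>)\<bar> < 1"
  obtains C where "0 < C" "\<And>g x. square_integrable g \<Longrightarrow> 0 < x \<Longrightarrow>
    (\<integral>\<^sup>+y. norm (green \<alpha> g x y) \<partial>half_line) \<le> ennreal (C * x powr (3/2) * norm (abs_L2 g))"
proof -
  obtain M \<rho> where M: "0 < M" "\<rho> < 1"
    "\<And>x y. 0 < y \<Longrightarrow> y \<le> x \<Longrightarrow> norm (green_kernel \<alpha> x y) \<le> M * (x powr (1/2 + \<rho>) * y powr (1/2 - \<rho>))"
    using green_kernel_bound[OF assms] by blast
  let ?C = "M / sqrt (2 - 2 * \<rho>)"
  have "(\<integral>\<^sup>+y. norm (green \<alpha> g x y) \<partial>half_line) \<le> ennreal (?C * x powr (3/2) * norm (abs_L2 g))"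
    if g: "square_integrable g" and x: "0 < x" for g x
  proof (rule ennreal_square_le)
    have [measurable]: "g \<in> borel_measurable half_line" using g by (simp add: square_integrable_def)
    let ?A = "\<integral>\<^sup>+y. (if y < x then ennreal (y powr (1/2 - \<rho>) * norm (g y)) else 0) \<partial>half_line"
    have "?A\<^sup>2 \<le> ennreal (x powr ((1 - 2 * \<rho>) + 1) / ((1 - 2 * \<rho>) + 1)) *
      (\<integral>\<^sup>+y. (if y < x then ennreal (y powr (1 - 2 * \<rho> - (1 - 2 * \<rho>)) * (norm (g y))\<^sup>2) else 0) \<partial>half_line)"
      by (rule weighted_Cauchy_Schwarz) (use M x in auto)
    also have "\<dots> \<le> ennreal (x powr ((1 - 2 * \<rho>) + 1) / ((1 - 2 * \<rho>) + 1)) *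
      (\<integral>\<^sup>+y. ennreal ((norm (g y))\<^sup>2) \<partial>half_line)"
      by (intro mult_left_mono nn_integral_mono) auto
    also have "\<dots> = ennreal (x powr (2 - 2 * \<rho>) / (2 - 2 * \<rho>) * (norm (abs_L2 g))\<^sup>2)"
      using M by (simp add: nn_integral_L2[OF g] flip: ennreal_mult)
    finally have A: "?A\<^sup>2 \<le> ennreal (x powr (2 - 2 * \<rho>) / (2 - 2 * \<rho>) * (norm (abs_L2 g))\<^sup>2)" .
    have "(\<integral>\<^sup>+y. norm (green \<alpha> g x y) \<partial>half_line)\<^sup>2 \<le> (ennreal (M * x powr (1/2 + \<rho>)) * ?A)\<^sup>2"
      by (intro power_mono nn_integral_green_le M x) auto
    also have "\<dots> = ennreal ((M * x powr (1/2 + \<rho>))\<^sup>2) * ?A\<^sup>2"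
      using M by (simp add: power_mult_distrib ennreal_power)
    also have "\<dots> \<le> ennreal ((M * x powr (1/2 + \<rho>))\<^sup>2) *
        ennreal (x powr (2 - 2 * \<rho>) / (2 - 2 * \<rho>) * (norm (abs_L2 g))\<^sup>2)"
      by (rule mult_left_mono[OF A]) simp
    also have "\<dots> = ennreal ((M * x powr (1/2 + \<rho>))\<^sup>2 *
        (x powr (2 - 2 * \<rho>) / (2 - 2 * \<rho>) * (norm (abs_L2 g))\<^sup>2))"
      using M by (intro ennreal_mult[symmetric]) auto
    also have "(M * x powr (1/2 + \<rho>))\<^sup>2 * (x powr (2 - 2 * \<rho>) / (2 - 2 * \<rho>) * (norm (abs_L2 g))\<^sup>2)
        = M\<^sup>2 * (x powr (1/2 + \<rho>) * x powr (1/2 + \<rho>) * x powr (2 - 2 * \<rho>)) / (2 - 2 * \<rho>) * (norm (abs_L2 g))\<^sup>2"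
      by (simp add: power2_eq_square mult_ac)
    also have "x powr (1/2 + \<rho>) * x powr (1/2 + \<rho>) * x powr (2 - 2 * \<rho>) = x powr (3/2) * x powr (3/2)"
      by (simp flip: powr_add)
    also have "M\<^sup>2 * (x powr (3/2) * x powr (3/2)) / (2 - 2 * \<rho>) * (norm (abs_L2 g))\<^sup>2
        = (?C * x powr (3/2) * norm (abs_L2 g))\<^sup>2"
      using M by (simp add: power_mult_distrib power_divide power2_eq_square[of "x powr _"])
    finally show "(\<integral>\<^sup>+y. norm (green \<alpha> g x y) \<partial>half_line)\<^sup>2 \<le> ennreal ((?C * x powr (3/2) * norm (abs_L2 g))\<^sup>2)" .
  qed (use M in auto)
  then show thesis using M by (intro that[of ?C]) auto
qed

context
  fixes \<alpha> :: complex
  assumes \<alpha>: "\<bar>Re (csqrt \<alpha>)\<bar> < 1"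
begin

lemma integrable_green:
  assumes "square_integrable g" "0 < x"
  shows "integrable half_line (green \<alpha> g x)"
proof (rule integrableI_bounded)
  show "green \<alpha> g x \<in> borel_measurable half_line"
    by (rule green_measurable) (use assms in \<open>simp add: square_integrable_def\<close>)
  obtain C where "(\<integral>\<^sup>+y. norm (green \<alpha> g x y) \<partial>half_line) \<le> ennreal (C * x powr (3/2) * norm (abs_L2 g))"
    using nn_integral_green_bound[OF \<alpha>] assms by metis
  then show "(\<integral>\<^sup>+y. norm (green \<alpha> g x y) \<partial>half_line) < \<infinity>" by (rule le_less_trans) simp
qed

lemma green_op_bound:
  obtains C where "0 < C"
    "\<And>g x. square_integrable g \<Longrightarrow> 0 < x \<Longrightarrow> (\<integral>y. norm (green \<alpha> g x y) \<partial>half_line) \<le> C * x powr (3/2) * norm (abs_L2 g)"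
    "\<And>g x. square_integrable g \<Longrightarrow> 0 < x \<Longrightarrow> norm (green_op \<alpha> g x) \<le> C * x powr (3/2) * norm (abs_L2 g)"
proof -
  obtain C where C: "0 < C" "\<And>g x. square_integrable g \<Longrightarrow> 0 < x \<Longrightarrow>
    (\<integral>\<^sup>+y. norm (green \<alpha> g x y) \<partial>half_line) \<le> ennreal (C * x powr (3/2) * norm (abs_L2 g))"
    using nn_integral_green_bound[OF \<alpha>] by blast
  have 1: "(\<integral>y. norm (green \<alpha> g x y) \<partial>half_line) \<le> C * x powr (3/2) * norm (abs_L2 g)"
    if "square_integrable g" "0 < x" for g x
  proof -
    have "ennreal (\<integral>y. norm (green \<alpha> g x y) \<partial>half_line) = (\<integral>\<^sup>+y. norm (green \<alpha> g x y) \<partial>half_line)"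
      using integrable_green[OF that] by (intro nn_integral_eq_integral[symmetric]) auto
    also have "\<dots> \<le> ennreal (C * x powr (3/2) * norm (abs_L2 g))" by (rule C(2)[OF that])
    finally show ?thesis using C(1) by (subst (asm) ennreal_le_iff) auto
  qed
  show thesis
  proof (rule that[OF C(1) 1])
    show "norm (green_op \<alpha> g x) \<le> C * x powr (3/2) * norm (abs_L2 g)" if "square_integrable g" "0 < x" for g x
      unfolding green_op_def by (rule order_trans[OF integral_norm_bound 1[OF that]])
  qed
qed

text \<open>The kernel bound reduces the claim to Hardy's inequality for |g|. Division by x^2 gains
  decay both at zero and at infinity, so the quotient lies in the space although the integral itself
  need not.\<close>

lemma green_op_Hardy:
  obtains C where "0 < C"
    "\<And>g. square_integrable g \<Longrightarrow> square_integrable (\<lambda>x. green_op \<alpha> g x / (complex_of_real x)\<^sup>2)"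
    "\<And>g. square_integrable g \<Longrightarrow>
       norm (abs_L2 (\<lambda>x. green_op \<alpha> g x / (complex_of_real x)\<^sup>2)) \<le> C * norm (abs_L2 g)"
proof -
  obtain M \<rho> where M: "0 < M" "\<rho> < 1"
    "\<And>x y. 0 < y \<Longrightarrow> y \<le> x \<Longrightarrow> norm (green_kernel \<alpha> x y) \<le> M * (x powr (1/2 + \<rho>) * y powr (1/2 - \<rho>))"
    using green_kernel_bound[OF \<alpha>] by blast
  let ?C = "M / (1 - \<rho>)"
  have bound: "(\<integral>\<^sup>+x. ennreal ((norm (green_op \<alpha> g x / (complex_of_real x)\<^sup>2))\<^sup>2) \<partial>half_line)
      \<le> ennreal ((?C * norm (abs_L2 g))\<^sup>2)" if g: "square_integrable g" for g
  proof -
    have [measurable]: "g \<in> borel_measurable half_line" using g by (simp add: square_integrable_def)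
    let ?A = "\<lambda>x. \<integral>\<^sup>+y. (if y < x then ennreal (y powr (1/2 - \<rho>) * norm (g y)) else 0) \<partial>half_line"
    have "(\<integral>\<^sup>+x. ennreal ((norm (green_op \<alpha> g x / (complex_of_real x)\<^sup>2))\<^sup>2) \<partial>half_line)
      \<le> (\<integral>\<^sup>+x. ennreal (M\<^sup>2) * (ennreal (x powr (2 * \<rho> - 3)) * (?A x)\<^sup>2) \<partial>half_line)"
    proof (rule nn_integral_mono)
      fix x assume "x \<in> space half_line"
      then have x: "0 < x" by simp
      have "ennreal (norm (green_op \<alpha> g x)) \<le> (\<integral>\<^sup>+y. norm (green \<alpha> g x y) \<partial>half_line)"
        unfolding green_op_def by (rule integral_norm_bound_ennreal[OF integrable_green[OF g x]])
      also have "\<dots> \<le> ennreal (M * x powr (1/2 + \<rho>)) * ?A x"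
        by (rule nn_integral_green_le[OF M(3)]) (use M x in auto)
      finally have "(ennreal (norm (green_op \<alpha> g x)))\<^sup>2 \<le> (ennreal (M * x powr (1/2 + \<rho>)) * ?A x)\<^sup>2"
        by (intro power_mono) auto
      also have "\<dots> = ennreal ((M * x powr (1/2 + \<rho>))\<^sup>2) * (?A x)\<^sup>2"
        using M by (simp add: power_mult_distrib ennreal_power)
      finally have "ennreal (1 / x ^ 4) * ennreal ((norm (green_op \<alpha> g x))\<^sup>2)
          \<le> ennreal (1 / x ^ 4) * (ennreal ((M * x powr (1/2 + \<rho>))\<^sup>2) * (?A x)\<^sup>2)"
        by (intro mult_left_mono) (simp_all add: ennreal_power)
      moreover have "(norm (green_op \<alpha> g x / (complex_of_real x)\<^sup>2))\<^sup>2 = 1 / x ^ 4 * (norm (green_op \<alpha> g x))\<^sup>2"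
        using x by (simp add: norm_divide norm_power power_divide flip: power_mult)
      \<comment> \<open>The exponents add up to (1 + 2\<rho>) - 4 = 2\<rho> - 3, the weight in
        \<open>Hardy_inequality\<close>.\<close>
      moreover have "1 / x ^ 4 * (M * x powr (1/2 + \<rho>))\<^sup>2 = M\<^sup>2 * x powr (2 * \<rho> - 3)"
      proof -
        have "1 / x ^ 4 = x powr (- 4)" using x by (simp add: powr_minus field_simps powr_numeral)
        then have "1 / x ^ 4 * (M * x powr (1/2 + \<rho>))\<^sup>2
            = M\<^sup>2 * (x powr (- 4) * x powr (1/2 + \<rho>) * x powr (1/2 + \<rho>))"
          by (simp add: power2_eq_square mult_ac)
        also have "x powr (- 4) * x powr (1/2 + \<rho>) * x powr (1/2 + \<rho>) = x powr (2 * \<rho> - 3)"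
          by (simp flip: powr_add)
        finally show ?thesis .
      qed
      ultimately show "ennreal ((norm (green_op \<alpha> g x / (complex_of_real x)\<^sup>2))\<^sup>2)
          \<le> ennreal (M\<^sup>2) * (ennreal (x powr (2 * \<rho> - 3)) * (?A x)\<^sup>2)"
        using x by (simp add: mult.assoc[symmetric] flip: ennreal_mult)
    qed
    also have "\<dots> = ennreal (M\<^sup>2) * (\<integral>\<^sup>+x. ennreal (x powr (2 * \<rho> - 3)) * (?A x)\<^sup>2 \<partial>half_line)"
      by (rule nn_integral_cmult) measurable
    also have "\<dots> \<le> ennreal (M\<^sup>2) * (ennreal (1 / (1 - \<rho>)\<^sup>2) * (\<integral>\<^sup>+y. ennreal ((norm (g y))\<^sup>2) \<partial>half_line))"
      by (intro mult_left_mono Hardy_inequality M) auto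
    also have "\<dots> = ennreal (M\<^sup>2 * (1 / (1 - \<rho>)\<^sup>2 * (norm (abs_L2 g))\<^sup>2))"
      by (simp add: nn_integral_L2[OF g] flip: ennreal_mult)
    also have "M\<^sup>2 * (1 / (1 - \<rho>)\<^sup>2 * (norm (abs_L2 g))\<^sup>2) = (?C * norm (abs_L2 g))\<^sup>2"
      by (simp add: power_mult_distrib power_divide)
    finally show ?thesis .
  qed
  have sq: "square_integrable (\<lambda>x. green_op \<alpha> g x / (complex_of_real x)\<^sup>2)" if g: "square_integrable g" for g
    unfolding square_integrable_def
  proof
    have [measurable]: "g \<in> borel_measurable half_line" using g by (simp add: square_integrable_def)
    have [measurable]: "green_op \<alpha> g \<in> borel_measurable half_line" by (rule green_op_measurable) measurable
    show [measurable]: "(\<lambda>x. green_op \<alpha> g x / (complex_of_real x)\<^sup>2) \<in> borel_measurable half_line" by measurable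
    show "integrable half_line (\<lambda>x. (cmod (green_op \<alpha> g x / (complex_of_real x)\<^sup>2))\<^sup>2)"
    proof (rule integrableI_bounded)
      show "(\<integral>\<^sup>+x. ennreal (norm ((cmod (green_op \<alpha> g x / (complex_of_real x)\<^sup>2))\<^sup>2)) \<partial>half_line) < \<infinity>"
        using le_less_trans[OF bound[OF g]] by simp
    qed measurable
  qed
  show thesis
  proof (rule that[OF _ sq])
    show "0 < ?C" using M by simp
    show "norm (abs_L2 (\<lambda>x. green_op \<alpha> g x / (complex_of_real x)\<^sup>2)) \<le> ?C * norm (abs_L2 g)"
      if g: "square_integrable g" for g
    proof (rule power2_le_imp_le)
      have "ennreal ((norm (abs_L2 (\<lambda>x. green_op \<alpha> g x / (complex_of_real x)\<^sup>2)))\<^sup>2)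
          \<le> ennreal ((?C * norm (abs_L2 g))\<^sup>2)"
        by (rule bound[OF g, unfolded nn_integral_L2[OF sq[OF g]]])
      then show "(norm (abs_L2 (\<lambda>x. green_op \<alpha> g x / (complex_of_real x)\<^sup>2)))\<^sup>2 \<le> (?C * norm (abs_L2 g))\<^sup>2"
        by (rule ennreal_le_iff[THEN iffD1, rotated]) simp
      show "0 \<le> ?C * norm (abs_L2 g)" using M by simp
    qed
  qed
qed

text \<open>Green's identity on [y, c], with \<open>c\<close> so large that \<phi> and its image
  vanish beyond it. The kernel is annihilated by the expression in x, and at x = y it vanishes with
  slope -1, so only \<phi>(y) survives.\<close>

lemma green_kernel_bessel_integral:
  assumes t: "\<phi> \<in> test_functions" and y: "0 < y"
  shows "(\<integral>x. (if y < x then green_kernel \<alpha> x y * bessel \<alpha> \<phi> x else 0) \<partial>half_line) = \<phi> y"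
proof -
  obtain a b where ab: "0 < a" "a < b" "\<And>x. 0 < x \<Longrightarrow> x \<notin> {a..b} \<Longrightarrow> \<phi> x = 0" and s: "smooth_on {0<..} \<phi>"
    using test_functionsE[OF t] by metis
  obtain a' b' where ab': "0 < a'" "a' < b'" "\<And>x. 0 < x \<Longrightarrow> x \<notin> {a'..b'} \<Longrightarrow> bessel \<alpha> \<phi> x = 0"
    using test_functionsE[OF bessel_test[OF t]] by metis
  define c where "c = max y (max b b') + 1"
  have c: "0 < c" "y \<le> c" "c \<notin> {a..b}" using y by (auto simp: c_def)
  let ?k = "\<lambda>x. green_kernel \<alpha> x y" and ?k' = "\<lambda>x. dsol1 \<alpha> x * sol2 \<alpha> y - dsol2 \<alpha> x * sol1 \<alpha> y"
  let ?F = "\<lambda>x. if y < x then green_kernel \<alpha> x y * bessel \<alpha> \<phi> x else 0"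
  have k: "(?k has_vector_derivative ?k' x) (at x)" if "0 < x" for x
    unfolding green_kernel_def
    by (intro has_vector_derivative_diff has_vector_derivative_mult_left
        has_vector_derivative_sol1 has_vector_derivative_sol2 that)
  have k': "(?k' has_vector_derivative (\<alpha> - 1/4) * (1 / (complex_of_real x)\<^sup>2) * ?k x) (at x)" if "0 < x" for x
  proof -
    have "(?k' has_vector_derivative (\<alpha> - 1/4) * (1 / (complex_of_real x)\<^sup>2) * sol1 \<alpha> x * sol2 \<alpha> y
        - (\<alpha> - 1/4) * (1 / (complex_of_real x)\<^sup>2) * sol2 \<alpha> x * sol1 \<alpha> y) (at x)"
      by (intro has_vector_derivative_diff has_vector_derivative_mult_left
          has_vector_derivative_dsol1 has_vector_derivative_dsol2 that)
    then show ?thesis by (simp only: green_kernel_def right_diff_distrib mult.assoc)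
  qed
  have b0: "bessel \<alpha> ?k x = 0" if "0 < x" for x
    by (subst bessel_eq[OF k k' that]) simp_all
  have [measurable]: "bessel \<alpha> \<phi> \<in> borel_measurable half_line"
    by (rule test_measurable[OF bessel_test[OF t]])
  have "integrable half_line ?F"
  proof (rule Bochner_Integration.integrable_bound)
    have "(\<lambda>x. ?k x) = (\<lambda>x. sol2 \<alpha> y * sol1 \<alpha> x - sol1 \<alpha> y * sol2 \<alpha> x)" by (auto simp: green_kernel_def)
    moreover have "smooth_on {0<..} (\<lambda>x. sol2 \<alpha> y * sol1 \<alpha> x - sol1 \<alpha> y * sol2 \<alpha> x)"
      by (rule smooth_on_diff[OF smooth_on_mult[OF smooth_on_const smooth_sol1] smooth_on_mult[OF smooth_on_const smooth_sol2]])
    ultimately have "smooth_on {0<..} ?k" by simp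
    then show "integrable half_line (\<lambda>x. ?k x * bessel \<alpha> \<phi> x)"
      by (intro integrable_mult_test locally_integrable_continuous smooth_on_imp_continuous_on bessel_test t)
    show "?F \<in> borel_measurable half_line" unfolding green_kernel_def by measurable
  qed auto
  then show ?thesis
  proof (rule half_line_integral_eq[OF _ y])
    show "?F x = 0" if "0 < x" "x \<notin> {y..c}" for x
    proof (cases "y < x")
      case True
      then have n: "x \<notin> {a'..b'}" using that by (auto simp: c_def)
      show ?thesis unfolding ab'(3)[OF that(1) n] by simp
    qed simp
    have "((\<lambda>x. ?k x * bessel \<alpha> \<phi> x - bessel \<alpha> ?k x * \<phi> x) has_integral
      (?k' c * \<phi> c - ?k c * vector_derivative \<phi> (at c)) - (?k' y * \<phi> y - ?k y * vector_derivative \<phi> (at y))) {y..c}"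
      by (rule green_identity[OF k k' smooth_half_lineD(2)[OF s] smooth_half_lineD(2)[OF smooth_half_lineD(1)[OF s]] y c(2)])
    moreover have "(?k' c * \<phi> c - ?k c * vector_derivative \<phi> (at c)) - (?k' y * \<phi> y - ?k y * vector_derivative \<phi> (at y)) = \<phi> y"
    proof -
      have "?k y = 0" by (simp add: green_kernel_def)
      moreover have "?k' y = - 1" using wronskian[OF y, of \<alpha>] by (simp add: algebra_simps)
      moreover have "vector_derivative \<phi> (at c) = 0"
        by (rule vector_derivative_zero_outside[OF ab(3) c(1,3)])
      ultimately show ?thesis unfolding ab(3)[OF c(1,3)] by simp
    qed
    ultimately have "((\<lambda>x. ?k x * bessel \<alpha> \<phi> x - bessel \<alpha> ?k x * \<phi> x) has_integral \<phi> y) {y..c}" by simp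
    then show "(?F has_integral \<phi> y) {y..c}"
    proof (rule has_integral_eq[rotated])
      fix x assume "x \<in> {y..c}"
      then show "?k x * bessel \<alpha> \<phi> x - bessel \<alpha> ?k x * \<phi> x = ?F x"
        using b0[of x] y by (cases "x = y") (auto simp: green_kernel_def)
    qed
  qed
qed

text \<open>Exchanging the integrals moves the expression onto the kernel, where the previous lemma
  applies. Fubini is justified by the x^(3/2) bound times a test function.\<close>

lemma green_op_weak_solution:
  assumes g: "square_integrable g" and t: "\<phi> \<in> test_functions"
  shows "(\<integral>x. green_op \<alpha> g x * bessel \<alpha> \<phi> x \<partial>half_line) = (\<integral>y. g y * \<phi> y \<partial>half_line)"
proof -
  have [measurable]: "g \<in> borel_measurable half_line" using g by (simp add: square_integrable_def)
  have [measurable]: "bessel \<alpha> \<phi> \<in> borel_measurable half_line"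
    by (rule test_measurable[OF bessel_test[OF t]])
  let ?f = "\<lambda>x y. green \<alpha> g x y * bessel \<alpha> \<phi> x"
  have green2[measurable]: "(\<lambda>z. green \<alpha> g (fst z) (snd z)) \<in> borel_measurable (half_line \<Otimes>\<^sub>M half_line)"
    using green_measurable_pair[of g \<alpha>] by (simp add: split_beta)
  obtain C where C: "0 < C"
    "\<And>g x. square_integrable g \<Longrightarrow> 0 < x \<Longrightarrow> (\<integral>y. norm (green \<alpha> g x y) \<partial>half_line) \<le> C * x powr (3/2) * norm (abs_L2 g)"
    by (rule green_op_bound) (rule that)
  have int: "integrable (half_line \<Otimes>\<^sub>M half_line) (\<lambda>(x, y). ?f x y)"
  proof (rule half_line_pair.Fubini_integrable)
    show "(\<lambda>(x, y). ?f x y) \<in> borel_measurable (half_line \<Otimes>\<^sub>M half_line)"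
      unfolding split_beta by measurable
    have cont: "continuous_on {0<..} (\<lambda>x. complex_of_real (C * x powr (3/2) * norm (abs_L2 g)))"
      by (intro continuous_intros) auto
    have "integrable half_line (\<lambda>x. complex_of_real (C * x powr (3/2) * norm (abs_L2 g)) * bessel \<alpha> \<phi> x)"
      by (rule integrable_mult_test[OF locally_integrable_continuous[OF cont] bessel_test[OF t]])
    then show "integrable half_line (\<lambda>x. \<integral>y. norm (case (x, y) of (x, y) \<Rightarrow> ?f x y) \<partial>half_line)"
    proof (rule Bochner_Integration.integrable_bound)
      show "(\<lambda>x. \<integral>y. norm (case (x, y) of (x, y) \<Rightarrow> ?f x y) \<partial>half_line) \<in> borel_measurable half_line"
        unfolding split_beta by (rule half_line.borel_measurable_lebesgue_integral) (simp add: split_beta)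
      show "AE x in half_line. norm (\<integral>y. norm (case (x, y) of (x, y) \<Rightarrow> ?f x y) \<partial>half_line)
          \<le> norm (complex_of_real (C * x powr (3/2) * norm (abs_L2 g)) * bessel \<alpha> \<phi> x)"
      proof (rule AE_I2)
        fix x assume "x \<in> space half_line"
        then have x: "0 < x" by simp
        have "norm (\<integral>y. norm (case (x, y) of (x, y) \<Rightarrow> ?f x y) \<partial>half_line)
            = (\<integral>y. norm (green \<alpha> g x y) \<partial>half_line) * norm (bessel \<alpha> \<phi> x)"
          by (simp add: norm_mult)
        also have "\<dots> \<le> (C * x powr (3/2) * norm (abs_L2 g)) * norm (bessel \<alpha> \<phi> x)"
          by (rule mult_right_mono[OF C(2)[OF g x]]) simp
        finally show "norm (\<integral>y. norm (case (x, y) of (x, y) \<Rightarrow> ?f x y) \<partial>half_line)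
          \<le> norm (complex_of_real (C * x powr (3/2) * norm (abs_L2 g)) * bessel \<alpha> \<phi> x)"
          using C(1) by (simp add: norm_mult)
      qed
    qed
    show "AE x in half_line. integrable half_line (\<lambda>y. case (x, y) of (x, y) \<Rightarrow> ?f x y)"
      by (rule AE_I2) (use integrable_green[OF g] in simp)
  qed
  have "(\<integral>x. green_op \<alpha> g x * bessel \<alpha> \<phi> x \<partial>half_line) = (\<integral>x. (\<integral>y. ?f x y \<partial>half_line) \<partial>half_line)"
    by (simp add: green_op_def)
  also have "\<dots> = (\<integral>y. (\<integral>x. ?f x y \<partial>half_line) \<partial>half_line)"
    by (rule half_line_pair.Fubini_integral[OF int, symmetric])
  also have "\<dots> = (\<integral>y. g y * \<phi> y \<partial>half_line)"
  proof (rule Bochner_Integration.integral_cong[OF refl])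
    fix y assume "y \<in> space half_line"
    then have y: "0 < y" by simp
    have "(\<integral>x. ?f x y \<partial>half_line)
        = (\<integral>x. g y * (if y < x then green_kernel \<alpha> x y * bessel \<alpha> \<phi> x else 0) \<partial>half_line)"
      by (rule Bochner_Integration.integral_cong) (auto simp: green_def)
    then show "(\<integral>x. ?f x y \<partial>half_line) = g y * \<phi> y"
      by (simp add: green_kernel_bessel_integral[OF t y])
  qed
  finally show ?thesis .
qed

end

section \<open>Representation of the elements of the maximal domain\<close>

lemma bessel_cong:
  assumes "open S" "S \<subseteq> {0<..}" "\<And>x. x \<in> S \<Longrightarrow> f x = g x" "x \<in> S"
    and g: "smooth_on {0<..} g"
  shows "bessel \<alpha> f x = bessel \<alpha> g x"
proof -
  have d: "vector_derivative f (at y) = vector_derivative g (at y)" if "y \<in> S" for y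
  proof (rule vector_derivative_at)
    show "(f has_vector_derivative vector_derivative g (at y)) (at y)"
      by (rule has_vector_derivative_transform_within_open[OF smooth_half_lineD(2)[OF g] assms(1) that])
        (use assms that in auto)
  qed
  have "vector_derivative (\<lambda>x. vector_derivative f (at x)) (at x) = vector_derivative (\<lambda>x. vector_derivative g (at x)) (at x)"
  proof (rule vector_derivative_at)
    show "((\<lambda>x. vector_derivative f (at x)) has_vector_derivative
        vector_derivative (\<lambda>x. vector_derivative g (at x)) (at x)) (at x)"
      by (rule has_vector_derivative_transform_within_open[OF smooth_half_lineD(2)[OF smooth_half_lineD(1)[OF g]] assms(1,4)])
        (use assms d in auto)
  qed
  then show ?thesis using assms(3)[OF assms(4)] by (simp only: bessel_def)
qed

lemma bessel_add:
  assumes "smooth_on {0<..} f" "smooth_on {0<..} g" "0 < x"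
  shows "bessel \<alpha> (\<lambda>x. f x + g x) x = bessel \<alpha> f x + bessel \<alpha> g x"
proof -
  have eq: "bessel \<alpha> (\<lambda>x. f x + g x) x = - (vector_derivative (\<lambda>x. vector_derivative f (at x)) (at x)
      + vector_derivative (\<lambda>x. vector_derivative g (at x)) (at x))
      + (\<alpha> - 1/4) * (1 / (complex_of_real x)\<^sup>2) * (f x + g x)"
    by (rule bessel_eq[OF has_vector_derivative_add[OF smooth_half_lineD(2)[OF assms(1)] smooth_half_lineD(2)[OF assms(2)]]
      has_vector_derivative_add[OF smooth_half_lineD(2)[OF smooth_half_lineD(1)[OF assms(1)]]
        smooth_half_lineD(2)[OF smooth_half_lineD(1)[OF assms(2)]]] assms(3)])
  show ?thesis
    unfolding eq bessel_def[of \<alpha> f] bessel_def[of \<alpha> g] by (simp only: distrib_left minus_add_distrib) (simp only: ac_simps)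
qed

lemma bessel_scale:
  assumes "smooth_on {0<..} f" "0 < x"
  shows "bessel \<alpha> (\<lambda>x. c * f x) x = c * bessel \<alpha> f x"
proof -
  have "bessel \<alpha> (\<lambda>x. c * f x) x = - (c * vector_derivative (\<lambda>x. vector_derivative f (at x)) (at x))
      + (\<alpha> - 1/4) * (1 / (complex_of_real x)\<^sup>2) * (c * f x)"
    by (rule bessel_eq[OF has_vector_derivative_mult_right[OF smooth_half_lineD(2)[OF assms(1)]]
      has_vector_derivative_mult_right[OF smooth_half_lineD(2)[OF smooth_half_lineD(1)[OF assms(1)]]] assms(2)])
  then show ?thesis by (simp only: bessel_def distrib_left mult_minus_right ac_simps)
qed

lemma antiderivative_test:
  assumes f: "continuous_on {0<..} f" and c: "0 < c" "c < d" "\<And>x. 0 < x \<Longrightarrow> x \<notin> {c..d} \<Longrightarrow> f x = (0::complex)"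
  obtains I where "\<And>x. 0 < x \<Longrightarrow> (I has_vector_derivative f x) (at x)"
    "\<And>x. 0 < x \<Longrightarrow> x < c \<Longrightarrow> I x = 0" "\<And>x. d \<le> x \<Longrightarrow> I x = (\<integral>x. f x \<partial>half_line)"
proof
  \<comment> \<open>The integration starts strictly below the support, which leaves room for a
    two-sided derivative at \<open>c\<close>.\<close>
  let ?I = "\<lambda>x. integral {c/2..x} f"
  have I0: "?I x = 0" if "x < c" for x
  proof -
    have "?I x = integral {c/2..x} (\<lambda>_. 0)"
    proof (rule Henstock_Kurzweil_Integration.integral_cong)
      fix y assume "y \<in> {c/2..x}"
      then show "f y = 0" using c(3)[of y] c(1) that by simp
    qed
    then show ?thesis by simp
  qed
  then show "0 < x \<Longrightarrow> x < c \<Longrightarrow> ?I x = 0" for x by blast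
  have sub: "{c/2..b} \<subseteq> {0<..}" for b using c(1) by auto
  show "(?I has_vector_derivative f x) (at x)" if x: "0 < x" for x
  proof (cases "x < c")
    case True
    have "((\<lambda>_. 0) has_vector_derivative f x) (at x)" using c(3)[of x] True x by simp
    then show ?thesis
      by (rule has_vector_derivative_transform_within_open[where S = "{..<c}"]) (use True I0 in auto)
  next
    case False
    have "(?I has_vector_derivative f x) (at x within {c/2..x+1})"
      by (rule integral_has_vector_derivative[OF continuous_on_subset[OF f sub]]) (use False c in auto)
    moreover have "at x within {c/2..x+1} = at x"
      by (rule at_within_interior) (use False c in auto)
    ultimately show ?thesis by simp
  qed
  show "?I x = (\<integral>x. f x \<partial>half_line)" if x: "d \<le> x" for x
  proof (rule half_line_integral_eq[symmetric])
    show "integrable half_line f"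
      by (rule locally_integrable_imp_integrable[OF locally_integrable_continuous[OF f] c(1,3)])
    show "0 < c / 2" using c by simp
    show "f y = 0" if "0 < y" "y \<notin> {c/2..x}" for y
      by (rule c(3)[OF that(1)]) (use that x c in auto)
    show "(f has_integral ?I x) {c/2..x}"
      by (rule integrable_integral[OF integrable_continuous_real[OF continuous_on_subset[OF f sub]]])
  qed
qed

text \<open>The variation of constants integral need not be square integrable, but divided by x^2 it
  gives a bounded operator; continuity statements are phrased through this operator.\<close>

definition hardy :: "complex \<Rightarrow> L2 \<Rightarrow> L2" where
  "hardy \<alpha> g = abs_L2 (\<lambda>x. green_op \<alpha> (rep_L2 g) x / (complex_of_real x)\<^sup>2)"

lemma rep_L2_measurable: "rep_L2 g \<in> borel_measurable half_line"
  using square_integrable_rep[of g] by (simp add: square_integrable_def)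

lemma AE_rep_add: "AE x in half_line. rep_L2 (f + g) x = rep_L2 f x + rep_L2 g x"
  using AE_rep_abs_L2[OF square_integrable_add[OF square_integrable_rep[of f] square_integrable_rep[of g]]]
  by (simp add: abs_rep_L2 flip: abs_L2_add[OF square_integrable_rep square_integrable_rep])

lemma AE_rep_scale: "AE x in half_line. rep_L2 (c *\<^sub>C f) x = c * rep_L2 f x"
  using AE_rep_abs_L2[OF square_integrable_scale[OF square_integrable_rep[of f]]]
  by (simp add: abs_rep_L2 flip: abs_L2_scale[OF square_integrable_rep])

context
  fixes \<alpha> :: complex
  assumes \<alpha>: "\<bar>Re (csqrt \<alpha>)\<bar> < 1"
begin

lemma square_integrable_green_op:
  "square_integrable g \<Longrightarrow> square_integrable (\<lambda>x. green_op \<alpha> g x / (complex_of_real x)\<^sup>2)"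
  by (rule green_op_Hardy[OF \<alpha>])

lemma rep_hardy: "AE x in half_line. rep_L2 (hardy \<alpha> g) x = green_op \<alpha> (rep_L2 g) x / (complex_of_real x)\<^sup>2"
  unfolding hardy_def by (rule AE_rep_abs_L2[OF square_integrable_green_op[OF square_integrable_rep]])

text \<open>The integral is x^2 times a square integrable function, and the factor x^2 is harmless
  on compact intervals.\<close>

lemma locally_integrable_green_op:
  assumes "square_integrable g"
  shows "locally_integrable (green_op \<alpha> g)"
proof -
  have l: "locally_integrable (\<lambda>x. green_op \<alpha> g x / (complex_of_real x)\<^sup>2 * (complex_of_real x)\<^sup>2)"
    by (intro locally_integrable_mult_continuous square_integrable_imp_locally_integrable
        square_integrable_green_op assms continuous_intros)
  have m: "green_op \<alpha> g \<in> borel_measurable half_line"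
    by (rule green_op_measurable) (use assms in \<open>simp add: square_integrable_def\<close>)
  show ?thesis unfolding locally_integrable_def
  proof (intro conjI allI impI m)
    fix a b :: real assume a: "0 < a"
    have "set_integrable half_line {a..b} (\<lambda>x. green_op \<alpha> g x / (complex_of_real x)\<^sup>2 * (complex_of_real x)\<^sup>2)"
      using l a by (simp only: locally_integrable_def)
    then show "set_integrable half_line {a..b} (green_op \<alpha> g)"
      unfolding set_integrable_def
      by (rule Bochner_Integration.integrable_cong[THEN iffD1, rotated -1]) simp_all
  qed
qed

lemma green_op_add:
  assumes "square_integrable f" "square_integrable g" "0 < x"
  shows "green_op \<alpha> (\<lambda>x. f x + g x) x = green_op \<alpha> f x + green_op \<alpha> g x"
proof -
  have "green_op \<alpha> (\<lambda>x. f x + g x) x = (\<integral>y. green \<alpha> f x y + green \<alpha> g x y \<partial>half_line)"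
    unfolding green_op_def
    by (rule Bochner_Integration.integral_cong) (auto simp: green_def distrib_left)
  also have "\<dots> = green_op \<alpha> f x + green_op \<alpha> g x"
    unfolding green_op_def using assms by (intro Bochner_Integration.integral_add integrable_green[OF \<alpha>])
  finally show ?thesis .
qed

lemma green_op_scale: "green_op \<alpha> (\<lambda>x. c * f x) x = c * green_op \<alpha> f x"
proof -
  have "green_op \<alpha> (\<lambda>x. c * f x) x = (\<integral>y. c * green \<alpha> f x y \<partial>half_line)"
    unfolding green_op_def
    by (rule Bochner_Integration.integral_cong) (auto simp: green_def)
  then show ?thesis by (simp add: green_op_def)
qed

lemma green_op_cong:
  assumes "f \<in> borel_measurable half_line" "g \<in> borel_measurable half_line" "AE x in half_line. f x = g x"
  shows "green_op \<alpha> f x = green_op \<alpha> g x"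
  unfolding green_op_def
proof (rule integral_cong_AE)
  show "AE y in half_line. green \<alpha> f x y = green \<alpha> g x y"
    using assms(3) by eventually_elim (simp add: green_def)
qed (use assms in \<open>auto intro: green_measurable\<close>)

lemma hardy_add: "hardy \<alpha> (f + g) = hardy \<alpha> f + hardy \<alpha> g"
  unfolding hardy_def
proof (subst abs_L2_add)
  show "abs_L2 (\<lambda>x. green_op \<alpha> (rep_L2 (f + g)) x / (complex_of_real x)\<^sup>2) =
    abs_L2 (\<lambda>x. green_op \<alpha> (rep_L2 f) x / (complex_of_real x)\<^sup>2 + green_op \<alpha> (rep_L2 g) x / (complex_of_real x)\<^sup>2)"
  proof (rule abs_L2_eqI)
    show "AE x in half_line. green_op \<alpha> (rep_L2 (f + g)) x / (complex_of_real x)\<^sup>2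
      = green_op \<alpha> (rep_L2 f) x / (complex_of_real x)\<^sup>2 + green_op \<alpha> (rep_L2 g) x / (complex_of_real x)\<^sup>2"
    proof (rule AE_I2)
      fix x assume "x \<in> space half_line"
      then have x: "0 < x" by simp
      have "green_op \<alpha> (rep_L2 (f + g)) x = green_op \<alpha> (\<lambda>x. rep_L2 f x + rep_L2 g x) x"
        by (rule green_op_cong) (auto intro: rep_L2_measurable AE_rep_add borel_measurable_add)
      then show "green_op \<alpha> (rep_L2 (f + g)) x / (complex_of_real x)\<^sup>2
        = green_op \<alpha> (rep_L2 f) x / (complex_of_real x)\<^sup>2 + green_op \<alpha> (rep_L2 g) x / (complex_of_real x)\<^sup>2"
        by (simp only: green_op_add[OF square_integrable_rep square_integrable_rep x] add_divide_distrib)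
    qed
  qed (intro square_integrable_add square_integrable_green_op square_integrable_rep)+
qed (intro square_integrable_green_op square_integrable_rep)+

lemma hardy_scale: "hardy \<alpha> (c *\<^sub>C f) = c *\<^sub>C hardy \<alpha> f"
  unfolding hardy_def
proof (subst abs_L2_scale)
  show "abs_L2 (\<lambda>x. green_op \<alpha> (rep_L2 (c *\<^sub>C f)) x / (complex_of_real x)\<^sup>2) =
    abs_L2 (\<lambda>x. c * (green_op \<alpha> (rep_L2 f) x / (complex_of_real x)\<^sup>2))"
  proof (rule abs_L2_eqI)
    show "AE x in half_line. green_op \<alpha> (rep_L2 (c *\<^sub>C f)) x / (complex_of_real x)\<^sup>2
      = c * (green_op \<alpha> (rep_L2 f) x / (complex_of_real x)\<^sup>2)"
    proof (rule AE_I2)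
      fix x assume "x \<in> space half_line"
      have "green_op \<alpha> (rep_L2 (c *\<^sub>C f)) x = green_op \<alpha> (\<lambda>x. c * rep_L2 f x) x"
        by (rule green_op_cong) (auto intro: rep_L2_measurable AE_rep_scale borel_measurable_times)
      then show "green_op \<alpha> (rep_L2 (c *\<^sub>C f)) x / (complex_of_real x)\<^sup>2
        = c * (green_op \<alpha> (rep_L2 f) x / (complex_of_real x)\<^sup>2)"
        by (simp only: green_op_scale times_divide_eq_right)
    qed
  qed (intro square_integrable_scale square_integrable_green_op square_integrable_rep)+
qed (intro square_integrable_green_op square_integrable_rep)

lemma hardy_bound: obtains C where "0 < C" "\<And>g. norm (hardy \<alpha> g) \<le> C * norm g"
proof -
  obtain C where C: "0 < C" "\<And>g. square_integrable g \<Longrightarrow>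
       norm (abs_L2 (\<lambda>x. green_op \<alpha> g x / (complex_of_real x)\<^sup>2)) \<le> C * norm (abs_L2 g)"
    by (rule green_op_Hardy[OF \<alpha>]) (rule that)
  show thesis
    by (rule that[OF C(1)]) (use C(2)[OF square_integrable_rep] in \<open>simp add: hardy_def abs_rep_L2\<close>)
qed

end

context cutoff
begin

lemma smooth_cut: "smooth_on {0<..} u \<Longrightarrow> smooth_on {0<..} (\<lambda>x. u x * \<xi> x)"
  by (rule smooth_on_mult[OF _ smooth])

text \<open>The cut off solution coincides with the solution near zero and with 0 beyond
  \<open>R\<close>, so the expression annihilates it in both regions.\<close>

lemma bessel_cut_test:
  assumes u: "smooth_on {0<..} u" and 0: "\<And>x. 0 < x \<Longrightarrow> bessel \<alpha> u x = 0"
  shows "bessel \<alpha> (\<lambda>x. u x * \<xi> x) \<in> test_functions"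
proof (rule test_functionsI[OF smooth_bessel[OF smooth_cut[OF u]]])
  show "0 < \<epsilon> / 2" "\<epsilon> / 2 < R + 1" using eps by auto
  fix x assume x: "0 < x" "x \<notin> {\<epsilon> / 2..R + 1}"
  show "bessel \<alpha> (\<lambda>x. u x * \<xi> x) x = 0"
  proof (cases "x < \<epsilon>")
    case True
    have "bessel \<alpha> (\<lambda>x. u x * \<xi> x) x = bessel \<alpha> u x"
      by (rule bessel_cong[where S = "{0<..<\<epsilon>}", OF _ _ _ _ u]) (use True x one in auto)
    then show ?thesis using 0[OF x(1)] by simp
  next
    case False
    have "bessel \<alpha> (\<lambda>x. u x * \<xi> x) x = bessel \<alpha> (\<lambda>_. 0) x"
      by (rule bessel_cong[where S = "{R<..}", OF _ _ _ _ smooth_on_const]) (use False x zero eps in auto)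
    also have "bessel \<alpha> (\<lambda>_. 0) x = 0" by (simp add: bessel_def)
    finally show ?thesis .
  qed
qed

lemma bessel_cut1: "bessel \<alpha> (\<lambda>x. sol1 \<alpha> x * \<xi> x) \<in> test_functions"
  by (rule bessel_cut_test[OF smooth_sol1 bessel_sol1])

lemma bessel_cut2: "bessel \<alpha> (\<lambda>x. sol2 \<alpha> x * \<xi> x) \<in> test_functions"
  by (rule bessel_cut_test[OF smooth_sol2 bessel_sol2])

text \<open>Subtracting the solution that \<open>\<phi>\<close> equals near infinity, cut off near zero, makes the
  solution \<open>\<phi>\<close> of \<open>bessel \<alpha> \<phi> = \<psi>\<close> vanishing near zero a test function.\<close>

lemma solve_test:
  assumes t: "\<psi> \<in> test_functions"
  obtains \<phi> where "\<phi> \<in> test_functions" "\<And>x. 0 < x \<Longrightarrow> bessel \<alpha> \<phi> x = \<psi> x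
    + (\<integral>x. sol2 \<alpha> x * \<psi> x \<partial>half_line) * bessel \<alpha> (\<lambda>x. sol1 \<alpha> x * \<xi> x) x
    - (\<integral>x. sol1 \<alpha> x * \<psi> x \<partial>half_line) * bessel \<alpha> (\<lambda>x. sol2 \<alpha> x * \<xi> x) x"
proof -
  obtain c d where cd: "0 < c" "c < d" "\<And>x. 0 < x \<Longrightarrow> x \<notin> {c..d} \<Longrightarrow> \<psi> x = 0" and s: "smooth_on {0<..} \<psi>"
    using test_functionsE[OF t] by metis
  define A where "A = (\<integral>x. sol1 \<alpha> x * \<psi> x \<partial>half_line)"
  define B where "B = (\<integral>x. sol2 \<alpha> x * \<psi> x \<partial>half_line)"
  have s1: "smooth_on {0<..} (\<lambda>x. sol1 \<alpha> x * \<psi> x)" by (rule smooth_on_mult[OF smooth_sol1 s])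
  have s2: "smooth_on {0<..} (\<lambda>x. sol2 \<alpha> x * \<psi> x)" by (rule smooth_on_mult[OF smooth_sol2 s])
  obtain I1 where I1: "\<And>x. 0 < x \<Longrightarrow> (I1 has_vector_derivative sol1 \<alpha> x * \<psi> x) (at x)"
    "\<And>x. 0 < x \<Longrightarrow> x < c \<Longrightarrow> I1 x = 0" "\<And>x. d \<le> x \<Longrightarrow> I1 x = (\<integral>x. sol1 \<alpha> x * \<psi> x \<partial>half_line)"
    by (rule antiderivative_test[OF smooth_on_imp_continuous_on[OF s1] cd(1,2)]) (simp add: cd(3), rule that)
  obtain I2 where I2: "\<And>x. 0 < x \<Longrightarrow> (I2 has_vector_derivative sol2 \<alpha> x * \<psi> x) (at x)"
    "\<And>x. 0 < x \<Longrightarrow> x < c \<Longrightarrow> I2 x = 0" "\<And>x. d \<le> x \<Longrightarrow> I2 x = (\<integral>x. sol2 \<alpha> x * \<psi> x \<partial>half_line)"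
    by (rule antiderivative_test[OF smooth_on_imp_continuous_on[OF s2] cd(1,2)]) (simp add: cd(3), rule that)
  have sI1: "smooth_on {0<..} I1"
    by (rule smooth_on_antiderivative[OF s1]) (simp add: has_vector_derivative_at_within[OF I1(1)])
  have sI2: "smooth_on {0<..} I2"
    by (rule smooth_on_antiderivative[OF s2]) (simp add: has_vector_derivative_at_within[OF I2(1)])
  \<comment> \<open>Variation of constants with smooth antiderivatives. It vanishes below the
    support of \<psi> and equals \<open>B * sol1 - A * sol2\<close> above it.\<close>
  define \<phi>1 where "\<phi>1 x = sol1 \<alpha> x * I2 x - sol2 \<alpha> x * I1 x" for x
  have s\<phi>1: "smooth_on {0<..} \<phi>1"
    unfolding \<phi>1_def by (rule smooth_on_diff[OF smooth_on_mult[OF smooth_sol1 sI2] smooth_on_mult[OF smooth_sol2 sI1]])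
  have d1: "(\<phi>1 has_vector_derivative dsol1 \<alpha> x * I2 x - dsol2 \<alpha> x * I1 x) (at x)" if "0 < x" for x
  proof -
    have "(\<phi>1 has_vector_derivative (sol1 \<alpha> x * (sol2 \<alpha> x * \<psi> x) + dsol1 \<alpha> x * I2 x)
        - (sol2 \<alpha> x * (sol1 \<alpha> x * \<psi> x) + dsol2 \<alpha> x * I1 x)) (at x)"
      unfolding \<phi>1_def
      by (intro has_vector_derivative_diff has_vector_derivative_mult
          has_vector_derivative_sol1 has_vector_derivative_sol2 I1(1) I2(1) that)
    then show ?thesis by (simp add: mult.left_commute)
  qed
  have d2: "((\<lambda>x. dsol1 \<alpha> x * I2 x - dsol2 \<alpha> x * I1 x) has_vector_derivative
      (\<alpha> - 1/4) * (1 / (complex_of_real x)\<^sup>2) * \<phi>1 x - \<psi> x) (at x)" if "0 < x" for x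
  proof -
    have "((\<lambda>x. dsol1 \<alpha> x * I2 x - dsol2 \<alpha> x * I1 x) has_vector_derivative
        (dsol1 \<alpha> x * (sol2 \<alpha> x * \<psi> x) + (\<alpha> - 1/4) * (1 / (complex_of_real x)\<^sup>2) * sol1 \<alpha> x * I2 x)
      - (dsol2 \<alpha> x * (sol1 \<alpha> x * \<psi> x) + (\<alpha> - 1/4) * (1 / (complex_of_real x)\<^sup>2) * sol2 \<alpha> x * I1 x)) (at x)"
      by (intro has_vector_derivative_diff has_vector_derivative_mult
          has_vector_derivative_dsol1 has_vector_derivative_dsol2 I1(1) I2(1) that)
    moreover have "(dsol1 \<alpha> x * (sol2 \<alpha> x * \<psi> x) + k * sol1 \<alpha> x * I2 x)
      - (dsol2 \<alpha> x * (sol1 \<alpha> x * \<psi> x) + k * sol2 \<alpha> x * I1 x) = k * \<phi>1 x - \<psi> x" for k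
    proof -
      have "(dsol1 \<alpha> x * (sol2 \<alpha> x * \<psi> x) + k * sol1 \<alpha> x * I2 x)
        - (dsol2 \<alpha> x * (sol1 \<alpha> x * \<psi> x) + k * sol2 \<alpha> x * I1 x)
        = k * \<phi>1 x - (sol1 \<alpha> x * dsol2 \<alpha> x - dsol1 \<alpha> x * sol2 \<alpha> x) * \<psi> x"
        by (simp add: \<phi>1_def algebra_simps)
      then show ?thesis by (simp add: wronskian[OF that])
    qed
    ultimately show ?thesis by (simp only:)
  qed
  have b1: "bessel \<alpha> \<phi>1 x = \<psi> x" if "0 < x" for x
    by (subst bessel_eq[OF d1 d2 that]) simp_all
  \<comment> \<open>This is \<open>- (1 - \<xi>)\<close> times \<open>B * sol1 - A * sol2\<close>:
    it cancels the tail of \<open>\<phi>1\<close> and is 0 near zero. It is split so that the pieces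
    without \<open>\<xi>\<close> are annihilated by the expression.\<close>
  let ?h = "\<lambda>x. (B * (sol1 \<alpha> x * \<xi> x) + (- A) * (sol2 \<alpha> x * \<xi> x)) + ((- B) * sol1 \<alpha> x + A * sol2 \<alpha> x)"
  let ?\<phi> = "\<lambda>x. \<phi>1 x + ?h x"
  note sc = smooth_on_mult[OF smooth_on_const]
  note sm = smooth_on_add[OF sc[OF smooth_cut[OF smooth_sol1]] sc[OF smooth_cut[OF smooth_sol2]]]
    smooth_on_add[OF sc[OF smooth_sol1] sc[OF smooth_sol2]]
  have s\<phi>: "smooth_on {0<..} ?\<phi>" by (rule smooth_on_add[OF s\<phi>1 smooth_on_add[OF sm]])
  show thesis
  proof (rule that)
    show "?\<phi> \<in> test_functions"
    proof (rule test_functionsI[OF s\<phi>])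
      show "0 < min c \<epsilon> / 2" "min c \<epsilon> / 2 < max d R" using cd eps by auto
      fix x assume x: "0 < x" "x \<notin> {min c \<epsilon> / 2..max d R}"
      show "?\<phi> x = 0"
      proof (cases "x < min c \<epsilon>")
        case True
        then show ?thesis using I1(2)[OF x(1)] I2(2)[OF x(1)] one[OF x(1)] by (simp add: \<phi>1_def algebra_simps)
      next
        case False
        then have "d \<le> x" "R \<le> x" using x by auto
        then show ?thesis using I1(3)[of x, folded A_def] I2(3)[of x, folded B_def] zero[of x] by (simp add: \<phi>1_def algebra_simps)
      qed
    qed
    fix x :: real assume x: "0 < x"
    have "bessel \<alpha> ?\<phi> x = bessel \<alpha> \<phi>1 x + ((bessel \<alpha> (\<lambda>x. B * (sol1 \<alpha> x * \<xi> x)) x + bessel \<alpha> (\<lambda>x. (- A) * (sol2 \<alpha> x * \<xi> x)) x)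
        + (bessel \<alpha> (\<lambda>x. (- B) * sol1 \<alpha> x) x + bessel \<alpha> (\<lambda>x. A * sol2 \<alpha> x) x))"
      by (simp only: bessel_add[OF s\<phi>1 smooth_on_add[OF sm] x] bessel_add[OF sm x]
          bessel_add[OF sc[OF smooth_cut[OF smooth_sol1]] sc[OF smooth_cut[OF smooth_sol2]] x]
          bessel_add[OF sc[OF smooth_sol1] sc[OF smooth_sol2] x])
    also have "\<dots> = \<psi> x + B * bessel \<alpha> (\<lambda>x. sol1 \<alpha> x * \<xi> x) x - A * bessel \<alpha> (\<lambda>x. sol2 \<alpha> x * \<xi> x) x"
      by (simp only: b1[OF x] bessel_scale[OF smooth_cut[OF smooth_sol1] x] bessel_scale[OF smooth_cut[OF smooth_sol2] x]
          bessel_scale[OF smooth_sol1 x] bessel_scale[OF smooth_sol2 x] bessel_sol1[OF x] bessel_sol2[OF x]) simp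
    finally show "bessel \<alpha> ?\<phi> x = \<psi> x
        + (\<integral>x. sol2 \<alpha> x * \<psi> x \<partial>half_line) * bessel \<alpha> (\<lambda>x. sol1 \<alpha> x * \<xi> x) x
        - (\<integral>x. sol1 \<alpha> x * \<psi> x \<partial>half_line) * bessel \<alpha> (\<lambda>x. sol2 \<alpha> x * \<xi> x) x"
      by (simp only: A_def B_def)
  qed
qed

text \<open>This is the integral of f minus the variation of constants integral of g against
  \<theta>, see \<open>pairing_eq\<close>. Shifting x^2 onto \<theta> makes its continuity in (f, g)
  follow from the boundedness of \<open>hardy\<close>.\<close>

definition pairing :: "complex \<Rightarrow> (real \<Rightarrow> complex) \<Rightarrow> L2 \<Rightarrow> L2 \<Rightarrow> complex" where
  "pairing \<alpha> \<theta> f g = distribution_of f \<theta> - distribution_of (hardy \<alpha> g) (\<lambda>x. (complex_of_real x)\<^sup>2 * \<theta> x)"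

text \<open>Transposing \<open>solve_test\<close> gives the formula: there the integral of
  \<open>sol1\<close> against \<psi> multiplies the image of the cut off \<open>sol2\<close>, so the
  coefficient of \<open>sol1\<close> is a pairing with the latter. For \<open>coef2\<close> the
  roles and the sign are exchanged.\<close>

definition coef1 :: "complex \<Rightarrow> L2 \<Rightarrow> L2 \<Rightarrow> complex" where
  "coef1 \<alpha> = pairing \<alpha> (bessel \<alpha> (\<lambda>x. sol2 \<alpha> x * \<xi> x))"

definition coef2 :: "complex \<Rightarrow> L2 \<Rightarrow> L2 \<Rightarrow> complex" where
  "coef2 \<alpha> f g = - pairing \<alpha> (bessel \<alpha> (\<lambda>x. sol1 \<alpha> x * \<xi> x)) f g"

lemma smooth_square: "smooth_on {0<..} (\<lambda>x. (complex_of_real x)\<^sup>2)"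
  by (rule smooth_on_holomorphic[where F = "\<lambda>w. w\<^sup>2"]) (auto intro!: holomorphic_intros)

lemma pairing_eq:
  assumes \<alpha>: "\<bar>Re (csqrt \<alpha>)\<bar> < 1" and t: "\<theta> \<in> test_functions"
  shows "pairing \<alpha> \<theta> f g = (\<integral>x. (rep_L2 f x - green_op \<alpha> (rep_L2 g) x) * \<theta> x \<partial>half_line)"
proof -
  have t2: "(\<lambda>x. (complex_of_real x)\<^sup>2 * \<theta> x) \<in> test_functions" by (rule mult_test[OF t smooth_square])
  have "distribution_of (hardy \<alpha> g) (\<lambda>x. (complex_of_real x)\<^sup>2 * \<theta> x)
      = (\<integral>x. (green_op \<alpha> (rep_L2 g) x / (complex_of_real x)\<^sup>2) * ((complex_of_real x)\<^sup>2 * \<theta> x) \<partial>half_line)"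
    by (rule distribution_of_cong[OF rep_hardy[OF \<alpha>] _ test_measurable[OF t2]])
      (use square_integrable_green_op[OF \<alpha> square_integrable_rep] in \<open>simp add: square_integrable_def\<close>)
  also have "\<dots> = (\<integral>x. green_op \<alpha> (rep_L2 g) x * \<theta> x \<partial>half_line)"
    by (rule Bochner_Integration.integral_cong) auto
  finally have 1: "distribution_of (hardy \<alpha> g) (\<lambda>x. (complex_of_real x)\<^sup>2 * \<theta> x)
    = (\<integral>x. green_op \<alpha> (rep_L2 g) x * \<theta> x \<partial>half_line)" .
  have "(\<integral>x. (rep_L2 f x - green_op \<alpha> (rep_L2 g) x) * \<theta> x \<partial>half_line)
    = (\<integral>x. rep_L2 f x * \<theta> x - green_op \<alpha> (rep_L2 g) x * \<theta> x \<partial>half_line)"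
    by (simp only: left_diff_distrib)
  also have "\<dots> = (\<integral>x. rep_L2 f x * \<theta> x \<partial>half_line) - (\<integral>x. green_op \<alpha> (rep_L2 g) x * \<theta> x \<partial>half_line)"
    by (intro Bochner_Integration.integral_diff integrable_mult_test t locally_integrable_green_op[OF \<alpha>]
        square_integrable_imp_locally_integrable square_integrable_rep)
  finally show ?thesis unfolding pairing_def 1 by (simp add: distribution_of_def)
qed

text \<open>The difference \<open>v\<close> of f and the variation of constants integral is
  orthogonal to all images of test functions. Inserting \<open>solve_test\<close>, its integral
  against any \<psi> equals that of the combination of solutions with these coefficients, and the
  fundamental lemma identifies the two.\<close>

theorem representation:
  assumes \<alpha>: "\<bar>Re (csqrt \<alpha>)\<bar> < 1" and fg: "(f, g) \<in> L_max \<alpha>"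
  shows "AE x in half_line. rep_L2 f x =
    green_op \<alpha> (rep_L2 g) x + coef1 \<alpha> f g * sol1 \<alpha> x + coef2 \<alpha> f g * sol2 \<alpha> x"
proof -
  define v where "v x = rep_L2 f x - green_op \<alpha> (rep_L2 g) x" for x
  have lv: "locally_integrable v" unfolding v_def
    by (intro locally_integrable_diff locally_integrable_green_op[OF \<alpha>]
        square_integrable_imp_locally_integrable square_integrable_rep)
  have v0: "(\<integral>x. v x * bessel \<alpha> \<phi> x \<partial>half_line) = 0" if t: "\<phi> \<in> test_functions" for \<phi>
  proof -
    have "(\<integral>x. v x * bessel \<alpha> \<phi> x \<partial>half_line)
      = (\<integral>x. rep_L2 f x * bessel \<alpha> \<phi> x - green_op \<alpha> (rep_L2 g) x * bessel \<alpha> \<phi> x \<partial>half_line)"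
      by (simp only: v_def left_diff_distrib)
    also have "\<dots> = (\<integral>x. rep_L2 f x * bessel \<alpha> \<phi> x \<partial>half_line) - (\<integral>x. green_op \<alpha> (rep_L2 g) x * bessel \<alpha> \<phi> x \<partial>half_line)"
      by (intro Bochner_Integration.integral_diff integrable_mult_test bessel_test t locally_integrable_green_op[OF \<alpha>]
        square_integrable_imp_locally_integrable square_integrable_rep)
    also have "(\<integral>x. rep_L2 f x * bessel \<alpha> \<phi> x \<partial>half_line) = (\<integral>x. rep_L2 g x * \<phi> x \<partial>half_line)"
      using fg t unfolding L_max_iff distribution_of_def by blast
    also have "(\<integral>x. green_op \<alpha> (rep_L2 g) x * bessel \<alpha> \<phi> x \<partial>half_line) = (\<integral>x. rep_L2 g x * \<phi> x \<partial>half_line)"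
      by (rule green_op_weak_solution[OF \<alpha> square_integrable_rep t])
    finally show ?thesis by simp
  qed
  let ?t1 = "bessel \<alpha> (\<lambda>x. sol1 \<alpha> x * \<xi> x)" and ?t2 = "bessel \<alpha> (\<lambda>x. sol2 \<alpha> x * \<xi> x)"
  let ?s = "\<lambda>x. coef1 \<alpha> f g * sol1 \<alpha> x + coef2 \<alpha> f g * sol2 \<alpha> x"
  have c1: "coef1 \<alpha> f g = (\<integral>x. v x * ?t2 x \<partial>half_line)"
    unfolding coef1_def v_def by (rule pairing_eq[OF \<alpha> bessel_cut2])
  have c2: "coef2 \<alpha> f g = - (\<integral>x. v x * ?t1 x \<partial>half_line)"
    unfolding coef2_def v_def by (subst pairing_eq[OF \<alpha> bessel_cut1]) (rule refl)
  have ls: "locally_integrable ?s"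
    by (intro locally_integrable_add locally_integrable_scale locally_integrable_continuous
        smooth_on_imp_continuous_on smooth_sol1 smooth_sol2)
  have "AE x in half_line. v x - ?s x = 0"
  proof (rule fundamental_lemma)
    show "locally_integrable (\<lambda>x. v x - ?s x)" by (rule locally_integrable_diff[OF lv ls])
    fix \<psi> assume t: "\<psi> \<in> test_functions"
    define A where "A = (\<integral>x. sol1 \<alpha> x * \<psi> x \<partial>half_line)"
    define B where "B = (\<integral>x. sol2 \<alpha> x * \<psi> x \<partial>half_line)"
    obtain \<phi> where \<phi>: "\<phi> \<in> test_functions" "\<And>x. 0 < x \<Longrightarrow> bessel \<alpha> \<phi> x = \<psi> x
        + (\<integral>x. sol2 \<alpha> x * \<psi> x \<partial>half_line) * ?t1 x - (\<integral>x. sol1 \<alpha> x * \<psi> x \<partial>half_line) * ?t2 x"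
      by (rule solve_test[OF t]) (rule that)
    note b = \<phi>(2)[folded A_def B_def]
    have i: "integrable half_line (\<lambda>x. v x * \<psi> x)" "integrable half_line (\<lambda>x. v x * ?t1 x)"
      "integrable half_line (\<lambda>x. v x * ?t2 x)"
      by (intro integrable_mult_test lv t bessel_cut1 bessel_cut2)+
    have "0 = (\<integral>x. v x * bessel \<alpha> \<phi> x \<partial>half_line)" by (rule v0[OF \<phi>(1), symmetric])
    also have "\<dots> = (\<integral>x. v x * \<psi> x + B * (v x * ?t1 x) - A * (v x * ?t2 x) \<partial>half_line)"
      by (rule Bochner_Integration.integral_cong) (simp_all add: b algebra_simps)
    also have "\<dots> = (\<integral>x. v x * \<psi> x \<partial>half_line) - B * coef2 \<alpha> f g - A * coef1 \<alpha> f g"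
      using i by (simp add: c1 c2)
    finally have v: "(\<integral>x. v x * \<psi> x \<partial>half_line) = coef1 \<alpha> f g * A + coef2 \<alpha> f g * B"
      by (simp add: algebra_simps)
    have j: "integrable half_line (\<lambda>x. sol1 \<alpha> x * \<psi> x)" "integrable half_line (\<lambda>x. sol2 \<alpha> x * \<psi> x)"
      by (intro integrable_mult_test t locally_integrable_continuous smooth_on_imp_continuous_on smooth_sol1 smooth_sol2)+
    have "(\<integral>x. (v x - ?s x) * \<psi> x \<partial>half_line)
        = (\<integral>x. v x * \<psi> x - (coef1 \<alpha> f g * (sol1 \<alpha> x * \<psi> x) + coef2 \<alpha> f g * (sol2 \<alpha> x * \<psi> x)) \<partial>half_line)"
      by (simp only: left_diff_distrib distrib_right mult.assoc)
    also have "\<dots> = 0" using i(1) j by (simp add: v flip: A_def B_def)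
    finally show "(\<integral>x. (v x - ?s x) * \<psi> x \<partial>half_line) = 0" .
  qed
  then show ?thesis by eventually_elim (simp add: v_def algebra_simps)
qed

end

section \<open>The space \<open>H2_0\<close>\<close>

text \<open>For \<open>\<alpha> = 1/4\<close> the potential vanishes, so \<open>H2\<close> is the domain of \<open>L_max (1/4)\<close>.\<close>

lemma csqrt_quarter: "csqrt (1/4) = 1/2"
  using csqrt_square[of "1/2"] by (simp add: power2_eq_square)

lemma quarter_admissible: "\<bar>Re (csqrt (1/4))\<bar> < 1"
  by (simp add: csqrt_quarter)

lemma exp_half_ln_minus: "0 < x \<Longrightarrow> exp (- (complex_of_real (ln x) / 2)) = inverse (complex_of_real (sqrt x))"
  by (simp only: exp_minus exp_half_ln)

lemma sol1_quarter: "0 < x \<Longrightarrow> sol1 (1/4) x = (complex_of_real x + 1) / 2"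
proof -
  assume x: "0 < x"
  have "ch (1/4) (ln x) = (complex_of_real (sqrt x) + inverse (complex_of_real (sqrt x))) / 2"
    using exp_half_ln[OF x] exp_half_ln_minus[OF x] by (simp add: ch_def csqrt_quarter cosh_field_def)
  then have "sol1 (1/4) x = (complex_of_real (sqrt x) * complex_of_real (sqrt x) + 1) / 2"
    using x by (simp add: sol1_def field_simps)
  then show ?thesis using x by (simp flip: of_real_mult)
qed

lemma sol2_quarter: "0 < x \<Longrightarrow> sol2 (1/4) x = complex_of_real x - 1"
proof -
  assume x: "0 < x"
  have "sh (1/4) (ln x) = complex_of_real (sqrt x) - inverse (complex_of_real (sqrt x))"
    using exp_half_ln[OF x] exp_half_ln_minus[OF x] by (simp add: sh_def csqrt_quarter sinh_field_def)
  then have "sol2 (1/4) x = complex_of_real (sqrt x) * complex_of_real (sqrt x) - 1"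
    using x by (simp add: sol2_def field_simps)
  then show ?thesis using x by (simp flip: of_real_mult)
qed

lemma green_kernel_quarter: "0 < x \<Longrightarrow> 0 < y \<Longrightarrow> green_kernel (1/4) x y = complex_of_real (y - x)"
  by (simp add: green_kernel_def sol1_quarter sol2_quarter field_simps)

lemma AE_half_line_ex:
  assumes "AE x in half_line. P x" "0 < d"
  obtains x where "0 < x" "x < d" "P x"
proof -
  have "\<exists>x. 0 < x \<and> x < d \<and> P x"
  proof (rule ccontr)
    assume "\<not> ?thesis"
    then have "AE x in lebesgue. x \<notin> {0<..<d}"
      using assms(1) unfolding AE_half_line_iff by (auto elim!: eventually_mono)
    then have "{0<..<d} \<in> null_sets lebesgue" by (subst AE_iff_null_sets) auto
    then have "emeasure lborel {0<..<d} = 0" by (auto simp: null_sets_def)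
    then show False using assms(2) by (simp add: emeasure_lborel_Ioo)
  qed
  then show thesis using that by blast
qed

text \<open>An affine function that is o(x) at zero vanishes: the limit gives \<open>a = 0\<close>,
  division by x gives \<open>b = 0\<close>. The bound holds only almost everywhere, which still
  provides points arbitrarily close to zero.\<close>

lemma linear_near_zero:
  fixes a b :: complex
  assumes ae: "AE x in half_line. x < \<delta> \<longrightarrow> norm (a + b * complex_of_real x) \<le> r x" and \<delta>: "0 < \<delta>"
    and r: "\<And>e. 0 < e \<Longrightarrow> \<exists>d>0. \<forall>x. 0 < x \<longrightarrow> x < d \<longrightarrow> r x \<le> e * x"
  shows "a = 0 \<and> b = 0"
proof -
  have ex: "\<exists>x. 0 < x \<and> x < e \<and> norm (a + b * complex_of_real x) \<le> e * x" if e: "0 < e" for e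
  proof -
    obtain d where d: "0 < d" "\<forall>x. 0 < x \<longrightarrow> x < d \<longrightarrow> r x \<le> e * x" using r[OF e] by blast
    obtain x where "0 < x" "x < min d (min e \<delta>)" "x < \<delta> \<longrightarrow> norm (a + b * complex_of_real x) \<le> r x"
      by (rule AE_half_line_ex[OF ae, of "min d (min e \<delta>)"]) (use d e \<delta> in auto)
    then show ?thesis using d(2) by (intro exI[of _ x]) (auto intro: order_trans)
  qed
  have "norm a \<le> 0 + e" if e: "0 < e" for e
  proof -
    \<comment> \<open>The bound 1 allows \<open>e' * x \<le> x\<close>, and the second bound makes
      \<open>(norm b + 1) * x\<close> at most \<open>e\<close>.\<close>
    define e' where "e' = min 1 (e / (norm b + 1))"
    have e': "0 < e'" "e' \<le> 1" "e' \<le> e / (norm b + 1)" using e by (auto simp: e'_def add_nonneg_pos)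
    obtain x where x: "0 < x" "x < e'" "norm (a + b * complex_of_real x) \<le> e' * x" using ex[OF e'(1)] by blast
    have "norm a \<le> norm (a + b * complex_of_real x) + norm (b * complex_of_real x)"
      using norm_triangle_ineq4[of "a + b * complex_of_real x" "b * complex_of_real x"] by simp
    also have "\<dots> \<le> 1 * x + norm b * x"
      using x e' by (intro add_mono order_trans[OF x(3)] mult_right_mono) (auto simp: norm_mult)
    also have "\<dots> = (norm b + 1) * x" by (simp add: algebra_simps)
    also have "\<dots> \<le> (norm b + 1) * (e / (norm b + 1))" using x e' by (intro mult_left_mono) auto
    also have "\<dots> = e" using norm_ge_zero[of b] by (simp add: add_nonneg_eq_0_iff)
    finally show ?thesis by simp
  qed
  then have "norm a \<le> 0" by (rule field_le_epsilon)
  then have a: "a = 0" by simp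
  have "norm b \<le> 0 + e" if e: "0 < e" for e
  proof -
    obtain x where x: "0 < x" "norm (a + b * complex_of_real x) \<le> e * x" using ex[OF e] by blast
    then have "norm b * x \<le> e * x" using a by (simp add: norm_mult)
    then show ?thesis using x(1) by simp
  qed
  then have "norm b \<le> 0" by (rule field_le_epsilon)
  then show ?thesis using a by simp
qed

text \<open>The common tool for showing that coefficients vanish or agree. For \<alpha> = 1/4 the
  solutions are (x+1)/2 and x-1, so the combination is affine.\<close>

lemma solutions_near_zero:
  assumes ae: "AE x in half_line. x < \<delta> \<longrightarrow> norm (A * sol1 (1/4) x + B * sol2 (1/4) x) \<le> r x" and \<delta>: "0 < \<delta>"
    and r: "\<And>e. 0 < e \<Longrightarrow> \<exists>d>0. \<forall>x. 0 < x \<longrightarrow> x < d \<longrightarrow> r x \<le> e * x"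
  shows "A = 0 \<and> B = 0"
proof -
  have "(A / 2 - B) = 0 \<and> (A / 2 + B) = 0"
  proof (rule linear_near_zero[OF _ \<delta> r])
    have "AE x in half_line. 0 < x" by (rule AE_I2) simp
    with ae show "AE x in half_line. x < \<delta> \<longrightarrow> norm ((A / 2 - B) + (A / 2 + B) * complex_of_real x) \<le> r x"
    proof eventually_elim
      case (elim x)
      have "A * sol1 (1/4) x + B * sol2 (1/4) x = (A / 2 - B) + (A / 2 + B) * complex_of_real x"
        using elim(2) by (simp add: sol1_quarter sol2_quarter field_simps)
      then show ?case using elim(1) by simp
    qed
  qed
  moreover have "A = (A / 2 - B) + (A / 2 + B)" "2 * B = (A / 2 + B) - (A / 2 - B)" by simp_all
  ultimately show ?thesis by (metis add_0 diff_0_right mult_eq_0_iff zero_neq_numeral)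
qed

lemma powr_three_halves_small:
  fixes K e :: real
  assumes "0 \<le> K" "0 < e"
  shows "\<exists>d>0. \<forall>x. 0 < x \<longrightarrow> x < d \<longrightarrow> K * x powr (3/2) \<le> e * x"
proof (intro exI conjI allI impI)
  let ?d = "(e / (K + 1))\<^sup>2"
  have q: "0 < e / (K + 1)" using assms by (intro divide_pos_pos) auto
  then show "0 < ?d" by (rule zero_less_power)
  fix x :: real assume x: "0 < x" "x < ?d"
  have "x powr (3/2) = x powr 1 * x powr (1/2)" using powr_add[of x 1 "1/2"] by simp
  then have p: "x powr (3/2) = sqrt x * x" using x by (simp add: powr_half_sqrt)
  have "sqrt x \<le> sqrt ?d" using x by (intro real_sqrt_le_mono) simp
  then have "sqrt x \<le> e / (K + 1)" using q by (simp only: real_sqrt_abs abs_of_pos)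
  then have "K * sqrt x \<le> K * (e / (K + 1))" using assms by (intro mult_left_mono) auto
  also have "\<dots> \<le> e" using assms by (simp add: field_simps)
  finally have "K * sqrt x * x \<le> e * x" using x by (intro mult_right_mono) auto
  then show "K * x powr (3/2) \<le> e * x" by (simp add: p mult.assoc)
qed

lemma distribution_of_scale:
  assumes "\<phi> \<in> borel_measurable half_line"
  shows "distribution_of (c *\<^sub>C f) \<phi> = c * distribution_of f \<phi>"
proof -
  have "distribution_of (c *\<^sub>C f) \<phi> = (\<integral>x. c * rep_L2 f x * \<phi> x \<partial>half_line)"
    by (rule distribution_of_cong[OF AE_rep_scale _ assms]) (intro borel_measurable_times borel_measurable_const rep_L2_measurable)
  then show ?thesis by (simp add: distribution_of_def mult.assoc)
qed

text \<open>The operator is minus the second derivative, so the image changes sign; as g runs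
  through the whole space, so does -g.\<close>

lemma H2_iff: "f \<in> H2 \<longleftrightarrow> (\<exists>g. (f, g) \<in> L_max (1/4))"
proof -
  have D: "distribution_deriv (distribution_deriv (distribution_of f)) \<phi> = - distribution_of f (bessel (1/4) \<phi>)" for f \<phi>
    by (simp add: distribution_deriv_def distribution_of_def bessel_def)
  have neg: "- distribution_of f (bessel (1/4) \<phi>) = distribution_of g \<phi> \<longleftrightarrow>
      distribution_of f (bessel (1/4) \<phi>) = distribution_of ((-1) *\<^sub>C g) \<phi>"
    if "\<phi> \<in> test_functions" for g \<phi>
    unfolding distribution_of_scale[OF test_measurable[OF that]] by (auto simp: minus_equation_iff)
  have "distribution_eq (distribution_deriv (distribution_deriv (distribution_of f))) (distribution_of g)
      \<longleftrightarrow> (f, (-1) *\<^sub>C g) \<in> L_max (1/4)" for g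
    unfolding distribution_eq_def L_max_iff D by (rule ball_cong[OF refl neg])
  moreover have "(-1) *\<^sub>C (-1) *\<^sub>C g = g" for g :: L2
    using scaleC_of_real[of 1 g] by (simp add: scaleC_scaleC)
  then have "(\<exists>g. (f, (-1) *\<^sub>C g) \<in> L_max (1/4)) \<longleftrightarrow> (\<exists>g. (f, g) \<in> L_max (1/4))"
    by metis
  ultimately show ?thesis unfolding H2_def by simp
qed

lemma integrable_cut:
  assumes g: "square_integrable g"
  shows "integrable half_line (\<lambda>y. if y < t then g y else 0)"
proof (rule Bochner_Integration.integrable_bound)
  have [measurable]: "g \<in> borel_measurable half_line" using g by (simp add: square_integrable_def)
  have "integrable half_line (\<lambda>y. if y < t then 1 else 0 :: real)"
  proof (rule integrableI_bounded)
    have "(\<integral>\<^sup>+y. ennreal (norm (if y < t then 1 else 0 :: real)) \<partial>half_line)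
        \<le> (\<integral>\<^sup>+y. indicator {0..max 0 t} y \<partial>lborel)"
      unfolding nn_integral_half_line by (rule nn_integral_mono) (auto simp: indicator_def)
    also have "\<dots> < \<infinity>" by simp
    finally show "(\<integral>\<^sup>+y. ennreal (norm (if y < t then 1 else 0 :: real)) \<partial>half_line) < \<infinity>" .
  qed measurable
  then show "integrable half_line (\<lambda>y. (if y < t then 1 else 0) + (cmod (g y))\<^sup>2)"
    using g by (intro Bochner_Integration.integrable_add) (auto simp: square_integrable_def)
  show "(\<lambda>y. if y < t then g y else 0) \<in> borel_measurable half_line" by measurable
  have "u \<le> 1 + u\<^sup>2" for u :: real
    using zero_le_power2[of "u - 1/2"] by (simp add: power2_eq_square algebra_simps)
  then show "AE y in half_line. norm (if y < t then g y else 0) \<le> norm ((if y < t then 1 else 0) + (cmod (g y))\<^sup>2)"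
    by auto
qed

text \<open>Cauchy-Schwarz against the indicator of the window. It provides the modulus of
  continuity t^(1/2) for the derivative of the variation of constants integral.\<close>

lemma integral_window_le:
  assumes g: "square_integrable g" and st: "0 \<le> s" "s \<le> t"
  shows "(\<integral>y. (if s \<le> y \<and> y < t then norm (g y) else 0) \<partial>half_line) \<le> sqrt (t - s) * norm (abs_L2 g)"
    and "integrable half_line (\<lambda>y. if s \<le> y \<and> y < t then norm (g y) else 0)"
proof -
  have [measurable]: "g \<in> borel_measurable half_line" using g by (simp add: square_integrable_def)
  let ?w = "\<lambda>y. if s \<le> y \<and> y < t then norm (g y) else 0"
  have "integrable half_line (\<lambda>y. norm (if y < t then g y else 0))"
    by (rule integrable_norm[OF integrable_cut[OF g]])
  then show i: "integrable half_line ?w"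
    by (rule Bochner_Integration.integrable_bound) auto
  let ?i = "\<lambda>y. if s \<le> y \<and> y < t then 1 else 0 :: ennreal"
  have "(\<integral>\<^sup>+y. ?i y * ennreal (norm (g y)) \<partial>half_line)\<^sup>2
      \<le> (\<integral>\<^sup>+y. (?i y)\<^sup>2 \<partial>half_line) * (\<integral>\<^sup>+y. (ennreal (norm (g y)))\<^sup>2 \<partial>half_line)"
    by (rule Cauchy_Schwarz_nn_integral) measurable
  also have "(\<integral>\<^sup>+y. (ennreal (norm (g y)))\<^sup>2 \<partial>half_line) = ennreal ((norm (abs_L2 g))\<^sup>2)"
    by (simp add: ennreal_power nn_integral_L2[OF g])
  also have "(\<integral>\<^sup>+y. (?i y)\<^sup>2 \<partial>half_line) \<le> (\<integral>\<^sup>+y. indicator {s..t} y \<partial>lborel)"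
    unfolding nn_integral_half_line by (rule nn_integral_mono) (auto simp: indicator_def)
  also have "\<dots> = ennreal (t - s)" using st by simp
  also have "ennreal (t - s) * ennreal ((norm (abs_L2 g))\<^sup>2) = ennreal ((sqrt (t - s) * norm (abs_L2 g))\<^sup>2)"
    using st by (simp add: power_mult_distrib ennreal_mult)
  finally have "(\<integral>\<^sup>+y. ?i y * ennreal (norm (g y)) \<partial>half_line)\<^sup>2 \<le> ennreal ((sqrt (t - s) * norm (abs_L2 g))\<^sup>2)"
    by (simp add: mult_right_mono)
  then have "(\<integral>\<^sup>+y. ?i y * ennreal (norm (g y)) \<partial>half_line) \<le> ennreal (sqrt (t - s) * norm (abs_L2 g))"
    by (rule ennreal_square_le) (use st in simp)
  moreover have "(\<integral>\<^sup>+y. ?i y * ennreal (norm (g y)) \<partial>half_line) = (\<integral>\<^sup>+y. ennreal (?w y) \<partial>half_line)"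
    by (rule nn_integral_cong) simp
  moreover have "(\<integral>\<^sup>+y. ennreal (?w y) \<partial>half_line) = ennreal (\<integral>y. ?w y \<partial>half_line)"
    by (rule nn_integral_eq_integral[OF i]) simp
  ultimately have "ennreal (\<integral>y. ?w y \<partial>half_line) \<le> ennreal (sqrt (t - s) * norm (abs_L2 g))" by simp
  then show "(\<integral>y. ?w y \<partial>half_line) \<le> sqrt (t - s) * norm (abs_L2 g)"
    by (rule ennreal_le_iff[THEN iffD1, rotated]) (use st in simp)
qed

lemma green_quarter:
  "0 \<le> x \<Longrightarrow> 0 < y \<Longrightarrow> green (1/4) g x y = (if y < x then complex_of_real (y - x) * g y else 0)"
  by (simp add: green_def green_kernel_quarter)

text \<open>The kernel is y - x, so the integrand of the first-order Taylor remainder cancels except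
  for y between s and t, where it is at most |t - s| |g(y)|. Both orders of s and t, and s = 0, are
  covered, as the one-sided derivative at zero needs.\<close>

lemma green_op_quarter_increment:
  assumes g: "square_integrable g" and st: "0 \<le> s" "0 \<le> t"
  shows "norm (green_op (1/4) g t - green_op (1/4) g s
      - complex_of_real (t - s) * (- (\<integral>y. (if y < s then g y else 0) \<partial>half_line)))
    \<le> \<bar>t - s\<bar> * (sqrt \<bar>t - s\<bar> * norm (abs_L2 g))"
proof -
  define W where "W y = (if min s t \<le> y \<and> y < max s t then norm (g y) else 0)" for y
  have "0 \<le> min s t" "min s t \<le> max s t" using st by auto
  note W = integral_window_le(2)[OF g this, folded W_def] integral_window_le(1)[OF g this, folded W_def]
  have ig: "integrable half_line (green (1/4) g x)" if "0 \<le> x" for x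
  proof (cases "x = 0")
    case True
    have "integrable half_line (\<lambda>y. 0 :: complex)" by simp
    then show ?thesis
      by (rule Bochner_Integration.integrable_cong[THEN iffD1, rotated -1]) (use True in \<open>auto simp: green_def\<close>)
  next
    case False
    then show ?thesis using that by (intro integrable_green[OF quarter_admissible g]) auto
  qed
  let ?d = "\<lambda>y. green (1/4) g t y - green (1/4) g s y + complex_of_real (t - s) * (if y < s then g y else 0)"
  have id: "integrable half_line ?d"
    by (intro Bochner_Integration.integrable_add Bochner_Integration.integrable_diff ig st integrable_mult_right integrable_cut g)
  have eq: "green_op (1/4) g t - green_op (1/4) g s
      - complex_of_real (t - s) * (- (\<integral>y. (if y < s then g y else 0) \<partial>half_line)) = (\<integral>y. ?d y \<partial>half_line)"
    using ig[OF st(1)] ig[OF st(2)] integrable_cut[OF g, of s] by (simp add: green_op_def)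
  have "norm (\<integral>y. ?d y \<partial>half_line) \<le> (\<integral>y. norm (?d y) \<partial>half_line)" by (rule integral_norm_bound)
  also have "\<dots> \<le> (\<integral>y. \<bar>t - s\<bar> * W y \<partial>half_line)"
  proof (rule integral_mono)
    show "integrable half_line (\<lambda>y. norm (?d y))" by (rule integrable_norm[OF id])
    show "integrable half_line (\<lambda>y. \<bar>t - s\<bar> * W y)" by (rule integrable_mult_right[OF W(1)])
    fix y assume "y \<in> space half_line"
    then have y: "0 < y" by simp
    show "norm (?d y) \<le> \<bar>t - s\<bar> * W y"
    proof (cases "min s t \<le> y \<and> y < max s t")
      case True
      then have "norm (?d y) = \<bar>t - y\<bar> * norm (g y)"
        unfolding green_quarter[OF st(1) y] green_quarter[OF st(2) y]
        by (cases "s \<le> t") (auto simp: norm_mult abs_minus_commute simp flip: of_real_diff left_diff_distrib distrib_right)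
      also have "\<dots> \<le> \<bar>t - s\<bar> * norm (g y)" using True by (intro mult_right_mono) auto
      finally show ?thesis using True by (simp add: W_def)
    next
      case False
      then have "?d y = 0"
        unfolding green_quarter[OF st(1) y] green_quarter[OF st(2) y] by (auto simp: algebra_simps)
      then show ?thesis by (simp add: W_def)
    qed
  qed
  also have "\<dots> = \<bar>t - s\<bar> * (\<integral>y. W y \<partial>half_line)" by (rule integral_mult_right_zero)
  also have "\<dots> \<le> \<bar>t - s\<bar> * (sqrt (max s t - min s t) * norm (abs_L2 g))"
    by (rule mult_left_mono[OF W(2)]) simp
  also have "max s t - min s t = \<bar>t - s\<bar>" by auto
  finally show ?thesis unfolding eq .
qed

lemma sqrt_small:
  assumes "0 \<le> N" "0 < e"
  obtains d where "0 < d" "\<And>u. 0 \<le> u \<Longrightarrow> u < d \<Longrightarrow> sqrt u * N \<le> e"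
proof
  let ?d = "(e / (N + 1))\<^sup>2"
  have q: "0 < e / (N + 1)" using assms by (intro divide_pos_pos) auto
  then show "0 < ?d" by (rule zero_less_power)
  fix u assume u: "0 \<le> u" "u < ?d"
  then have "sqrt u \<le> sqrt ?d" by (intro real_sqrt_le_mono) simp
  then have "sqrt u \<le> e / (N + 1)" using q by (simp only: real_sqrt_abs abs_of_pos)
  then have "sqrt u * N \<le> e / (N + 1) * N" using assms by (intro mult_right_mono) auto
  also have "\<dots> \<le> e" using assms by (simp add: field_simps)
  finally show "sqrt u * N \<le> e" .
qed

text \<open>The increment estimate is of order |t - s|^(3/2), which gives the derivative, namely
  minus the integral of g up to s; its continuity follows from the window estimate.\<close>

lemma green_op_quarter_C1:
  assumes g: "square_integrable g"
  defines "F' \<equiv> \<lambda>s. - (\<integral>y. (if y < s then g y else 0) \<partial>half_line)"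
  shows "\<And>x. 0 \<le> x \<Longrightarrow> (green_op (1/4) g has_vector_derivative F' x) (at x within {0..})"
    and "continuous_on {0..} F'" and "green_op (1/4) g 0 = 0" and "F' 0 = 0"
proof -
  let ?N = "norm (abs_L2 g)"
  show "(green_op (1/4) g has_vector_derivative F' x) (at x within {0..})" if x: "0 \<le> x" for x
    unfolding has_vector_derivative_def has_derivative_within_alt
  proof (intro conjI allI impI)
    show "bounded_linear (\<lambda>h. h *\<^sub>R F' x)" by (rule bounded_linear_scaleR_left)
    fix e :: real assume e: "0 < e"
    obtain d where d: "0 < d" "\<And>u. 0 \<le> u \<Longrightarrow> u < d \<Longrightarrow> sqrt u * ?N \<le> e"
      by (rule sqrt_small[OF norm_ge_zero e]) (rule that)
    show "\<exists>d>0. \<forall>y\<in>{0..}. norm (y - x) < d \<longrightarrow>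
        norm (green_op (1/4) g y - green_op (1/4) g x - (y - x) *\<^sub>R F' x) \<le> e * norm (y - x)"
    proof (intro exI[of _ d] conjI ballI impI d(1))
      fix y :: real assume y: "y \<in> {0..}" "norm (y - x) < d"
      have "norm (green_op (1/4) g y - green_op (1/4) g x - (y - x) *\<^sub>R F' x) \<le> \<bar>y - x\<bar> * (sqrt \<bar>y - x\<bar> * ?N)"
        unfolding F'_def scaleR_conv_of_real by (rule green_op_quarter_increment[OF g x]) (use y in simp)
      also have "\<dots> \<le> \<bar>y - x\<bar> * e" by (rule mult_left_mono[OF d(2)]) (use y in auto)
      finally show "norm (green_op (1/4) g y - green_op (1/4) g x - (y - x) *\<^sub>R F' x) \<le> e * norm (y - x)"
        by (simp add: mult.commute)
    qed
  qed
  have F'_diff: "norm (F' t - F' s) \<le> sqrt \<bar>t - s\<bar> * ?N" if st: "0 \<le> s" "0 \<le> t" for s t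
  proof -
    let ?d = "\<lambda>y. (if y < s then g y else 0) - (if y < t then g y else 0)"
    have "F' t - F' s = (\<integral>y. ?d y \<partial>half_line)"
      using integrable_cut[OF g, of s] integrable_cut[OF g, of t] by (simp add: F'_def)
    also have "norm \<dots> \<le> (\<integral>y. norm (?d y) \<partial>half_line)" by (rule integral_norm_bound)
    also have "\<dots> = (\<integral>y. (if min s t \<le> y \<and> y < max s t then norm (g y) else 0) \<partial>half_line)"
      by (rule Bochner_Integration.integral_cong) auto
    also have "\<dots> \<le> sqrt (max s t - min s t) * ?N" by (rule integral_window_le[OF g]) (use st in auto)
    also have "max s t - min s t = \<bar>t - s\<bar>" by auto
    finally show ?thesis .
  qed
  show "continuous_on {0..} F'"
    unfolding continuous_on_iff
  proof (intro ballI allI impI)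
    fix s e :: real assume s: "s \<in> {0..}" and e: "0 < e"
    obtain d where d: "0 < d" "\<And>u. 0 \<le> u \<Longrightarrow> u < d \<Longrightarrow> sqrt u * ?N \<le> e / 2"
      by (rule sqrt_small[OF norm_ge_zero half_gt_zero[OF e]]) (rule that)
    show "\<exists>d>0. \<forall>t\<in>{0..}. dist t s < d \<longrightarrow> dist (F' t) (F' s) < e"
    proof (intro exI[of _ d] conjI ballI impI d(1))
      fix t :: real assume t: "t \<in> {0..}" "dist t s < d"
      have "dist (F' t) (F' s) \<le> sqrt \<bar>t - s\<bar> * ?N" unfolding dist_norm by (rule F'_diff) (use s t in auto)
      also have "\<dots> \<le> e / 2" by (rule d(2)) (use t in \<open>auto simp: dist_real_def\<close>)
      also have "\<dots> < e" using e by simp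
      finally show "dist (F' t) (F' s) < e" .
    qed
  qed
  have "green_op (1/4) g 0 = (\<integral>y. 0 \<partial>half_line)"
    unfolding green_op_def by (rule Bochner_Integration.integral_cong) (auto simp: green_def)
  then show "green_op (1/4) g 0 = 0" by simp
  have "F' 0 = - (\<integral>y. 0 \<partial>half_line)"
    unfolding F'_def by (intro arg_cong[where f = uminus] Bochner_Integration.integral_cong) auto
  then show "F' 0 = 0" by simp
qed

text \<open>In the representation of f for \<alpha> = 1/4, the boundary values make f = o(x) and the
  integral is O(x^(3/2)), so the two solutions cannot contribute. Conversely the integral is the
  required continuously differentiable representative.\<close>

lemma (in cutoff) H2_0_iff:
  "f \<in> H2_0 \<longleftrightarrow> (\<exists>g. (f, g) \<in> L_max (1/4) \<and> (AE x in half_line. rep_L2 f x = green_op (1/4) (rep_L2 g) x))"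
proof
  assume "f \<in> H2_0"
  then obtain F F' where f: "f \<in> H2" and F: "AE x in half_line. rep_L2 f x = F x"
    "\<And>x. 0 \<le> x \<Longrightarrow> (F has_vector_derivative F' x) (at x within {0..})" "F 0 = 0" "F' 0 = 0"
    unfolding H2_0_def by blast
  obtain g where g: "(f, g) \<in> L_max (1/4)" using f H2_iff by blast
  obtain C where C: "0 < C" "\<And>g x. square_integrable g \<Longrightarrow> 0 < x \<Longrightarrow> norm (green_op (1/4) g x) \<le> C * x powr (3/2) * norm (abs_L2 g)"
    by (rule green_op_bound[OF quarter_admissible]) (rule that)
  define A where "A = coef1 (1/4) f g"
  define B where "B = coef2 (1/4) f g"
  have rep: "AE x in half_line. rep_L2 f x = green_op (1/4) (rep_L2 g) x + A * sol1 (1/4) x + B * sol2 (1/4) x"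
    unfolding A_def B_def by (rule representation[OF quarter_admissible g])
  have "A = 0 \<and> B = 0"
  proof (rule solutions_near_zero[where \<delta> = 1 and r = "\<lambda>x. norm (F x) + (C * norm g) * x powr (3/2)"])
    have "AE x in half_line. 0 < x" by (rule AE_I2) simp
    with rep F(1) show "AE x in half_line. x < 1 \<longrightarrow> norm (A * sol1 (1/4) x + B * sol2 (1/4) x)
      \<le> norm (F x) + (C * norm g) * x powr (3/2)"
    proof eventually_elim
      case (elim x)
      have "A * sol1 (1/4) x + B * sol2 (1/4) x = F x - green_op (1/4) (rep_L2 g) x"
        using elim by (simp add: algebra_simps)
      also have "norm \<dots> \<le> norm (F x) + norm (green_op (1/4) (rep_L2 g) x)" by (rule norm_triangle_ineq4)
      also have "norm (green_op (1/4) (rep_L2 g) x) \<le> C * x powr (3/2) * norm (abs_L2 (rep_L2 g))"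
        by (rule C(2)[OF square_integrable_rep elim(3)])
      finally show ?case by (simp add: abs_rep_L2 mult_ac)
    qed
    fix e :: real assume e: "0 < e"
    obtain d1 where d1: "0 < d1" "\<forall>x. 0 < x \<longrightarrow> x < d1 \<longrightarrow> (C * norm g) * x powr (3/2) \<le> e / 2 * x"
      using powr_three_halves_small[of "C * norm g" "e / 2"] C(1) e by auto
    have "\<exists>d>0. \<forall>y\<in>{0..}. norm (y - 0) < d \<longrightarrow> norm (F y - F 0 - (y - 0) *\<^sub>R F' 0) \<le> e / 2 * norm (y - 0)"
      using F(2)[of 0, unfolded has_vector_derivative_def has_derivative_within_alt, THEN conjunct2, rule_format, of "e / 2"] e
      by simp
    then obtain d2 where d2: "0 < d2" "\<forall>y\<in>{0..}. \<bar>y\<bar> < d2 \<longrightarrow> norm (F y) \<le> e / 2 * \<bar>y\<bar>"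
      using F(3,4) by auto
    show "\<exists>d>0. \<forall>x. 0 < x \<longrightarrow> x < d \<longrightarrow> norm (F x) + (C * norm g) * x powr (3/2) \<le> e * x"
    proof (intro exI[of _ "min d1 d2"] conjI allI impI)
      fix x assume x: "0 < x" "x < min d1 d2"
      have "norm (F x) \<le> e / 2 * x" using d2(2)[rule_format, of x] x by simp
      moreover have "(C * norm g) * x powr (3/2) \<le> e / 2 * x" using d1(2) x by simp
      ultimately show "norm (F x) + (C * norm g) * x powr (3/2) \<le> e * x" by simp
    qed (use d1 d2 in simp)
  qed simp
  then show "\<exists>g. (f, g) \<in> L_max (1/4) \<and> (AE x in half_line. rep_L2 f x = green_op (1/4) (rep_L2 g) x)"
    using g rep by (intro exI[of _ g]) simp
next
  assume "\<exists>g. (f, g) \<in> L_max (1/4) \<and> (AE x in half_line. rep_L2 f x = green_op (1/4) (rep_L2 g) x)"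
  then obtain g where g: "(f, g) \<in> L_max (1/4)" "AE x in half_line. rep_L2 f x = green_op (1/4) (rep_L2 g) x" by blast
  have "f \<in> H2" using g(1) H2_iff by blast
  then show "f \<in> H2_0"
    unfolding H2_0_def
    by (intro CollectI conjI exI[of _ "green_op (1/4) (rep_L2 g)"] g(2)
        exI[of _ "\<lambda>s. - (\<integral>y. (if y < s then rep_L2 g y else 0) \<partial>half_line)"]
        allI impI green_op_quarter_C1[OF square_integrable_rep])
qed

section \<open>The maximal domain\<close>

lemma distribution_of_add:
  assumes t: "\<phi> \<in> test_functions"
  shows "distribution_of (f + g) \<phi> = distribution_of f \<phi> + distribution_of g \<phi>"
proof -
  note i = integrable_mult_test[OF square_integrable_imp_locally_integrable[OF square_integrable_rep] t]
  have "distribution_of (f + g) \<phi> = (\<integral>x. (rep_L2 f x + rep_L2 g x) * \<phi> x \<partial>half_line)"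
    by (rule distribution_of_cong[OF AE_rep_add _ test_measurable[OF t]])
      (intro borel_measurable_add rep_L2_measurable)
  also have "\<dots> = (\<integral>x. rep_L2 f x * \<phi> x + rep_L2 g x * \<phi> x \<partial>half_line)" by (simp only: distrib_right)
  also have "\<dots> = distribution_of f \<phi> + distribution_of g \<phi>"
    unfolding distribution_of_def by (rule Bochner_Integration.integral_add[OF i i])
  finally show ?thesis .
qed

lemma L_max_add:
  assumes "(f, g) \<in> L_max \<alpha>" "(f', g') \<in> L_max \<alpha>"
  shows "(f + f', g + g') \<in> L_max \<alpha>"
  unfolding L_max_iff
proof
  fix \<phi> assume t: "\<phi> \<in> test_functions"
  show "distribution_of (f + f') (bessel \<alpha> \<phi>) = distribution_of (g + g') \<phi>"
    using assms t unfolding L_max_iff distribution_of_add[OF t] distribution_of_add[OF bessel_test[OF t]] by simp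
qed

lemma L_max_scale:
  assumes "(f, g) \<in> L_max \<alpha>"
  shows "(c *\<^sub>C f, c *\<^sub>C g) \<in> L_max \<alpha>"
  unfolding L_max_iff
proof
  fix \<phi> assume t: "\<phi> \<in> test_functions"
  show "distribution_of (c *\<^sub>C f) (bessel \<alpha> \<phi>) = distribution_of (c *\<^sub>C g) \<phi>"
    using assms t unfolding L_max_iff distribution_of_scale[OF test_measurable[OF t]]
      distribution_of_scale[OF test_measurable[OF bessel_test[OF t]]] by simp
qed

lemma scaleC_minus_one: "(-1) *\<^sub>C (u :: 'a::complex_banach) = - u"
  using scaleC_of_real[of "-1" u] by simp

lemma scaleC_uminus: "(- c) *\<^sub>C (u :: 'a::complex_banach) = - (c *\<^sub>C u)"
  using scaleC_scaleC[of "-1" c u] by (simp add: scaleC_minus_one)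

lemma L_max_diff:
  assumes "(f, g) \<in> L_max \<alpha>" "(f', g') \<in> L_max \<alpha>"
  shows "(f - f', g - g') \<in> L_max \<alpha>"
  using L_max_add[OF assms(1) L_max_scale[OF assms(2), of "-1"]] by (simp add: scaleC_minus_one)

lemma square_integrable_test:
  assumes t: "\<phi> \<in> test_functions"
  shows "square_integrable \<phi>"
  unfolding square_integrable_def
proof
  obtain a b where ab: "0 < a" "\<And>x. 0 < x \<Longrightarrow> x \<notin> {a..b} \<Longrightarrow> \<phi> x = 0" "smooth_on {0<..} \<phi>"
    using test_functionsE[OF t] by metis
  have "integrable half_line (\<lambda>x. complex_of_real ((cmod (\<phi> x))\<^sup>2))"
  proof (rule locally_integrable_imp_integrable[OF locally_integrable_continuous ab(1)])
    show "continuous_on {0<..} (\<lambda>x. complex_of_real ((cmod (\<phi> x))\<^sup>2))"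
      by (intro continuous_intros smooth_on_imp_continuous_on[OF ab(3)])
    show "complex_of_real ((cmod (\<phi> x))\<^sup>2) = 0" if "0 < x" "x \<notin> {a..b}" for x
      unfolding ab(2)[OF that] by simp
  qed
  then show "integrable half_line (\<lambda>x. (cmod (\<phi> x))\<^sup>2)" by (simp only: complex_of_real_integrable_eq)
qed (rule test_measurable[OF t])

lemma norm_distribution_of_le:
  assumes t: "\<phi> \<in> test_functions"
  shows "norm (distribution_of f \<phi>) \<le> norm f * norm (abs_L2 \<phi>)"
proof -
  have [measurable]: "\<phi> \<in> borel_measurable half_line" by (rule test_measurable[OF t])
  have [measurable]: "rep_L2 f \<in> borel_measurable half_line" by (rule rep_L2_measurable)
  have i: "integrable half_line (\<lambda>x. rep_L2 f x * \<phi> x)"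
    by (rule integrable_mult_test[OF square_integrable_imp_locally_integrable[OF square_integrable_rep] t])
  have "(\<integral>\<^sup>+x. ennreal (norm (rep_L2 f x)) * ennreal (norm (\<phi> x)) \<partial>half_line)\<^sup>2
    \<le> (\<integral>\<^sup>+x. (ennreal (norm (rep_L2 f x)))\<^sup>2 \<partial>half_line) * (\<integral>\<^sup>+x. (ennreal (norm (\<phi> x)))\<^sup>2 \<partial>half_line)"
    by (rule Cauchy_Schwarz_nn_integral) measurable
  also have "\<dots> = ennreal ((norm f * norm (abs_L2 \<phi>))\<^sup>2)"
    by (simp add: ennreal_power nn_integral_L2[OF square_integrable_rep] nn_integral_L2[OF square_integrable_test[OF t]]
        abs_rep_L2 power_mult_distrib ennreal_mult)
  finally have "(\<integral>\<^sup>+x. ennreal (norm (rep_L2 f x)) * ennreal (norm (\<phi> x)) \<partial>half_line) \<le> ennreal (norm f * norm (abs_L2 \<phi>))"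
    by (rule ennreal_square_le) simp
  note le = this
  have "ennreal (norm (distribution_of f \<phi>)) \<le> (\<integral>\<^sup>+x. norm (rep_L2 f x * \<phi> x) \<partial>half_line)"
    unfolding distribution_of_def by (rule integral_norm_bound_ennreal[OF i])
  also have "\<dots> = (\<integral>\<^sup>+x. ennreal (norm (rep_L2 f x)) * ennreal (norm (\<phi> x)) \<partial>half_line)"
    by (rule nn_integral_cong) (simp add: norm_mult ennreal_mult)
  also note le
  finally have "ennreal (norm (distribution_of f \<phi>)) \<le> ennreal (norm f * norm (abs_L2 \<phi>))" .
  then show ?thesis by (rule ennreal_le_iff[THEN iffD1, rotated]) simp
qed

lemma continuous_distribution_of:
  assumes t: "\<phi> \<in> test_functions"
  shows "continuous_on UNIV (\<lambda>f. distribution_of f \<phi>)"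
proof (rule linear_continuous_on)
  show "bounded_linear (\<lambda>f. distribution_of f \<phi>)"
  proof (rule bounded_linear_intro)
    show "distribution_of (f + g) \<phi> = distribution_of f \<phi> + distribution_of g \<phi>" for f g
      by (rule distribution_of_add[OF t])
    show "distribution_of (r *\<^sub>R f) \<phi> = r *\<^sub>R distribution_of f \<phi>" for r f
      using distribution_of_scale[OF test_measurable[OF t], of "complex_of_real r" f]
      by (simp add: scaleC_of_real scaleR_conv_of_real)
    show "norm (distribution_of f \<phi>) \<le> norm f * norm (abs_L2 \<phi>)" for f
      by (rule norm_distribution_of_le[OF t])
  qed
qed

text \<open>For each test function the defining condition equates two continuous functionals; the
  graph is the intersection of these closed sets.\<close>

lemma closed_L_max: "closed (L_max \<alpha>)"
proof -
  have "closed {p. distribution_of (fst p) (bessel \<alpha> \<phi>) = distribution_of (snd p) \<phi>}"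
    if t: "\<phi> \<in> test_functions" for \<phi>
  proof (rule closed_Collect_eq)
    show "continuous_on UNIV (\<lambda>p. distribution_of (fst p) (bessel \<alpha> \<phi>))"
      by (rule continuous_on_compose2[OF continuous_distribution_of[OF bessel_test[OF t]]])
        (auto intro: continuous_on_fst continuous_on_id)
    show "continuous_on UNIV (\<lambda>p. distribution_of (snd p) \<phi>)"
      by (rule continuous_on_compose2[OF continuous_distribution_of[OF t]])
        (auto intro: continuous_on_snd continuous_on_id)
  qed
  then have "closed (\<Inter>\<phi>\<in>test_functions. {p. distribution_of (fst p) (bessel \<alpha> \<phi>) = distribution_of (snd p) \<phi>})"
    by (intro closed_INT ballI)
  moreover have "L_max \<alpha> = (\<Inter>\<phi>\<in>test_functions. {p. distribution_of (fst p) (bessel \<alpha> \<phi>) = distribution_of (snd p) \<phi>})"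
    by (rule set_eqI) (simp add: L_max_iff split_paired_all)
  ultimately show ?thesis by simp
qed

lemma (in cutoff) L_max_unique:
  assumes "(f, g) \<in> L_max \<alpha>" "(f, g') \<in> L_max \<alpha>"
  shows "g = g'"
proof (rule L2_eqI)
  note l = square_integrable_imp_locally_integrable[OF square_integrable_rep]
  have "AE x in half_line. rep_L2 g x - rep_L2 g' x = 0"
  proof (rule fundamental_lemma[OF locally_integrable_diff[OF l l]])
    fix \<phi> assume t: "\<phi> \<in> test_functions"
    have "(\<integral>x. (rep_L2 g x - rep_L2 g' x) * \<phi> x \<partial>half_line)
        = (\<integral>x. rep_L2 g x * \<phi> x - rep_L2 g' x * \<phi> x \<partial>half_line)" by (simp only: left_diff_distrib)
    also have "\<dots> = distribution_of g \<phi> - distribution_of g' \<phi>"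
      unfolding distribution_of_def
      by (rule Bochner_Integration.integral_diff[OF integrable_mult_test[OF l t] integrable_mult_test[OF l t]])
    also have "\<dots> = 0" using assms t unfolding L_max_iff by (metis right_minus_eq)
    finally show "(\<integral>x. (rep_L2 g x - rep_L2 g' x) * \<phi> x \<partial>half_line) = 0" .
  qed
  then show "AE x in half_line. rep_L2 g x = rep_L2 g' x" by eventually_elim simp
qed

lemma (in cutoff) closed_operator_L_max: "closed_operator (L_max \<alpha>)"
  unfolding closed_operator_def
proof (intro conjI allI impI)
  show "single_valued (L_max \<alpha>)" using L_max_unique by (auto intro: single_valuedI)
  show "(0, 0) \<in> L_max \<alpha>"
  proof -
    have "distribution_of 0 \<phi> = 0" if "\<phi> \<in> test_functions" for \<phi>
      using distribution_of_add[OF that, of 0 0] by simp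
    then show ?thesis by (simp add: L_max_iff bessel_test)
  qed
qed (auto intro: L_max_add L_max_scale closed_L_max)

lemma (in cutoff) op_apply_L_max: "(f, g) \<in> L_max \<alpha> \<Longrightarrow> op_apply (L_max \<alpha>) f = g"
  unfolding op_apply_def using L_max_unique by blast

text \<open>A square integrable majorant, up to a constant, of both cut off solutions for all
  \<alpha> with |Re m| \<le> r < \<rho> at once. This uniformity is what differentiation with
  respect to \<alpha> in the L2 norm requires.\<close>

definition envelope :: "real \<Rightarrow> real \<Rightarrow> real \<Rightarrow> real" where
  "envelope R \<rho> x = (if x < R then sqrt x * exp (\<rho> * \<bar>ln x\<bar>) else 0)"

text \<open>The exponential is at most the sum of x^(2\<rho>) and x^(-2\<rho>), whichever sign ln x
  has; the critical power x^(1-2\<rho>) is integrable at zero because \<rho> < 1.\<close>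

lemma envelope_square_integrable:
  assumes \<rho>: "0 \<le> \<rho>" "\<rho> < 1" and R: "0 < R"
  shows "integrable half_line (\<lambda>x. (envelope R \<rho> x)\<^sup>2)"
proof (rule integrableI_bounded)
  have "(\<lambda>x. sqrt x * exp (\<rho> * \<bar>ln x\<bar>)) \<in> borel_measurable half_line"
    by (rule continuous_on_half_line_measurable) (intro continuous_intros, auto)
  then show [measurable]: "(\<lambda>x. (envelope R \<rho> x)\<^sup>2) \<in> borel_measurable half_line"
    unfolding envelope_def by measurable
  have "(\<integral>\<^sup>+x. ennreal (norm ((envelope R \<rho> x)\<^sup>2)) \<partial>half_line)
    \<le> (\<integral>\<^sup>+x. (if x < R then ennreal (x powr (1 + 2 * \<rho>)) else 0) + (if x < R then ennreal (x powr (1 - 2 * \<rho>)) else 0) \<partial>half_line)"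
  proof (rule nn_integral_mono)
    fix x assume "x \<in> space half_line"
    then have x: "0 < x" by simp
    have "(sqrt x * exp (\<rho> * \<bar>ln x\<bar>))\<^sup>2 = x * exp (2 * \<rho> * \<bar>ln x\<bar>)"
      using x by (simp add: power_mult_distrib mult.assoc flip: exp_double)
    also have "exp (2 * \<rho> * \<bar>ln x\<bar>) \<le> x powr (2 * \<rho>) + x powr (- (2 * \<rho>))"
      using x by (cases "0 \<le> ln x") (simp_all add: powr_def add_increasing add_increasing2)
    also have "x * (x powr (2 * \<rho>) + x powr (- (2 * \<rho>))) = x powr (1 + 2 * \<rho>) + x powr (1 - 2 * \<rho>)"
      using x by (simp add: distrib_left powr_mult_base)
    finally have "(sqrt x * exp (\<rho> * \<bar>ln x\<bar>))\<^sup>2 \<le> x powr (1 + 2 * \<rho>) + x powr (1 - 2 * \<rho>)"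
      using x by simp
    then show "ennreal (norm ((envelope R \<rho> x)\<^sup>2)) \<le>
      (if x < R then ennreal (x powr (1 + 2 * \<rho>)) else 0) + (if x < R then ennreal (x powr (1 - 2 * \<rho>)) else 0)"
      by (simp add: envelope_def ennreal_leI flip: ennreal_plus)
  qed
  also have "\<dots> = (\<integral>\<^sup>+x. (if x < R then ennreal (x powr (1 + 2 * \<rho>)) else 0) \<partial>half_line)
      + (\<integral>\<^sup>+x. (if x < R then ennreal (x powr (1 - 2 * \<rho>)) else 0) \<partial>half_line)"
    by (rule nn_integral_add) measurable
  also have "\<dots> \<le> ennreal (R powr (1 + 2 * \<rho> + 1) / (1 + 2 * \<rho> + 1)) + ennreal (R powr (1 - 2 * \<rho> + 1) / (1 - 2 * \<rho> + 1))"
    by (intro add_mono nn_integral_powr_from_0) (use \<rho> R in auto)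
  also have "\<dots> < \<infinity>" by simp
  finally show "(\<integral>\<^sup>+x. ennreal (norm ((envelope R \<rho> x)\<^sup>2)) \<partial>half_line) < \<infinity>" .
qed

lemma square_integrable_envelope:
  assumes "F \<in> borel_measurable half_line" "\<And>x. 0 < x \<Longrightarrow> norm (F x) \<le> K * envelope R \<rho> x"
    and \<rho>: "0 \<le> \<rho>" "\<rho> < 1" and R: "0 < R"
  shows "square_integrable F"
  unfolding square_integrable_def
proof (rule conjI[OF assms(1)], rule Bochner_Integration.integrable_bound)
  show "integrable half_line (\<lambda>x. K\<^sup>2 * (envelope R \<rho> x)\<^sup>2)"
    by (intro integrable_mult_right envelope_square_integrable \<rho> R)
  have [measurable]: "F \<in> borel_measurable half_line" by (rule assms(1))
  show "(\<lambda>x. (cmod (F x))\<^sup>2) \<in> borel_measurable half_line" by measurable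
  show "AE x in half_line. norm ((cmod (F x))\<^sup>2) \<le> norm (K\<^sup>2 * (envelope R \<rho> x)\<^sup>2)"
  proof (rule AE_I2)
    fix x assume "x \<in> space half_line"
    then have "(norm (F x))\<^sup>2 \<le> (K * envelope R \<rho> x)\<^sup>2" using assms(2) by (intro power_mono) auto
    then show "norm ((cmod (F x))\<^sup>2) \<le> norm (K\<^sup>2 * (envelope R \<rho> x)\<^sup>2)" by (simp add: power_mult_distrib)
  qed
qed

context cutoff
begin

lemma norm_cut_solutions_le:
  obtains B where "0 < B"
    "\<And>\<alpha> r \<rho> x. \<bar>Re (csqrt \<alpha>)\<bar> \<le> r \<Longrightarrow> r < \<rho> \<Longrightarrow> 0 < x \<Longrightarrow> norm (sol1 \<alpha> x * \<xi> x) \<le> B * envelope R \<rho> x"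
    "\<And>\<alpha> r \<rho> x. \<bar>Re (csqrt \<alpha>)\<bar> \<le> r \<Longrightarrow> r < \<rho> \<Longrightarrow> 0 < x \<Longrightarrow> norm (sol2 \<alpha> x * \<xi> x) \<le> B / (\<rho> - r) * envelope R \<rho> x"
proof -
  obtain B where B: "0 < B" "\<And>x. 0 < x \<Longrightarrow> norm (\<xi> x) \<le> B" by (rule bounded) (rule that)
  show thesis
  proof (rule that[OF B(1)])
    fix \<alpha> r \<rho> and x :: real assume a: "\<bar>Re (csqrt \<alpha>)\<bar> \<le> r" "r < \<rho>" "0 < x"
    show "norm (sol1 \<alpha> x * \<xi> x) \<le> B * envelope R \<rho> x"
    proof (cases "x < R")
      case True
      have "norm (sol1 \<alpha> x) * norm (\<xi> x) \<le> (sqrt x * exp (\<rho> * \<bar>ln x\<bar>)) * B"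
        by (rule mult_mono[OF norm_solutions_le(1)[OF a] B(2)[OF a(3)]]) (use a in auto)
      then show ?thesis using True by (simp add: envelope_def norm_mult mult_ac)
    qed (simp add: zero envelope_def)
    show "norm (sol2 \<alpha> x * \<xi> x) \<le> B / (\<rho> - r) * envelope R \<rho> x"
    proof (cases "x < R")
      case True
      have "norm (sol2 \<alpha> x) * norm (\<xi> x) \<le> (1 / (\<rho> - r) * (sqrt x * exp (\<rho> * \<bar>ln x\<bar>))) * B"
        by (rule mult_mono[OF norm_solutions_le(2)[OF a] B(2)[OF a(3)]]) (use a in auto)
      then show ?thesis using True by (simp add: envelope_def norm_mult mult_ac)
    qed (simp add: zero envelope_def)
  qed
qed

lemma cut_solutions_measurable:
  "(\<lambda>x. sol1 \<alpha> x * \<xi> x) \<in> borel_measurable half_line" "(\<lambda>x. sol2 \<alpha> x * \<xi> x) \<in> borel_measurable half_line"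
  by (intro continuous_on_half_line_measurable smooth_on_imp_continuous_on smooth_cut smooth_sol1 smooth_sol2)+

lemma square_integrable_cut_solutions:
  assumes \<alpha>: "\<bar>Re (csqrt \<alpha>)\<bar> < 1"
  shows "square_integrable (\<lambda>x. sol1 \<alpha> x * \<xi> x)" "square_integrable (\<lambda>x. sol2 \<alpha> x * \<xi> x)"
proof -
  define r where "r = \<bar>Re (csqrt \<alpha>)\<bar>"
  define \<rho> where "\<rho> = (1 + r) / 2"
  have r: "\<bar>Re (csqrt \<alpha>)\<bar> \<le> r" "r < \<rho>" "0 \<le> \<rho>" "\<rho> < 1" using \<alpha> by (auto simp: r_def \<rho>_def)
  have R: "0 < R" using eps by simp
  obtain B where B: "0 < B"
    "\<And>\<alpha> r \<rho> x. \<bar>Re (csqrt \<alpha>)\<bar> \<le> r \<Longrightarrow> r < \<rho> \<Longrightarrow> 0 < x \<Longrightarrow> norm (sol1 \<alpha> x * \<xi> x) \<le> B * envelope R \<rho> x"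
    "\<And>\<alpha> r \<rho> x. \<bar>Re (csqrt \<alpha>)\<bar> \<le> r \<Longrightarrow> r < \<rho> \<Longrightarrow> 0 < x \<Longrightarrow> norm (sol2 \<alpha> x * \<xi> x) \<le> B / (\<rho> - r) * envelope R \<rho> x"
    by (rule norm_cut_solutions_le) (rule that)
  show "square_integrable (\<lambda>x. sol1 \<alpha> x * \<xi> x)"
    by (rule square_integrable_envelope[OF cut_solutions_measurable(1) B(2)[OF r(1,2)] r(3,4) R])
  show "square_integrable (\<lambda>x. sol2 \<alpha> x * \<xi> x)"
    by (rule square_integrable_envelope[OF cut_solutions_measurable(2) B(3)[OF r(1,2)] r(3,4) R])
qed

definition cut1 :: "complex \<Rightarrow> L2" where "cut1 \<alpha> = abs_L2 (\<lambda>x. sol1 \<alpha> x * \<xi> x)"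
definition cut2 :: "complex \<Rightarrow> L2" where "cut2 \<alpha> = abs_L2 (\<lambda>x. sol2 \<alpha> x * \<xi> x)"
definition Lcut1 :: "complex \<Rightarrow> L2" where "Lcut1 \<alpha> = abs_L2 (bessel \<alpha> (\<lambda>x. sol1 \<alpha> x * \<xi> x))"
definition Lcut2 :: "complex \<Rightarrow> L2" where "Lcut2 \<alpha> = abs_L2 (bessel \<alpha> (\<lambda>x. sol2 \<alpha> x * \<xi> x))"

lemma cut_in_L_max:
  assumes "\<bar>Re (csqrt \<alpha>)\<bar> < 1"
  shows "(cut1 \<alpha>, Lcut1 \<alpha>) \<in> L_max \<alpha>" "(cut2 \<alpha>, Lcut2 \<alpha>) \<in> L_max \<alpha>"
  unfolding cut1_def Lcut1_def cut2_def Lcut2_def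
  by (intro smooth_in_L_max smooth_cut smooth_sol1 smooth_sol2 square_integrable_cut_solutions assms
      square_integrable_test[OF bessel_cut1] square_integrable_test[OF bessel_cut2])+

lemma rep_cut:
  assumes "\<bar>Re (csqrt \<alpha>)\<bar> < 1"
  shows "AE x in half_line. rep_L2 (cut1 \<alpha>) x = sol1 \<alpha> x * \<xi> x"
    "AE x in half_line. rep_L2 (cut2 \<alpha>) x = sol2 \<alpha> x * \<xi> x"
  unfolding cut1_def cut2_def by (intro AE_rep_abs_L2 square_integrable_cut_solutions assms)+

lemma H2_0_green:
  assumes "h \<in> H2_0" "(h, k) \<in> L_max (1/4)"
  shows "AE x in half_line. rep_L2 h x = green_op (1/4) (rep_L2 k) x"
  using assms H2_0_iff L_max_unique by metis

lemma bessel_change: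
  "bessel \<alpha> \<phi> x = bessel \<beta> \<phi> x + (\<alpha> - \<beta>) * ((1 / (complex_of_real x)\<^sup>2) * \<phi> x)"
proof -
  have "- d + (\<alpha> - 1/4) * c * p = (- d + (\<beta> - 1/4) * c * p) + (\<alpha> - \<beta>) * (c * p)" for c d p :: complex
    by (simp add: algebra_simps)
  then show ?thesis unfolding bessel_def .
qed

lemma L_max_change:
  assumes fg: "(f, g) \<in> L_max \<beta>" and u: "AE x in half_line. rep_L2 f x / (complex_of_real x)\<^sup>2 = rep_L2 u x"
  shows "(f, g + (\<alpha> - \<beta>) *\<^sub>C u) \<in> L_max \<alpha>"
  unfolding L_max_iff
proof
  fix \<phi> assume t: "\<phi> \<in> test_functions"
  have t2: "(\<lambda>x. (1 / (complex_of_real x)\<^sup>2) * \<phi> x) \<in> test_functions" by (rule mult_test[OF t smooth_inverse_square])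
  note f = square_integrable_imp_locally_integrable[OF square_integrable_rep[of f]]
  have "distribution_of f (bessel \<alpha> \<phi>)
    = (\<integral>x. rep_L2 f x * bessel \<beta> \<phi> x + (\<alpha> - \<beta>) * (rep_L2 f x * ((1 / (complex_of_real x)\<^sup>2) * \<phi> x)) \<partial>half_line)"
    unfolding distribution_of_def
    unfolding bessel_change[of \<alpha> _ _ \<beta>]
    by (rule Bochner_Integration.integral_cong) (simp_all only: distrib_left mult.left_commute)
  also have "\<dots> = distribution_of f (bessel \<beta> \<phi>) + (\<alpha> - \<beta>) * (\<integral>x. rep_L2 f x * ((1 / (complex_of_real x)\<^sup>2) * \<phi> x) \<partial>half_line)"
    unfolding distribution_of_def
    by (simp only: Bochner_Integration.integral_add[OF integrable_mult_test[OF f bessel_test[OF t]]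
        integrable_mult_right[OF integrable_mult_test[OF f t2]]] integral_mult_right_zero)
  also have "(\<integral>x. rep_L2 f x * ((1 / (complex_of_real x)\<^sup>2) * \<phi> x) \<partial>half_line)
    = (\<integral>x. (rep_L2 f x / (complex_of_real x)\<^sup>2) * \<phi> x \<partial>half_line)"
    by (rule Bochner_Integration.integral_cong) auto
  also have "\<dots> = distribution_of u \<phi>"
  proof (rule distribution_of_cong[symmetric])
    show "AE x in half_line. rep_L2 u x = rep_L2 f x / (complex_of_real x)\<^sup>2" using u by eventually_elim simp
    have [measurable]: "rep_L2 f \<in> borel_measurable half_line" by (rule rep_L2_measurable)
    show "(\<lambda>x. rep_L2 f x / (complex_of_real x)\<^sup>2) \<in> borel_measurable half_line" by measurable
  qed (rule test_measurable[OF t])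
  also have "distribution_of f (bessel \<beta> \<phi>) = distribution_of g \<phi>" using fg t unfolding L_max_iff by blast
  also have "distribution_of g \<phi> + (\<alpha> - \<beta>) * distribution_of u \<phi> = distribution_of (g + (\<alpha> - \<beta>) *\<^sub>C u) \<phi>"
    by (simp only: distribution_of_add[OF t] distribution_of_scale[OF test_measurable[OF t]])
  finally show "distribution_of f (bessel \<alpha> \<phi>) = distribution_of (g + (\<alpha> - \<beta>) *\<^sub>C u) \<phi>" .
qed

text \<open>For h in \<open>H2_0\<close> the quotient h/x^2 is \<open>hardy (1/4) k\<close>. Thus
  the image of h is affine in \<alpha>, with coefficients depending boundedly on k; the holomorphic
  family is built on this formula.\<close>

lemma H2_0_in_L_max:
  assumes "h \<in> H2_0" "(h, k) \<in> L_max (1/4)"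
  shows "(h, k + (\<alpha> - 1/4) *\<^sub>C hardy (1/4) k) \<in> L_max \<alpha>"
proof (rule L_max_change[OF assms(2)])
  show "AE x in half_line. rep_L2 h x / (complex_of_real x)\<^sup>2 = rep_L2 (hardy (1/4) k) x"
    using H2_0_green[OF assms] rep_hardy[OF quarter_admissible, of k] by eventually_elim simp
qed

lemma H2_0_L_max: "h \<in> H2_0 \<Longrightarrow> \<exists>k. (h, k) \<in> L_max (1/4)"
  using H2_0_iff by blast

lemma AE_rep_remainder:
  assumes \<alpha>: "\<bar>Re (csqrt \<alpha>)\<bar> < 1"
  shows "AE x in half_line. rep_L2 (f - a *\<^sub>C cut1 \<alpha> - b *\<^sub>C cut2 \<alpha>) x
    = rep_L2 f x - a * (sol1 \<alpha> x * \<xi> x) - b * (sol2 \<alpha> x * \<xi> x)"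
proof -
  have eq: "f - a *\<^sub>C cut1 \<alpha> - b *\<^sub>C cut2 \<alpha> = f + ((- a) *\<^sub>C cut1 \<alpha> + (- b) *\<^sub>C cut2 \<alpha>)"
    by (simp add: scaleC_uminus)
  have "AE x in half_line. rep_L2 (f + ((- a) *\<^sub>C cut1 \<alpha> + (- b) *\<^sub>C cut2 \<alpha>)) x
    = rep_L2 f x - a * (sol1 \<alpha> x * \<xi> x) - b * (sol2 \<alpha> x * \<xi> x)"
    using AE_rep_add[of f "(- a) *\<^sub>C cut1 \<alpha> + (- b) *\<^sub>C cut2 \<alpha>"] AE_rep_add[of "(- a) *\<^sub>C cut1 \<alpha>" "(- b) *\<^sub>C cut2 \<alpha>"]
      AE_rep_scale[of "- a" "cut1 \<alpha>"] AE_rep_scale[of "- b" "cut2 \<alpha>"] rep_cut[OF \<alpha>]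
    by eventually_elim simp
  then show ?thesis by (simp only: eq)
qed

text \<open>Since h/x^2 is square integrable, h also belongs to the domain for 1/4. Its
  representation there has no solution part, because near zero h is itself an O(x^(3/2)) integral
  for the parameter \<alpha>.\<close>

lemma remainder_in_H2_0:
  assumes \<alpha>: "\<bar>Re (csqrt \<alpha>)\<bar> < 1" and fg: "(f, g) \<in> L_max \<alpha>"
  shows "f - coef1 \<alpha> f g *\<^sub>C cut1 \<alpha> - coef2 \<alpha> f g *\<^sub>C cut2 \<alpha> \<in> H2_0"
proof -
  define a where "a = coef1 \<alpha> f g"
  define b where "b = coef2 \<alpha> f g"
  define h where "h = f - a *\<^sub>C cut1 \<alpha> - b *\<^sub>C cut2 \<alpha>"
  define g' where "g' = g - a *\<^sub>C Lcut1 \<alpha> - b *\<^sub>C Lcut2 \<alpha>"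
  have h: "(h, g') \<in> L_max \<alpha>"
    unfolding h_def g'_def by (intro L_max_diff L_max_scale cut_in_L_max \<alpha> fg)
  \<comment> \<open>Where \<open>\<xi>\<close> is 1 the subtracted cut off solutions equal the
    solution part of the representation.\<close>
  have near: "AE x in half_line. x < \<epsilon> \<longrightarrow> rep_L2 h x = green_op \<alpha> (rep_L2 g) x"
  proof -
    have "AE x in half_line. 0 < x" by (rule AE_I2) simp
    with AE_rep_remainder[OF \<alpha>, of f a b, folded h_def] representation[OF \<alpha> fg, folded a_def b_def]
    show ?thesis
      by eventually_elim (auto simp: one)
  qed
  let ?H = "\<lambda>x. rep_L2 h x / (complex_of_real x)\<^sup>2"
  have sq: "square_integrable ?H"
    unfolding square_integrable_def
  proof
    have [measurable]: "rep_L2 h \<in> borel_measurable half_line" by (rule rep_L2_measurable)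
    show m[measurable]: "?H \<in> borel_measurable half_line" by measurable
    show "integrable half_line (\<lambda>x. (cmod (?H x))\<^sup>2)"
    \<comment> \<open>The majorant joins two regions: below \<open>\<epsilon>\<close> the Hardy
      bound for the integral, above it the bound \<open>1 / \<epsilon>\<^sup>2\<close> for the
      weight.\<close>
    proof (rule Bochner_Integration.integrable_bound)
      show "integrable half_line (\<lambda>x. (norm (green_op \<alpha> (rep_L2 g) x / (complex_of_real x)\<^sup>2))\<^sup>2 + (1 / \<epsilon>\<^sup>2)\<^sup>2 * (norm (rep_L2 h x))\<^sup>2)"
        using square_integrable_green_op[OF \<alpha> square_integrable_rep[of g]] square_integrable_rep[of h]
        by (intro Bochner_Integration.integrable_add integrable_mult_right) (auto simp: square_integrable_def)
      show "(\<lambda>x. (cmod (?H x))\<^sup>2) \<in> borel_measurable half_line" by measurable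
      have "AE x in half_line. 0 < x" by (rule AE_I2) simp
      with near show "AE x in half_line. norm ((cmod (?H x))\<^sup>2)
        \<le> norm ((norm (green_op \<alpha> (rep_L2 g) x / (complex_of_real x)\<^sup>2))\<^sup>2 + (1 / \<epsilon>\<^sup>2)\<^sup>2 * (norm (rep_L2 h x))\<^sup>2)"
      proof eventually_elim
        case (elim x)
        show ?case
        proof (cases "x < \<epsilon>")
          case True
          then have e: "rep_L2 h x = green_op \<alpha> (rep_L2 g) x" using elim(1) by simp
          show ?thesis unfolding e by simp
        next
          case False
          have "norm (?H x) = 1 / x\<^sup>2 * norm (rep_L2 h x)" by (simp add: norm_divide norm_power)
          also have "\<dots> \<le> 1 / \<epsilon>\<^sup>2 * norm (rep_L2 h x)"
            by (rule mult_right_mono) (use False eps in \<open>auto intro!: divide_left_mono power_mono\<close>)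
          finally have "(norm (?H x))\<^sup>2 \<le> (1 / \<epsilon>\<^sup>2 * norm (rep_L2 h x))\<^sup>2" by (intro power_mono) auto
          then have "(norm (?H x))\<^sup>2 \<le> (1 / \<epsilon>\<^sup>2)\<^sup>2 * (norm (rep_L2 h x))\<^sup>2" by (simp only: power_mult_distrib)
          moreover have "norm u \<le> norm (v + w)" if "u \<le> w" "0 \<le> u" "0 \<le> v" for u v w :: real
            using that by simp
          ultimately show ?thesis using zero_le_power2 by blast
        qed
      qed
    qed
  qed
  define k where "k = g' + (1/4 - \<alpha>) *\<^sub>C abs_L2 ?H"
  have k: "(h, k) \<in> L_max (1/4)"
    unfolding k_def
  proof (rule L_max_change[OF h])
    show "AE x in half_line. ?H x = rep_L2 (abs_L2 ?H) x" using AE_rep_abs_L2[OF sq] by eventually_elim simp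
  qed
  define A where "A = coef1 (1/4) h k"
  define B where "B = coef2 (1/4) h k"
  have rep: "AE x in half_line. rep_L2 h x = green_op (1/4) (rep_L2 k) x + A * sol1 (1/4) x + B * sol2 (1/4) x"
    unfolding A_def B_def by (rule representation[OF quarter_admissible k])
  obtain C where C: "0 < C" "\<And>g x. square_integrable g \<Longrightarrow> 0 < x \<Longrightarrow> norm (green_op \<alpha> g x) \<le> C * x powr (3/2) * norm (abs_L2 g)"
    by (rule green_op_bound[OF \<alpha>]) (rule that)
  obtain C' where C': "0 < C'" "\<And>g x. square_integrable g \<Longrightarrow> 0 < x \<Longrightarrow> norm (green_op (1/4) g x) \<le> C' * x powr (3/2) * norm (abs_L2 g)"
    by (rule green_op_bound[OF quarter_admissible]) (rule that)
  \<comment> \<open>Near zero the combination is the difference of two variation of constants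
    integrals, for \<alpha> and for 1/4, both of order x^(3/2).\<close>
  have "A = 0 \<and> B = 0"
  proof (rule solutions_near_zero[where \<delta> = \<epsilon> and r = "\<lambda>x. (C * norm g + C' * norm k) * x powr (3/2)"])
    have "AE x in half_line. 0 < x" by (rule AE_I2) simp
    with rep near show "AE x in half_line. x < \<epsilon> \<longrightarrow> norm (A * sol1 (1/4) x + B * sol2 (1/4) x)
      \<le> (C * norm g + C' * norm k) * x powr (3/2)"
    proof eventually_elim
      case (elim x)
      show ?case
      proof
        assume "x < \<epsilon>"
        then have "A * sol1 (1/4) x + B * sol2 (1/4) x = green_op \<alpha> (rep_L2 g) x - green_op (1/4) (rep_L2 k) x"
          using elim by (simp add: algebra_simps)
        then have "norm (A * sol1 (1/4) x + B * sol2 (1/4) x)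
            \<le> norm (green_op \<alpha> (rep_L2 g) x) + norm (green_op (1/4) (rep_L2 k) x)"
          by (simp only: norm_triangle_ineq4)
        also have "\<dots> \<le> C * x powr (3/2) * norm (abs_L2 (rep_L2 g)) + C' * x powr (3/2) * norm (abs_L2 (rep_L2 k))"
          by (rule add_mono[OF C(2)[OF square_integrable_rep elim(3)] C'(2)[OF square_integrable_rep elim(3)]])
        also have "\<dots> = (C * norm g + C' * norm k) * x powr (3/2)" by (simp add: abs_rep_L2 algebra_simps)
        finally show "norm (A * sol1 (1/4) x + B * sol2 (1/4) x) \<le> (C * norm g + C' * norm k) * x powr (3/2)" .
      qed
    qed
    show "\<exists>d>0. \<forall>x. 0 < x \<longrightarrow> x < d \<longrightarrow> (C * norm g + C' * norm k) * x powr (3/2) \<le> e * x" if "0 < e" for e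
      by (rule powr_three_halves_small[OF _ that]) (use C(1) C'(1) in simp)
  qed (rule eps)
  then have "AE x in half_line. rep_L2 h x = green_op (1/4) (rep_L2 k) x" using rep by simp
  then have "h \<in> H2_0" using k H2_0_iff by blast
  then show ?thesis by (simp only: h_def a_def b_def)
qed

theorem Domain_L_max:
  assumes \<alpha>: "\<bar>Re (csqrt \<alpha>)\<bar> < 1"
  shows "f \<in> Domain (L_max \<alpha>) \<longleftrightarrow> (\<exists>h\<in>H2_0. \<exists>a b. f = h + a *\<^sub>C cut1 \<alpha> + b *\<^sub>C cut2 \<alpha>)"
proof
  assume "f \<in> Domain (L_max \<alpha>)"
  then obtain g where g: "(f, g) \<in> L_max \<alpha>" by blast
  have "f = (f - coef1 \<alpha> f g *\<^sub>C cut1 \<alpha> - coef2 \<alpha> f g *\<^sub>C cut2 \<alpha>) + coef1 \<alpha> f g *\<^sub>C cut1 \<alpha> + coef2 \<alpha> f g *\<^sub>C cut2 \<alpha>"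
    by simp
  then show "\<exists>h\<in>H2_0. \<exists>a b. f = h + a *\<^sub>C cut1 \<alpha> + b *\<^sub>C cut2 \<alpha>"
    using remainder_in_H2_0[OF \<alpha> g] by blast
next
  assume "\<exists>h\<in>H2_0. \<exists>a b. f = h + a *\<^sub>C cut1 \<alpha> + b *\<^sub>C cut2 \<alpha>"
  then obtain h a b where h: "h \<in> H2_0" and f: "f = h + a *\<^sub>C cut1 \<alpha> + b *\<^sub>C cut2 \<alpha>" by blast
  obtain k where k: "(h, k) \<in> L_max (1/4)" using H2_0_L_max[OF h] by blast
  have "(f, (k + (\<alpha> - 1/4) *\<^sub>C hardy (1/4) k) + a *\<^sub>C Lcut1 \<alpha> + b *\<^sub>C Lcut2 \<alpha>) \<in> L_max \<alpha>"
    unfolding f by (intro L_max_add H2_0_in_L_max h k L_max_scale cut_in_L_max \<alpha>)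
  then show "f \<in> Domain (L_max \<alpha>)" by blast
qed

end

section \<open>Holomorphic families\<close>

subsection \<open>Graph spaces of closed operators\<close>

definition graph_space :: "('h::complex_banach \<times> 'h) set \<Rightarrow> 'h normed_structure" where
  "graph_space T = \<lparr>carr = Domain T, zer = 0, add = (+), scl = scaleC,
     nrm = (\<lambda>x. norm x + norm (op_apply T x))\<rparr>"

lemma minus_of_graph_space: "minus_of (graph_space T) x y = x - y"
  by (simp add: minus_of_def graph_space_def scaleC_minus_one)

context
  fixes T :: "('h::complex_banach \<times> 'h) set"
  assumes T: "closed_operator T"
begin

lemma op_apply_eq: "(x, y) \<in> T \<Longrightarrow> op_apply T x = y"
  unfolding op_apply_def
  using T[unfolded closed_operator_def, THEN conjunct1] by (intro the_equality) (auto dest: single_valuedD)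

lemma op_apply_in: "x \<in> Domain T \<Longrightarrow> (x, op_apply T x) \<in> T"
  using op_apply_eq by blast

lemma closed_operator_add: "(x, y) \<in> T \<Longrightarrow> (x', y') \<in> T \<Longrightarrow> (x + x', y + y') \<in> T"
  using T unfolding closed_operator_def by blast

lemma closed_operator_scale: "(x, y) \<in> T \<Longrightarrow> (c *\<^sub>C x, c *\<^sub>C y) \<in> T"
  using T unfolding closed_operator_def by blast

lemma closed_operator_diff: "(x, y) \<in> T \<Longrightarrow> (x', y') \<in> T \<Longrightarrow> (x - x', y - y') \<in> T"
  using closed_operator_add[OF _ closed_operator_scale[of x' y' "-1"], of x y] by (simp add: scaleC_minus_one)

lemma op_apply_add:
  "x \<in> Domain T \<Longrightarrow> y \<in> Domain T \<Longrightarrow> op_apply T (x + y) = op_apply T x + op_apply T y"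
  by (rule op_apply_eq[OF closed_operator_add[OF op_apply_in op_apply_in]])

lemma op_apply_scale: "x \<in> Domain T \<Longrightarrow> op_apply T (c *\<^sub>C x) = c *\<^sub>C op_apply T x"
  by (rule op_apply_eq[OF closed_operator_scale[OF op_apply_in]])

lemma op_apply_diff:
  "x \<in> Domain T \<Longrightarrow> y \<in> Domain T \<Longrightarrow> op_apply T (x - y) = op_apply T x - op_apply T y"
  by (rule op_apply_eq[OF closed_operator_diff[OF op_apply_in op_apply_in]])

text \<open>A Cauchy sequence for the graph norm converges together with its images, and closedness
  of the graph puts the limit pair into \<open>T\<close>.\<close>

lemma graph_space_complete:
  fixes s :: "nat \<Rightarrow> 'h"
  assumes s: "range s \<subseteq> Domain T"
    and cauchy: "\<forall>e>0. \<exists>N. \<forall>i\<ge>N. \<forall>j\<ge>N. norm (s i - s j) + norm (op_apply T (s i - s j)) < e"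
  shows "\<exists>l\<in>Domain T. (\<lambda>n. norm (s n - l) + norm (op_apply T (s n - l))) \<longlonglongrightarrow> 0"
proof -
  have sD: "s n \<in> Domain T" for n using s by blast
  have less: "0 \<le> v \<Longrightarrow> u + v < e \<Longrightarrow> u < e" and less': "0 \<le> u \<Longrightarrow> u + v < e \<Longrightarrow> v < e" for u v e :: real
    by simp_all
  have "Cauchy s"
    unfolding Cauchy_def dist_norm
  proof (intro allI impI)
    fix e :: real assume "0 < e"
    then obtain N where "\<forall>i\<ge>N. \<forall>j\<ge>N. norm (s i - s j) + norm (op_apply T (s i - s j)) < e"
      using cauchy by blast
    then show "\<exists>N. \<forall>i\<ge>N. \<forall>j\<ge>N. norm (s i - s j) < e"
      using less[OF norm_ge_zero] by blast
  qed
  then obtain l where l: "s \<longlonglongrightarrow> l" using Cauchy_convergent convergent_def by blast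
  have "Cauchy (\<lambda>n. op_apply T (s n))"
    unfolding Cauchy_def dist_norm
  proof (intro allI impI)
    fix e :: real assume "0 < e"
    then obtain N where "\<forall>i\<ge>N. \<forall>j\<ge>N. norm (s i - s j) + norm (op_apply T (s i - s j)) < e"
      using cauchy by blast
    then have "\<exists>N. \<forall>i\<ge>N. \<forall>j\<ge>N. norm (op_apply T (s i - s j)) < e"
      using less'[OF norm_ge_zero] by blast
    then show "\<exists>N. \<forall>i\<ge>N. \<forall>j\<ge>N. norm (op_apply T (s i) - op_apply T (s j)) < e"
      by (simp only: op_apply_diff[OF sD sD])
  qed
  then obtain k where k: "(\<lambda>n. op_apply T (s n)) \<longlonglongrightarrow> k" using Cauchy_convergent convergent_def by blast
  have cl: "closed T" using T unfolding closed_operator_def by blast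
  have lim: "(\<lambda>n. (s n, op_apply T (s n))) \<longlonglongrightarrow> (l, k)" by (intro tendsto_Pair l k)
  have lk: "(l, k) \<in> T" by (rule closed_sequentially[OF cl _ lim]) (rule op_apply_in[OF sD])
  then have lD: "l \<in> Domain T" by blast
  have "(\<lambda>n. norm (s n - l) + norm (op_apply T (s n) - k)) \<longlonglongrightarrow> norm (l - l) + norm (k - k)"
    by (intro tendsto_intros l k)
  then have "(\<lambda>n. norm (s n - l) + norm (op_apply T (s n - l))) \<longlonglongrightarrow> 0"
    by (simp add: op_apply_diff[OF sD lD] op_apply_eq[OF lk])
  then show ?thesis using lD by blast
qed

lemma graph_space_banach: "normed_structure_banach (graph_space T)"
proof -
  have 0: "0 \<in> Domain T" using T unfolding closed_operator_def by blast
  have add: "x + y \<in> Domain T" if "x \<in> Domain T" "y \<in> Domain T" for x y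
    using closed_operator_add[OF op_apply_in[OF that(1)] op_apply_in[OF that(2)]] by blast
  have scl: "c *\<^sub>C x \<in> Domain T" if "x \<in> Domain T" for c x
    using closed_operator_scale[OF op_apply_in[OF that]] by blast
  have one: "1 *\<^sub>C x = x" for x :: 'h using scaleC_of_real[of 1 x] by simp
  have t0: "op_apply T 0 = 0" using op_apply_add[OF 0 0] by simp
  have tri: "norm (x + y) + norm (op_apply T (x + y)) \<le> (norm x + norm (op_apply T x)) + (norm y + norm (op_apply T y))"
    if "x \<in> Domain T" "y \<in> Domain T" for x y
    using norm_triangle_ineq[of x y] norm_triangle_ineq[of "op_apply T x" "op_apply T y"]
    unfolding op_apply_add[OF that] by linarith
  have hom: "norm (c *\<^sub>C x) + norm (op_apply T (c *\<^sub>C x)) = cmod c * (norm x + norm (op_apply T x))"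
    if "x \<in> Domain T" for c x
    unfolding op_apply_scale[OF that] norm_scaleC by (simp add: distrib_left)
  have zero: "norm x + norm (op_apply T x) = 0 \<longleftrightarrow> x = 0" for x
    using t0 by (auto simp: add_nonneg_eq_0_iff)
  have eqs: "carr (graph_space T) = Domain T" "zer (graph_space T) = 0" "add (graph_space T) = (+)"
    "scl (graph_space T) = scaleC" "nrm (graph_space T) = (\<lambda>x. norm x + norm (op_apply T x))"
    by (simp_all add: graph_space_def)
  show ?thesis
    unfolding normed_structure_banach_def minus_of_graph_space eqs
    by (intro conjI ballI allI impI 0 add scl add.assoc add.commute add_0_left diff_self
        scaleC_add_right scaleC_add_left scaleC_scaleC one add_nonneg_nonneg norm_ge_zero zero tri hom)
      (use graph_space_complete in blast)+
qed

end

lemma bounded_operator_graph_spaceI: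
  assumes "\<And>x y. x \<in> Domain T \<Longrightarrow> y \<in> Domain T \<Longrightarrow> A (x + y) = A x + A y"
    and "\<And>c x. x \<in> Domain T \<Longrightarrow> A (c *\<^sub>C x) = c *\<^sub>C A x"
    and "\<And>x. x \<in> Domain T \<Longrightarrow> norm (A x) \<le> B * (norm x + norm (op_apply T x))"
  shows "bounded_operator (graph_space T) A"
  unfolding bounded_operator_def graph_space_def normed_structure.select_convs
  using assms by (intro conjI ballI allI exI[of _ B])

text \<open>The supremum is meaningful only for a nonempty bounded set: the zero vector gives the
  first, the bound \<open>c\<close> the second.\<close>

lemma operator_norm_le:
  assumes "zer K \<in> carr K" "nrm K (zer K) \<le> 1" "0 \<le> c"
    and "\<And>x. x \<in> carr K \<Longrightarrow> nrm K x \<le> 1 \<Longrightarrow> norm (A x) \<le> c"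
  shows "0 \<le> operator_norm K A" "operator_norm K A \<le> c"
proof -
  let ?S = "{x \<in> carr K. nrm K x \<le> 1}"
  have z: "zer K \<in> ?S" using assms(1,2) by simp
  have "bdd_above ((\<lambda>x. norm (A x)) ` ?S)" by (rule bdd_aboveI[of _ c]) (use assms(4) in auto)
  then have "norm (A (zer K)) \<le> operator_norm K A"
    unfolding operator_norm_def by (rule cSUP_upper[OF z])
  then show "0 \<le> operator_norm K A" by (rule order_trans[OF norm_ge_zero])
  show "operator_norm K A \<le> c"
    unfolding operator_norm_def by (rule cSUP_least) (use z assms(4) in auto)
qed

text \<open>The family is affine in z plus two operators of rank at most one whose functionals are
  fixed and whose vectors depend on z. Differentiability in operator norm thus reduces to that of
  the vectors \<open>P\<close> and \<open>Q\<close>.\<close>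

lemma holomorphic_bounded_familyI:
  fixes P Q :: "complex \<Rightarrow> 'h::complex_banach"
  assumes K: "normed_structure_banach K"
    and T0: "bounded_operator K T0" and T1: "bounded_operator K T1"
    and a: "\<And>x y. x \<in> carr K \<Longrightarrow> y \<in> carr K \<Longrightarrow> a (add K x y) = a x + a y"
      "\<And>c x. x \<in> carr K \<Longrightarrow> a (scl K c x) = c * a x" "\<And>x. x \<in> carr K \<Longrightarrow> cmod (a x) \<le> Ca * nrm K x"
    and b: "\<And>x y. x \<in> carr K \<Longrightarrow> y \<in> carr K \<Longrightarrow> b (add K x y) = b x + b y"
      "\<And>c x. x \<in> carr K \<Longrightarrow> b (scl K c x) = c * b x" "\<And>x. x \<in> carr K \<Longrightarrow> cmod (b x) \<le> Cb * nrm K x"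
    and P: "\<And>z. z \<in> \<Theta> \<Longrightarrow> \<exists>D. ((\<lambda>w. norm (inverse (w - z) *\<^sub>C (P w - P z) - D)) \<longlongrightarrow> 0) (at z)"
    and Q: "\<And>z. z \<in> \<Theta> \<Longrightarrow> \<exists>D. ((\<lambda>w. norm (inverse (w - z) *\<^sub>C (Q w - Q z) - D)) \<longlongrightarrow> 0) (at z)"
    and \<Theta>: "open \<Theta>"
    and A: "\<And>z x. z \<in> \<Theta> \<Longrightarrow> x \<in> carr K \<Longrightarrow> A z x = T0 x + z *\<^sub>C T1 x + a x *\<^sub>C P z + b x *\<^sub>C Q z"
  shows "holomorphic_bounded_family K \<Theta> A"
proof -
  have Kadd: "add K x y \<in> carr K" if "x \<in> carr K" "y \<in> carr K" for x y
    using K[unfolded normed_structure_banach_def, THEN conjunct2, THEN conjunct1] that by blast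
  have Kscl: "scl K c x \<in> carr K" if "x \<in> carr K" for c x
    using K[unfolded normed_structure_banach_def, THEN conjunct2, THEN conjunct2, THEN conjunct1] that by blast
  have K0: "zer K \<in> carr K" "nrm K (zer K) \<le> 1"
  proof -
    show "zer K \<in> carr K" by (rule K[unfolded normed_structure_banach_def, THEN conjunct1])
    moreover have "\<forall>x\<in>carr K. nrm K x = 0 \<longleftrightarrow> x = zer K"
      using K unfolding normed_structure_banach_def by (elim conjE) assumption
    ultimately have "nrm K (zer K) = 0" by blast
    then show "nrm K (zer K) \<le> 1" by simp
  qed
  have "\<forall>x\<in>carr K. 0 \<le> nrm K x"
    using K unfolding normed_structure_banach_def by (elim conjE) assumption
  then have nn: "0 \<le> nrm K x" if "x \<in> carr K" for x using that by blast
  obtain B0 where B0: "\<And>x. x \<in> carr K \<Longrightarrow> norm (T0 x) \<le> B0 * nrm K x" using T0 unfolding bounded_operator_def by blast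
  obtain B1 where B1: "\<And>x. x \<in> carr K \<Longrightarrow> norm (T1 x) \<le> B1 * nrm K x" using T1 unfolding bounded_operator_def by blast
  have T0l: "T0 (add K x y) = T0 x + T0 y" "T0 (scl K c x) = c *\<^sub>C T0 x" if "x \<in> carr K" "y \<in> carr K" for c x y
    using T0 that unfolding bounded_operator_def by blast+
  have T1l: "T1 (add K x y) = T1 x + T1 y" "T1 (scl K c x) = c *\<^sub>C T1 x" if "x \<in> carr K" "y \<in> carr K" for c x y
    using T1 that unfolding bounded_operator_def by blast+
  have bounded: "bounded_operator K (\<lambda>x. c0 *\<^sub>C T0 x + c1 *\<^sub>C T1 x + a x *\<^sub>C p + b x *\<^sub>C q)" for c0 c1 and p q :: 'h
    unfolding bounded_operator_def
  proof (intro conjI ballI allI)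
    fix x y assume xy: "x \<in> carr K" "y \<in> carr K"
    show "c0 *\<^sub>C T0 (add K x y) + c1 *\<^sub>C T1 (add K x y) + a (add K x y) *\<^sub>C p + b (add K x y) *\<^sub>C q
      = (c0 *\<^sub>C T0 x + c1 *\<^sub>C T1 x + a x *\<^sub>C p + b x *\<^sub>C q) + (c0 *\<^sub>C T0 y + c1 *\<^sub>C T1 y + a y *\<^sub>C p + b y *\<^sub>C q)"
      unfolding T0l[OF xy] T1l[OF xy] a(1)[OF xy] b(1)[OF xy] scaleC_add_right scaleC_add_left by simp
  next
    fix c x assume x: "x \<in> carr K"
    show "c0 *\<^sub>C T0 (scl K c x) + c1 *\<^sub>C T1 (scl K c x) + a (scl K c x) *\<^sub>C p + b (scl K c x) *\<^sub>C q
      = c *\<^sub>C (c0 *\<^sub>C T0 x + c1 *\<^sub>C T1 x + a x *\<^sub>C p + b x *\<^sub>C q)"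
      unfolding T0l[OF x x] T1l[OF x x] a(2)[OF x] b(2)[OF x] scaleC_add_right scaleC_scaleC
      by (simp add: mult.commute)
  next
    show "\<exists>B. \<forall>x\<in>carr K. norm (c0 *\<^sub>C T0 x + c1 *\<^sub>C T1 x + a x *\<^sub>C p + b x *\<^sub>C q) \<le> B * nrm K x"
    proof (intro exI ballI)
      fix x assume x: "x \<in> carr K"
      have "norm (c0 *\<^sub>C T0 x + c1 *\<^sub>C T1 x + a x *\<^sub>C p + b x *\<^sub>C q)
          \<le> norm (c0 *\<^sub>C T0 x) + norm (c1 *\<^sub>C T1 x) + norm (a x *\<^sub>C p) + norm (b x *\<^sub>C q)"
        by (intro norm_triangle_le add_mono order_refl)
      also have "\<dots> \<le> cmod c0 * (B0 * nrm K x) + cmod c1 * (B1 * nrm K x) + (Ca * nrm K x) * norm p + (Cb * nrm K x) * norm q"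
        unfolding norm_scaleC
        by (intro add_mono mult_left_mono mult_right_mono B0 B1 a(3) b(3) x norm_ge_zero)
      also have "\<dots> = (cmod c0 * B0 + cmod c1 * B1 + Ca * norm p + Cb * norm q) * nrm K x"
        by (simp add: algebra_simps)
      finally show "norm (c0 *\<^sub>C T0 x + c1 *\<^sub>C T1 x + a x *\<^sub>C p + b x *\<^sub>C q)
        \<le> (cmod c0 * B0 + cmod c1 * B1 + Ca * norm p + Cb * norm q) * nrm K x" .
    qed
  qed
  have one: "1 *\<^sub>C x = x" for x :: 'h using scaleC_of_real[of 1 x] by simp
  have null: "0 *\<^sub>C x = 0" for x :: 'h using scaleC_of_real[of 0 x] by simp
  show ?thesis
    unfolding holomorphic_bounded_family_def
  proof (intro conjI ballI)
    fix z assume z: "z \<in> \<Theta>"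
    have "bounded_operator K (\<lambda>x. T0 x + z *\<^sub>C T1 x + a x *\<^sub>C P z + b x *\<^sub>C Q z)"
      using bounded[of 1 z "P z" "Q z"] by (simp only: one)
    then show "bounded_operator K (A z)"
      unfolding bounded_operator_def by (simp add: A[OF z] Kadd Kscl)
  next
    fix z assume z: "z \<in> \<Theta>"
    obtain DP where DP: "((\<lambda>w. norm (inverse (w - z) *\<^sub>C (P w - P z) - DP)) \<longlongrightarrow> 0) (at z)" using P[OF z] by blast
    obtain DQ where DQ: "((\<lambda>w. norm (inverse (w - z) *\<^sub>C (Q w - Q z) - DQ)) \<longlongrightarrow> 0) (at z)" using Q[OF z] by blast
    \<comment> \<open>The affine part has difference quotient exactly \<open>T1\<close>, so the
      error comes from \<open>P\<close> and \<open>Q\<close> alone.\<close>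
    let ?D = "\<lambda>x. T1 x + a x *\<^sub>C DP + b x *\<^sub>C DQ"
    let ?p = "\<lambda>w. norm (inverse (w - z) *\<^sub>C (P w - P z) - DP)" and ?q = "\<lambda>w. norm (inverse (w - z) *\<^sub>C (Q w - Q z) - DQ)"
    have "bounded_operator K ?D" using bounded[of 0 1 DP DQ] by (simp only: one null add_0)
    moreover have "((\<lambda>w. operator_norm K (\<lambda>x. inverse (w - z) *\<^sub>C (A w x - A z x) - ?D x)) \<longlongrightarrow> 0) (at z)"
    proof (rule tendsto_sandwich)
      have le: "0 \<le> operator_norm K (\<lambda>x. inverse (w - z) *\<^sub>C (A w x - A z x) - ?D x) \<and>
          operator_norm K (\<lambda>x. inverse (w - z) *\<^sub>C (A w x - A z x) - ?D x) \<le> \<bar>Ca\<bar> * ?p w + \<bar>Cb\<bar> * ?q w"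
        if w: "w \<in> \<Theta>" "w \<noteq> z" for w
      proof (intro conjI operator_norm_le[OF K0])
        show c: "0 \<le> \<bar>Ca\<bar> * ?p w + \<bar>Cb\<bar> * ?q w" by simp
        show "norm (inverse (w - z) *\<^sub>C (A w x - A z x) - ?D x) \<le> \<bar>Ca\<bar> * ?p w + \<bar>Cb\<bar> * ?q w"
          if x: "x \<in> carr K" "nrm K x \<le> 1" for x
        proof -
          have "A w x - A z x = (w - z) *\<^sub>C T1 x + a x *\<^sub>C (P w - P z) + b x *\<^sub>C (Q w - Q z)"
          proof -
            have d1: "(w - z) *\<^sub>C T1 x = w *\<^sub>C T1 x - z *\<^sub>C T1 x"
              using scaleC_add_left[of "w - z" z "T1 x"] by simp
            have d2: "c *\<^sub>C (u - v) = c *\<^sub>C u - c *\<^sub>C v" for c and u v :: 'h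
              using scaleC_add_right[of c "u - v" v] by simp
            show ?thesis unfolding A[OF w(1) x(1)] A[OF z x(1)] d1 d2 by simp
          qed
          then have "inverse (w - z) *\<^sub>C (A w x - A z x) - ?D x
            = a x *\<^sub>C (inverse (w - z) *\<^sub>C (P w - P z) - DP) + b x *\<^sub>C (inverse (w - z) *\<^sub>C (Q w - Q z) - DQ)"
          proof -
            assume eq: "A w x - A z x = (w - z) *\<^sub>C T1 x + a x *\<^sub>C (P w - P z) + b x *\<^sub>C (Q w - Q z)"
            have d2: "c *\<^sub>C (u - v) = c *\<^sub>C u - c *\<^sub>C v" for c and u v :: 'h
              using scaleC_add_right[of c "u - v" v] by simp
            have i: "inverse (w - z) * (w - z) = 1" using w by simp
            show ?thesis
              unfolding eq scaleC_add_right scaleC_scaleC i one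
                d2[of "a x" "inverse (w - z) *\<^sub>C (P w - P z)" DP] d2[of "b x" "inverse (w - z) *\<^sub>C (Q w - Q z)" DQ]
              by (simp add: mult.commute)
          qed
          also have "norm \<dots> \<le> cmod (a x) * ?p w + cmod (b x) * ?q w"
            by (rule norm_triangle_le) (simp add: norm_scaleC)
          also have "\<dots> \<le> \<bar>Ca\<bar> * ?p w + \<bar>Cb\<bar> * ?q w"
          \<comment> \<open>The constants \<open>Ca\<close> and \<open>Cb\<close> come without a
            sign, hence the absolute values.\<close>
          proof (intro add_mono mult_right_mono norm_ge_zero)
            have "Ca * nrm K x \<le> \<bar>Ca\<bar> * 1" using nn[OF x(1)] x(2) by (intro mult_mono) auto
            then show "cmod (a x) \<le> \<bar>Ca\<bar>" using a(3)[OF x(1)] by simp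
            have "Cb * nrm K x \<le> \<bar>Cb\<bar> * 1" using nn[OF x(1)] x(2) by (intro mult_mono) auto
            then show "cmod (b x) \<le> \<bar>Cb\<bar>" using b(3)[OF x(1)] by simp
          qed
          finally show ?thesis .
        qed
        then show "norm (inverse (w - z) *\<^sub>C (A w x - A z x) - ?D x) \<le> \<bar>Ca\<bar> * ?p w + \<bar>Cb\<bar> * ?q w"
          if "x \<in> carr K" "nrm K x \<le> 1" for x using that .
        show "0 \<le> \<bar>Ca\<bar> * ?p w + \<bar>Cb\<bar> * ?q w" by (rule c)
      qed
      have ev: "eventually (\<lambda>w. w \<in> \<Theta> \<and> w \<noteq> z) (at z)"
        using \<Theta> z by (auto simp: eventually_at_topological)
      show "eventually (\<lambda>w. 0 \<le> operator_norm K (\<lambda>x. inverse (w - z) *\<^sub>C (A w x - A z x) - ?D x)) (at z)"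
        using ev by eventually_elim (use le in blast)
      show "eventually (\<lambda>w. operator_norm K (\<lambda>x. inverse (w - z) *\<^sub>C (A w x - A z x) - ?D x) \<le> \<bar>Ca\<bar> * ?p w + \<bar>Cb\<bar> * ?q w) (at z)"
        using ev by eventually_elim (use le in blast)
      have "((\<lambda>w. \<bar>Ca\<bar> * ?p w + \<bar>Cb\<bar> * ?q w) \<longlongrightarrow> \<bar>Ca\<bar> * 0 + \<bar>Cb\<bar> * 0) (at z)"
        by (intro tendsto_intros DP DQ)
      then show "((\<lambda>w. \<bar>Ca\<bar> * ?p w + \<bar>Cb\<bar> * ?q w) \<longlongrightarrow> 0) (at z)" by simp
    qed simp
    ultimately show "\<exists>D. bounded_operator K D \<and>
        ((\<lambda>w. operator_norm K (\<lambda>x. inverse (w - z) *\<^sub>C (A w x - A z x) - D x)) \<longlongrightarrow> 0) (at z)" by blast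
  qed
qed

subsection \<open>Square integrable functions depending holomorphically on a parameter\<close>

lemma Cauchy_bound:
  assumes hol: "F holomorphic_on UNIV" and M: "\<And>w. w \<in> cball z r \<Longrightarrow> norm (F w) \<le> M"
    and s: "0 < s" "cball u s \<subseteq> cball z r"
  shows "norm ((deriv ^^ n) F u) \<le> fact n * M / s ^ n"
proof (rule Cauchy_inequality)
  show "F holomorphic_on ball u s" by (rule holomorphic_on_subset[OF hol]) simp
  show "continuous_on (cball u s) F"
    by (rule continuous_on_subset[OF holomorphic_on_imp_continuous_on[OF hol]]) simp
  show "0 < s" by (rule s)
  fix x assume "norm (u - x) = s"
  then have "x \<in> cball u s" by (simp add: dist_norm)
  then show "norm (F x) \<le> M" using M s(2) by blast
qed

lemma norm_deriv_le:
  assumes "F holomorphic_on UNIV" "0 < r" "\<And>w. w \<in> cball z r \<Longrightarrow> norm (F w) \<le> M"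
  shows "norm (deriv F z) \<le> M / r"
proof -
  have "norm ((deriv ^^ 1) F z) \<le> fact 1 * M / r ^ 1"
    by (rule Cauchy_bound[OF assms(1) _ assms(2) order_refl]) (rule assms(3))
  then show ?thesis by simp
qed

text \<open>Taylor's formula of first order on the ball of radius r/2; Cauchy's estimate bounds the
  second derivative there by 2M/(r/2)^2. The result is linear in M, so for a family of functions the
  bounds can be integrated.\<close>

lemma difference_quotient_bound:
  assumes hol: "F holomorphic_on UNIV" and r: "0 < r" and M: "\<And>w. w \<in> cball z r \<Longrightarrow> norm (F w) \<le> M"
    and w: "w \<noteq> z" "norm (w - z) \<le> r / 2"
  shows "norm (inverse (w - z) * (F w - F z) - deriv F z) \<le> 8 * M / r\<^sup>2 * norm (w - z)"
proof -
  let ?f = "\<lambda>i. (deriv ^^ i) F"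
  have "norm (?f 0 w - (\<Sum>i\<le>1. ?f i z * (w - z) ^ i / fact i)) \<le> (8 * M / r\<^sup>2) * norm (w - z) ^ Suc 1 / fact 1"
  proof (rule complex_Taylor[where S = "cball z (r / 2)" and f = ?f])
    fix i x assume "x \<in> cball z (r / 2)"
    have "(?f i) holomorphic_on UNIV" by (rule holomorphic_higher_deriv[OF hol]) simp
    then have "(?f i has_field_derivative deriv (?f i) x) (at x)" by (rule holomorphic_derivI) auto
    then show "(?f i has_field_derivative ?f (Suc i) x) (at x within cball z (r / 2))"
      by (simp add: has_field_derivative_at_within)
  next
    fix x assume "x \<in> cball z (r / 2)"
    then have x: "dist z x \<le> r / 2" by simp
    have "cball x (r / 2) \<subseteq> cball z r"
    proof
      fix y assume "y \<in> cball x (r / 2)"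
      then have "dist x y \<le> r / 2" by simp
      then show "y \<in> cball z r" using dist_triangle[of z y x] x by simp
    qed
    then have "norm (?f 2 x) \<le> fact 2 * M / (r / 2) ^ 2" using r by (intro Cauchy_bound[OF hol M]) auto
    then show "norm (?f (Suc 1) x) \<le> 8 * M / r\<^sup>2" by (simp add: numeral_2_eq_2 power_divide)
  qed (use w r in \<open>auto simp: dist_norm norm_minus_commute\<close>)
  then have le: "norm (F w - F z - deriv F z * (w - z)) \<le> 8 * M / r\<^sup>2 * (norm (w - z) * norm (w - z))"
    by (simp add: power2_eq_square algebra_simps)
  have "inverse (w - z) * (F w - F z) - deriv F z = inverse (w - z) * (F w - F z - deriv F z * (w - z))"
    using w by (simp add: field_simps)
  then have "norm (inverse (w - z) * (F w - F z) - deriv F z) = inverse (norm (w - z)) * norm (F w - F z - deriv F z * (w - z))"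
    by (simp only: norm_mult norm_inverse)
  also have "\<dots> \<le> inverse (norm (w - z)) * (8 * M / r\<^sup>2 * (norm (w - z) * norm (w - z)))"
    by (rule mult_left_mono[OF le]) simp
  also have "\<dots> = 8 * M / r\<^sup>2 * norm (w - z)" using w by simp
  finally show "norm (inverse (w - z) * (F w - F z) - deriv F z) \<le> 8 * M / r\<^sup>2 * norm (w - z)" .
qed

lemma norm_abs_L2_le:
  assumes F: "square_integrable F" and M: "integrable half_line (\<lambda>x. (M x)\<^sup>2)" and c: "0 \<le> c"
    and le: "\<And>x. 0 < x \<Longrightarrow> norm (F x) \<le> c * M x"
  shows "norm (abs_L2 F) \<le> c * sqrt (\<integral>x. (M x)\<^sup>2 \<partial>half_line)"
proof (rule power2_le_imp_le)
  have "(norm (abs_L2 F))\<^sup>2 = (\<integral>x. (cmod (F x))\<^sup>2 \<partial>half_line)" by (rule L2_norm_abs_square[OF F])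
  also have "\<dots> \<le> (\<integral>x. c\<^sup>2 * (M x)\<^sup>2 \<partial>half_line)"
  proof (rule integral_mono)
    show "integrable half_line (\<lambda>x. (cmod (F x))\<^sup>2)" using F by (simp add: square_integrable_def)
    show "integrable half_line (\<lambda>x. c\<^sup>2 * (M x)\<^sup>2)" using M by simp
    show "(cmod (F x))\<^sup>2 \<le> c\<^sup>2 * (M x)\<^sup>2" if "x \<in> space half_line" for x
      using power_mono[OF le[of x], of 2] that by (simp add: power_mult_distrib)
  qed
  also have "\<dots> = c\<^sup>2 * (\<integral>x. (M x)\<^sup>2 \<partial>half_line)" by simp
  also have "\<dots> = (c * sqrt (\<integral>x. (M x)\<^sup>2 \<partial>half_line))\<^sup>2"
    by (simp add: power_mult_distrib)
  finally show "(norm (abs_L2 F))\<^sup>2 \<le> (c * sqrt (\<integral>x. (M x)\<^sup>2 \<partial>half_line))\<^sup>2" .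
  show "0 \<le> c * sqrt (\<integral>x. (M x)\<^sup>2 \<partial>half_line)" using c by simp
qed

text \<open>Pointwise holomorphy with one square integrable majorant on a ball suffices: the error
  of the difference quotient at x is at most a multiple of |w - z| M(x), and taking norms keeps the
  factor |w - z|.\<close>

lemma L2_differentiable:
  assumes hol: "\<And>x. 0 < x \<Longrightarrow> (\<lambda>z. \<Phi> z x) holomorphic_on UNIV"
    and meas: "\<And>z. \<Phi> z \<in> borel_measurable half_line"
    and r: "0 < r" and bound: "\<And>w x. w \<in> cball z r \<Longrightarrow> 0 < x \<Longrightarrow> norm (\<Phi> w x) \<le> M x"
    and M: "integrable half_line (\<lambda>x. (M x)\<^sup>2)"
  shows "\<exists>D. ((\<lambda>w. norm (inverse (w - z) *\<^sub>C (abs_L2 (\<Phi> w) - abs_L2 (\<Phi> z)) - D)) \<longlongrightarrow> 0) (at z)"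
proof -
  have sq: "square_integrable F" if "F \<in> borel_measurable half_line" "\<And>x. 0 < x \<Longrightarrow> norm (F x) \<le> c * M x" for F c
    unfolding square_integrable_def
  proof (rule conjI[OF that(1)], rule Bochner_Integration.integrable_bound)
    show "integrable half_line (\<lambda>x. c\<^sup>2 * (M x)\<^sup>2)" using M by simp
    have [measurable]: "F \<in> borel_measurable half_line" by (rule that(1))
    show "(\<lambda>x. (cmod (F x))\<^sup>2) \<in> borel_measurable half_line" by measurable
    show "AE x in half_line. norm ((cmod (F x))\<^sup>2) \<le> norm (c\<^sup>2 * (M x)\<^sup>2)"
    proof (rule AE_I2)
      fix x assume "x \<in> space half_line"
      then have "(norm (F x))\<^sup>2 \<le> (c * M x)\<^sup>2" using that(2) by (intro power_mono) auto
      then show "norm ((cmod (F x))\<^sup>2) \<le> norm (c\<^sup>2 * (M x)\<^sup>2)" by (simp add: power_mult_distrib)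
    qed
  qed
  have sq\<Phi>: "square_integrable (\<Phi> w)" if "w \<in> cball z r" for w
    by (rule sq[OF meas, of _ 1]) (use bound[OF that] in simp)
  define D where "D x = deriv (\<lambda>z. \<Phi> z x) z" for x
  define q where "q w x = inverse (w - z) * (\<Phi> w x - \<Phi> z x)" for w x
  have qD: "norm (q w x - D x) \<le> (8 / r\<^sup>2 * norm (w - z)) * M x"
    if "w \<noteq> z" "norm (w - z) \<le> r / 2" "0 < x" for w x
    using difference_quotient_bound[OF hol[OF that(3)] r bound[OF _ that(3)] that(1,2)]
    by (simp add: q_def D_def mult_ac)
  have Dle: "norm (D x) \<le> (1 / r) * M x" if "0 < x" for x
    unfolding D_def
    using norm_deriv_le[OF hol[OF that] r bound[OF _ that]] by simp
  have Dm: "D \<in> borel_measurable half_line"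
  proof (rule borel_measurable_LIMSEQ_metric)
    \<comment> \<open>A sequence tending to \<open>z\<close> inside the ball of radius r/2: the
      pointwise derivative becomes a limit of measurable quotients.\<close>
    let ?w = "\<lambda>n. z + complex_of_real (r / 2 / real (Suc n))"
    have mq: "q w \<in> borel_measurable half_line" for w
      unfolding q_def[abs_def] by (intro borel_measurable_times borel_measurable_diff meas borel_measurable_const)
    show "q (?w n) \<in> borel_measurable half_line" for n by (rule mq)
    fix x assume "x \<in> space half_line"
    then have x: "0 < x" by simp
    have "(\<lambda>n. q (?w n) x - D x) \<longlonglongrightarrow> 0"
    proof (rule Lim_null_comparison)
      have l: "(\<lambda>n. r / 2 / real (Suc n)) \<longlonglongrightarrow> 0"
        by (rule LIMSEQ_Suc[OF lim_const_over_n])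
      have n: "norm (?w n - z) = r / 2 / real (Suc n)" for n
      proof -
        have "?w n - z = complex_of_real (r / 2 / real (Suc n))" by simp
        then show ?thesis using r by (simp only: norm_of_real) simp
      qed
      have "norm (q (?w n) x - D x) \<le> 8 / r\<^sup>2 * (r / 2 / real (Suc n)) * M x" for n
      proof -
        have "0 < r / 2 / real (Suc n)" using r by simp
        then have ne: "?w n \<noteq> z" using n[of n] by (metis norm_zero less_irrefl right_minus_eq)
        have "r / 2 / real (Suc n) \<le> r / 2" using r divide_left_mono[of 1 "real (Suc n)" "r / 2"] by simp
        then have "norm (q (?w n) x - D x) \<le> 8 / r\<^sup>2 * norm (?w n - z) * M x"
          by (intro qD[OF ne _ x]) (simp only: n)
        then show ?thesis by (simp only: n)
      qed
      then show "eventually (\<lambda>n. norm (q (?w n) x - D x) \<le> 8 / r\<^sup>2 * (r / 2 / real (Suc n)) * M x) sequentially"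
        by simp
      have "(\<lambda>n. 8 / r\<^sup>2 * (r / 2 / real (Suc n)) * M x) \<longlonglongrightarrow> 8 / r\<^sup>2 * 0 * M x"
        by (intro tendsto_mult tendsto_const l)
      then show "(\<lambda>n. 8 / r\<^sup>2 * (r / 2 / real (Suc n)) * M x) \<longlonglongrightarrow> 0" by simp
    qed
    then show "(\<lambda>n. q (?w n) x) \<longlonglongrightarrow> D x" by (rule LIM_zero_cancel)
  qed
  have sqD: "square_integrable D" by (rule sq[OF Dm Dle])
  let ?N = "sqrt (\<integral>x. (M x)\<^sup>2 \<partial>half_line)"
  have "norm (inverse (w - z) *\<^sub>C (abs_L2 (\<Phi> w) - abs_L2 (\<Phi> z)) - abs_L2 D) \<le> (8 / r\<^sup>2 * norm (w - z)) * ?N"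
    if w: "w \<noteq> z" "norm (w - z) \<le> r / 2" for w
  proof -
    have b: "w \<in> cball z r" "z \<in> cball z r" using w r by (auto simp: dist_norm norm_minus_commute)
    have s: "square_integrable (\<lambda>x. \<Phi> w x - \<Phi> z x)" by (rule square_integrable_diff[OF sq\<Phi>[OF b(1)] sq\<Phi>[OF b(2)]])
    have s': "square_integrable (q w)" unfolding q_def[abs_def] by (rule square_integrable_scale[OF s])
    have "inverse (w - z) *\<^sub>C (abs_L2 (\<Phi> w) - abs_L2 (\<Phi> z)) - abs_L2 D = abs_L2 (\<lambda>x. q w x - D x)"
      unfolding abs_L2_diff[OF sq\<Phi>[OF b(1)] sq\<Phi>[OF b(2)]] abs_L2_scale[OF s]
      using abs_L2_diff[OF s' sqD] by (simp add: q_def[abs_def])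
    also have "norm \<dots> \<le> (8 / r\<^sup>2 * norm (w - z)) * ?N"
      by (rule norm_abs_L2_le[OF square_integrable_diff[OF s' sqD] M _ qD[OF w]]) simp_all
    finally show ?thesis .
  qed
  note le = this
  have "((\<lambda>w. norm (inverse (w - z) *\<^sub>C (abs_L2 (\<Phi> w) - abs_L2 (\<Phi> z)) - abs_L2 D)) \<longlongrightarrow> 0) (at z)"
  proof (rule tendsto_sandwich)
    show "eventually (\<lambda>w. 0 \<le> norm (inverse (w - z) *\<^sub>C (abs_L2 (\<Phi> w) - abs_L2 (\<Phi> z)) - abs_L2 D)) (at z)" by simp
    have "eventually (\<lambda>w. w \<noteq> z \<and> norm (w - z) \<le> r / 2) (at z)"
      unfolding eventually_at using r by (intro exI[of _ "r / 2"]) (auto simp: dist_norm)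
    then show "eventually (\<lambda>w. norm (inverse (w - z) *\<^sub>C (abs_L2 (\<Phi> w) - abs_L2 (\<Phi> z)) - abs_L2 D)
      \<le> (8 / r\<^sup>2 * norm (w - z)) * ?N) (at z)"
      by eventually_elim (use le in blast)
    have "((\<lambda>w. (8 / r\<^sup>2 * norm (w - z)) * ?N) \<longlongrightarrow> (8 / r\<^sup>2 * norm (z - z)) * ?N) (at z)"
      by (intro tendsto_intros)
    then show "((\<lambda>w. (8 / r\<^sup>2 * norm (w - z)) * ?N) \<longlongrightarrow> 0) (at z)" by simp
  qed simp
  then show ?thesis by blast
qed

subsection \<open>The family of maximal operators\<close>

lemma holomorphic_on_UNIV_if_balls:
  assumes "\<And>r. f holomorphic_on ball 0 r"
  shows "f holomorphic_on UNIV"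
  unfolding holomorphic_on_def
proof
  fix z :: complex
  have "f field_differentiable (at z)"
    by (rule holomorphic_on_imp_differentiable_at[OF assms[of "norm z + 1"]]) auto
  then show "f field_differentiable (at z within UNIV)" by simp
qed

lemma sol1_holomorphic: "(\<lambda>z. sol1 z x) holomorphic_on UNIV"
  unfolding sol1_def
  by (intro holomorphic_on_mult holomorphic_on_const holomorphic_on_UNIV_if_balls ch_holomorphic)

lemma sol2_holomorphic: "(\<lambda>z. sol2 z x) holomorphic_on UNIV"
  unfolding sol2_def
  by (intro holomorphic_on_mult holomorphic_on_const holomorphic_on_UNIV_if_balls sh_holomorphic)

text \<open>\<open>csqrt\<close> jumps across the negative axis, but its real part is the continuous
  function in the proof.\<close>

lemma open_admissible: "open {\<alpha>. \<bar>Re (csqrt \<alpha>)\<bar> < c}"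
proof -
  have "{\<alpha>. \<bar>Re (csqrt \<alpha>)\<bar> < c} = {\<alpha>. \<bar>sqrt ((cmod \<alpha> + Re \<alpha>) / 2)\<bar> < c}" by simp
  also have "open \<dots>" by (intro open_Collect_less continuous_intros) auto
  finally show ?thesis .
qed

text \<open>\<open>s\<close> lies between |Re csqrt z| and 1 to leave room for a neighbourhood of z,
  and \<rho> between \<open>s\<close> and 1 to leave room for the logarithm.\<close>

lemma admissible_cball:
  assumes "\<bar>Re (csqrt z)\<bar> < 1"
  obtains r s \<rho> where "0 < r" "s < \<rho>" "0 \<le> \<rho>" "\<rho> < 1" "\<And>w. w \<in> cball z r \<Longrightarrow> \<bar>Re (csqrt w)\<bar> \<le> s"
proof -
  define s where "s = (1 + \<bar>Re (csqrt z)\<bar>) / 2"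
  have s: "\<bar>Re (csqrt z)\<bar> < s" "s < (1 + s) / 2" "0 \<le> (1 + s) / 2" "(1 + s) / 2 < 1"
    using assms by (auto simp: s_def)
  obtain r where r: "0 < r" "cball z r \<subseteq> {\<alpha>. \<bar>Re (csqrt \<alpha>)\<bar> < s}"
    using open_admissible[of s] s(1) open_contains_cball by (metis mem_Collect_eq)
  have "\<bar>Re (csqrt w)\<bar> \<le> s" if "w \<in> cball z r" for w
    using r(2) that by (metis less_imp_le mem_Collect_eq subsetD)
  then show thesis by (rule that[OF r(1) s(2,3,4)])
qed

lemma test_bounded:
  assumes "\<phi> \<in> test_functions"
  obtains B where "0 \<le> B" "\<And>x. 0 < x \<Longrightarrow> norm (\<phi> x) \<le> B"
proof -
  obtain a b where ab: "0 < a" "\<And>x. 0 < x \<Longrightarrow> x \<notin> {a..b} \<Longrightarrow> \<phi> x = 0" "smooth_on {0<..} \<phi>"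
    using test_functionsE[OF assms] by metis
  have "{a..b} \<subseteq> {0<..}" using ab(1) by auto
  then have "bounded (\<phi> ` {a..b})"
    by (intro compact_imp_bounded compact_continuous_image compact_Icc
        continuous_on_subset[OF smooth_on_imp_continuous_on[OF ab(3)]])
  then obtain B where B: "\<And>x. x \<in> {a..b} \<Longrightarrow> norm (\<phi> x) \<le> B" unfolding bounded_iff by blast
  have "norm (\<phi> x) \<le> max B 0" if "0 < x" for x
    using B[of x] ab(2)[OF that] by (cases "x \<in> {a..b}") auto
  then show thesis by (intro that[of "max B 0"]) auto
qed

lemma (in cutoff) derivative_test: "(\<lambda>x. vector_derivative \<xi> (at x)) \<in> test_functions"
proof (rule test_functionsI[OF smooth_half_lineD(1)[OF smooth]])
  show "0 < \<epsilon> / 2" "\<epsilon> / 2 < R + 1" using eps by auto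
  fix x :: real assume x: "0 < x" "x \<notin> {\<epsilon> / 2..R + 1}"
  show "vector_derivative \<xi> (at x) = 0"
  proof (cases "x < \<epsilon>")
    case True
    show ?thesis
      by (rule vector_derivative_zero_open[where S = "{0<..<\<epsilon>}" and c = 1]) (use True x one in auto)
  next
    case False
    then have "R < x" using x by auto
    then show ?thesis
      by (intro vector_derivative_zero_open[where S = "{R<..}" and c = 0]) (use zero in auto)
  qed
qed

text \<open>By the equation for u all terms with the uncut potential cancel, leaving the commutator
  -(2u'\<xi>' + u\<xi>''). It lives on the support of \<xi>', away from zero, so the factor 1/x in
  \<open>dsol1\<close> and \<open>dsol2\<close> is harmless.\<close>

lemma (in cutoff) bessel_cut_eq:
  assumes u: "\<And>x. 0 < x \<Longrightarrow> (u has_vector_derivative u' x) (at x)"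
    "\<And>x. 0 < x \<Longrightarrow> (u' has_vector_derivative (\<alpha> - 1/4) * (1 / (complex_of_real x)\<^sup>2) * u x) (at x)"
    and x: "0 < x"
  shows "bessel \<alpha> (\<lambda>x. u x * \<xi> x) x = - (2 * u' x * vector_derivative \<xi> (at x)
    + u x * vector_derivative (\<lambda>x. vector_derivative \<xi> (at x)) (at x))"
proof -
  note d = smooth_half_lineD(2)[OF smooth] and dd = smooth_half_lineD(2)[OF smooth_half_lineD(1)[OF smooth]]
  have "bessel \<alpha> (\<lambda>x. u x * \<xi> x) x = - ((u x * vector_derivative (\<lambda>x. vector_derivative \<xi> (at x)) (at x) + u' x * vector_derivative \<xi> (at x))
      + (u' x * vector_derivative \<xi> (at x) + (\<alpha> - 1/4) * (1 / (complex_of_real x)\<^sup>2) * u x * \<xi> x))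
      + (\<alpha> - 1/4) * (1 / (complex_of_real x)\<^sup>2) * (u x * \<xi> x)"
    by (rule bessel_eq[OF has_vector_derivative_mult[OF u(1) d]
        has_vector_derivative_add[OF has_vector_derivative_mult[OF u(1) dd] has_vector_derivative_mult[OF u(2) d]] x])
  moreover have "- ((p + q) + (q + k * v * y)) + k * (v * y) = - (2 * q + p)" for p q k v y :: complex
    by (simp add: algebra_simps)
  ultimately show ?thesis by (simp only: mult.assoc)
qed

context cutoff
begin

lemma bessel_cut_solutions:
  assumes "0 < x"
  shows "bessel \<alpha> (\<lambda>x. sol1 \<alpha> x * \<xi> x) x = - (2 * dsol1 \<alpha> x * vector_derivative \<xi> (at x)
      + sol1 \<alpha> x * vector_derivative (\<lambda>x. vector_derivative \<xi> (at x)) (at x))"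
    and "bessel \<alpha> (\<lambda>x. sol2 \<alpha> x * \<xi> x) x = - (2 * dsol2 \<alpha> x * vector_derivative \<xi> (at x)
      + sol2 \<alpha> x * vector_derivative (\<lambda>x. vector_derivative \<xi> (at x)) (at x))"
proof -
  show "bessel \<alpha> (\<lambda>x. sol1 \<alpha> x * \<xi> x) x = - (2 * dsol1 \<alpha> x * vector_derivative \<xi> (at x)
      + sol1 \<alpha> x * vector_derivative (\<lambda>x. vector_derivative \<xi> (at x)) (at x))"
    by (rule bessel_cut_eq[OF has_vector_derivative_sol1 has_vector_derivative_dsol1 assms])
  show "bessel \<alpha> (\<lambda>x. sol2 \<alpha> x * \<xi> x) x = - (2 * dsol2 \<alpha> x * vector_derivative \<xi> (at x)
      + sol2 \<alpha> x * vector_derivative (\<lambda>x. vector_derivative \<xi> (at x)) (at x))"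
    by (rule bessel_cut_eq[OF has_vector_derivative_sol2 has_vector_derivative_dsol2 assms])
qed

text \<open>Complex differentiability, in the form in which \<open>L2_differentiable\<close>
  delivers and \<open>holomorphic_bounded_familyI\<close> requires it.\<close>

definition diff_at :: "(complex \<Rightarrow> L2) \<Rightarrow> complex \<Rightarrow> bool" where
  "diff_at P z \<longleftrightarrow> (\<exists>D. ((\<lambda>w. norm (inverse (w - z) *\<^sub>C (P w - P z) - D)) \<longlongrightarrow> 0) (at z))"

lemma cut_differentiable:
  assumes "\<bar>Re (csqrt z)\<bar> < 1"
  shows "diff_at cut1 z" "diff_at cut2 z"
proof -
  obtain r s \<rho> where r: "0 < r" "s < \<rho>" "0 \<le> \<rho>" "\<rho> < 1" "\<And>w. w \<in> cball z r \<Longrightarrow> \<bar>Re (csqrt w)\<bar> \<le> s"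
    by (rule admissible_cball[OF assms]) (rule that)
  obtain B where B: "0 < B"
    "\<And>\<alpha> r \<rho> x. \<bar>Re (csqrt \<alpha>)\<bar> \<le> r \<Longrightarrow> r < \<rho> \<Longrightarrow> 0 < x \<Longrightarrow> norm (sol1 \<alpha> x * \<xi> x) \<le> B * envelope R \<rho> x"
    "\<And>\<alpha> r \<rho> x. \<bar>Re (csqrt \<alpha>)\<bar> \<le> r \<Longrightarrow> r < \<rho> \<Longrightarrow> 0 < x \<Longrightarrow> norm (sol2 \<alpha> x * \<xi> x) \<le> B / (\<rho> - r) * envelope R \<rho> x"
    by (rule norm_cut_solutions_le) (rule that)
  have R: "0 < R" using eps by simp
  have M: "integrable half_line (\<lambda>x. (K * envelope R \<rho> x)\<^sup>2)" for K
    unfolding power_mult_distrib by (intro integrable_mult_right envelope_square_integrable r R)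
  show "diff_at cut1 z" unfolding diff_at_def cut1_def
    by (rule L2_differentiable[OF _ cut_solutions_measurable(1) r(1) B(2)[OF r(5) r(2)] M])
      (intro holomorphic_on_mult holomorphic_on_const sol1_holomorphic)
  show "diff_at cut2 z" unfolding diff_at_def cut2_def
    by (rule L2_differentiable[OF _ cut_solutions_measurable(2) r(1) B(3)[OF r(5) r(2)] M])
      (intro holomorphic_on_mult holomorphic_on_const sol2_holomorphic)
qed

lemma Lcut_differentiable:
  assumes "\<bar>Re (csqrt z)\<bar> < 1"
  shows "diff_at Lcut1 z" "diff_at Lcut2 z"
proof -
  obtain r s \<rho> where r: "0 < r" "s < \<rho>" "0 \<le> \<rho>" "\<rho> < 1" "\<And>w. w \<in> cball z r \<Longrightarrow> \<bar>Re (csqrt w)\<bar> \<le> s"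
    by (rule admissible_cball[OF assms]) (rule that)
  let ?x1 = "\<lambda>x. vector_derivative \<xi> (at x)" and ?x2 = "\<lambda>x. vector_derivative (\<lambda>x. vector_derivative \<xi> (at x)) (at x)"
  obtain B1 where B1: "0 \<le> B1" "\<And>x. 0 < x \<Longrightarrow> norm (?x1 x) \<le> B1"
    by (rule test_bounded[OF derivative_test]) (rule that)
  obtain B2 where B2: "0 \<le> B2" "\<And>x. 0 < x \<Longrightarrow> norm (?x2 x) \<le> B2"
    by (rule test_bounded[OF vector_derivative_test[OF derivative_test]]) (rule that)
  obtain a b where ab: "0 < a" "a < b" "\<And>x. 0 < x \<Longrightarrow> x \<notin> {a..b} \<Longrightarrow> ?x1 x = 0"
    using test_functionsE[OF derivative_test] by metis
  have x2: "?x2 x = 0" if "0 < x" "x \<notin> {a..b}" for x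
    by (rule vector_derivative_zero_outside[OF ab(3) that])
  \<comment> \<open>\<open>Z\<close> bounds the parameter on the ball, \<open>1 + S\<close> is a
    common constant for both solutions, and \<open>C\<close> collects the bounds for the two
    commutator terms, with 1/x at most 1/a on the support of \<xi>'.\<close>
  define Z where "Z = norm z + r"
  define S where "S = 1 / (\<rho> - s)"
  define C where "C = 2 * ((1/2 + 1) * (1 + S) * (1 + Z) / a) * B1 + (1 + S) * B2"
  have S: "0 \<le> S" using r by (simp add: S_def)
  have Z: "0 \<le> Z" "norm w \<le> Z" if "w \<in> cball z r" for w
  proof -
    show "0 \<le> Z" using r by (simp add: Z_def)
    show "norm w \<le> Z" using that norm_triangle_ineq2[of w z] by (simp add: Z_def dist_norm norm_minus_commute)
  qed
  have zr: "z \<in> cball z r" using r by simp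
  have solb: "norm (sol1 w x) \<le> (1 + S) * (sqrt x * exp (\<rho> * \<bar>ln x\<bar>))"
    "norm (sol2 w x) \<le> (1 + S) * (sqrt x * exp (\<rho> * \<bar>ln x\<bar>))" if "w \<in> cball z r" "0 < x" for w x
  proof -
    let ?e = "sqrt x * exp (\<rho> * \<bar>ln x\<bar>)"
    have e: "0 \<le> ?e" using that by simp
    have "norm (sol1 w x) \<le> ?e" by (rule norm_solutions_le(1)[OF r(5)[OF that(1)] r(2) that(2)])
    also have "\<dots> \<le> (1 + S) * ?e" using S e by (simp add: distrib_right)
    finally show "norm (sol1 w x) \<le> (1 + S) * ?e" .
    have "norm (sol2 w x) \<le> S * ?e" unfolding S_def by (rule norm_solutions_le(2)[OF r(5)[OF that(1)] r(2) that(2)])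
    also have "\<dots> \<le> (1 + S) * ?e" using S e by (simp add: distrib_right)
    finally show "norm (sol2 w x) \<le> (1 + S) * ?e" .
  qed
  \<comment> \<open>One estimate for both solutions: u, v are sol1, sol2 with c the parameter, or
    sol2, sol1 with c = 1. The cut at \<open>b + 1\<close> is there because \<open>envelope\<close>
    vanishes from its cut on.\<close>
  have key: "norm (- (2 * ((u / 2 + c * v) / complex_of_real x) * ?x1 x + u * ?x2 x)) \<le> C * envelope (b + 1) \<rho> x"
    if x: "0 < x" and uv: "norm u \<le> (1 + S) * (sqrt x * exp (\<rho> * \<bar>ln x\<bar>))" "norm v \<le> (1 + S) * (sqrt x * exp (\<rho> * \<bar>ln x\<bar>))"
      and c: "norm c \<le> 1 + Z" for u v c x
  proof (cases "x \<in> {a..b}")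
    case False
    have "C * envelope (b + 1) \<rho> x \<ge> 0"
      using B1(1) B2(1) S Z(1)[OF zr] ab(1) x by (auto simp: C_def envelope_def intro!: mult_nonneg_nonneg add_nonneg_nonneg)
    then show ?thesis unfolding ab(3)[OF x False] x2[OF x False] by simp
  next
    case True
    let ?e = "(1 + S) * (sqrt x * exp (\<rho> * \<bar>ln x\<bar>))"
    have e: "0 \<le> ?e" using S x by simp
    have "norm (u / 2 + c * v) \<le> norm u / 2 + norm c * norm v"
      using norm_triangle_ineq[of "u / 2" "c * v"] by (simp add: norm_mult norm_divide)
    also have "\<dots> \<le> ?e / 2 + (1 + Z) * ?e"
      using uv c Z(1)[OF zr] by (intro add_mono divide_right_mono mult_mono) auto
    also have "\<dots> \<le> (1/2 + 1) * (1 + Z) * ?e"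
    proof -
      have "?e / 2 \<le> (1 + Z) * ?e / 2" using mult_right_mono[of 1 "1 + Z" ?e] e Z(1)[OF zr] by simp
      then show ?thesis by (simp add: field_simps)
    qed
    finally have "norm (u / 2 + c * v) / x \<le> (1/2 + 1) * (1 + Z) * ?e / a"
      using True ab(1) e Z(1)[OF zr] by (intro frac_le) auto
    then have n1: "norm ((u / 2 + c * v) / complex_of_real x) \<le> (1/2 + 1) * (1 + Z) * ?e / a"
      using x by (simp add: norm_divide)
    have "norm (- (2 * ((u / 2 + c * v) / complex_of_real x) * ?x1 x + u * ?x2 x))
        \<le> 2 * norm ((u / 2 + c * v) / complex_of_real x) * norm (?x1 x) + norm u * norm (?x2 x)"
      unfolding norm_minus_cancel
      by (rule order_trans[OF norm_triangle_ineq]) (simp only: norm_mult norm_numeral order_refl)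
    also have "\<dots> \<le> 2 * ((1/2 + 1) * (1 + Z) * ?e / a) * B1 + ?e * B2"
      using n1 uv(1) B1 B2 x e Z(1)[OF zr] ab(1) by (intro add_mono mult_mono) auto
    also have "\<dots> = C * (sqrt x * exp (\<rho> * \<bar>ln x\<bar>))" by (simp add: C_def algebra_simps add_divide_distrib)
    also have "\<dots> = C * envelope (b + 1) \<rho> x" using True by (simp add: envelope_def)
    finally show ?thesis .
  qed
  have M: "integrable half_line (\<lambda>x. (C * envelope (b + 1) \<rho> x)\<^sup>2)"
    unfolding power_mult_distrib using ab by (intro integrable_mult_right envelope_square_integrable r) auto
  have hol1: "(\<lambda>w. bessel w (\<lambda>x. sol1 w x * \<xi> x) x) holomorphic_on UNIV" if "0 < x" for x
    unfolding bessel_cut_solutions(1)[OF that] dsol1_def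
    using that by (intro holomorphic_intros sol1_holomorphic sol2_holomorphic) auto
  have hol2: "(\<lambda>w. bessel w (\<lambda>x. sol2 w x * \<xi> x) x) holomorphic_on UNIV" if "0 < x" for x
    unfolding bessel_cut_solutions(2)[OF that] dsol2_def
    using that by (intro holomorphic_intros sol1_holomorphic sol2_holomorphic) auto
  have bd1: "norm (bessel w (\<lambda>x. sol1 w x * \<xi> x) x) \<le> C * envelope (b + 1) \<rho> x" if w: "w \<in> cball z r" and x: "0 < x" for w x
    unfolding bessel_cut_solutions(1)[OF x] dsol1_def
    by (rule key[OF x solb(1)[OF w x] solb(2)[OF w x]]) (use Z(2)[OF w] in simp)
  have bd2: "norm (bessel w (\<lambda>x. sol2 w x * \<xi> x) x) \<le> C * envelope (b + 1) \<rho> x" if w: "w \<in> cball z r" and x: "0 < x" for w x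
    using key[OF x solb(2)[OF w x] solb(1)[OF w x], of 1] Z(1)[OF w]
    unfolding bessel_cut_solutions(2)[OF x] dsol2_def by simp
  show "diff_at Lcut1 z" unfolding diff_at_def Lcut1_def
    by (rule L2_differentiable[OF hol1 test_measurable[OF bessel_cut1] r(1) bd1 M])
  show "diff_at Lcut2 z" unfolding diff_at_def Lcut2_def
    by (rule L2_differentiable[OF hol2 test_measurable[OF bessel_cut2] r(1) bd2 M])
qed

lemma scaleC_diff_left: "(a - b) *\<^sub>C (u :: 'a::complex_banach) = a *\<^sub>C u - b *\<^sub>C u"
  using scaleC_add_left[of "a - b" b u] by simp

lemma scaleC_diff_right: "a *\<^sub>C ((u :: 'a::complex_banach) - v) = a *\<^sub>C u - a *\<^sub>C v"
  using scaleC_add_right[of a "u - v" v] by simp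

lemma scaleC_zero_right: "a *\<^sub>C (0 :: 'a::complex_banach) = 0"
  using scaleC_diff_right[of a "0::'a" 0] by simp

lemma scaleC_one: "1 *\<^sub>C (u :: 'a::complex_banach) = u"
  using scaleC_of_real[of 1 u] by simp

lemma diff_at_affine:
  assumes "diff_at P z"
  shows "diff_at (\<lambda>w. P w - c - (w - e) *\<^sub>C d) z"
proof -
  obtain D where D: "((\<lambda>w. norm (inverse (w - z) *\<^sub>C (P w - P z) - D)) \<longlongrightarrow> 0) (at z)"
    using assms unfolding diff_at_def by blast
  have "((\<lambda>w. norm (inverse (w - z) *\<^sub>C ((P w - c - (w - e) *\<^sub>C d) - (P z - c - (z - e) *\<^sub>C d)) - (D - d))) \<longlongrightarrow> 0) (at z)"
  proof (rule Lim_transform_eventually[OF D])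
    have "eventually (\<lambda>w. w \<noteq> z) (at z)" by (simp add: eventually_at_filter)
    then show "eventually (\<lambda>w. norm (inverse (w - z) *\<^sub>C (P w - P z) - D)
      = norm (inverse (w - z) *\<^sub>C ((P w - c - (w - e) *\<^sub>C d) - (P z - c - (z - e) *\<^sub>C d)) - (D - d))) (at z)"
    proof eventually_elim
      case (elim w)
      have eq: "(P w - c - (w - e) *\<^sub>C d) - (P z - c - (z - e) *\<^sub>C d) = (P w - P z) - (w - z) *\<^sub>C d"
        by (simp add: scaleC_diff_left)
      have q: "inverse (w - z) * (w - z) = 1" using elim by simp
      have "inverse (w - z) *\<^sub>C ((P w - c - (w - e) *\<^sub>C d) - (P z - c - (z - e) *\<^sub>C d))
        = inverse (w - z) *\<^sub>C (P w - P z) - d"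
        unfolding eq scaleC_diff_right[of _ "P w - P z" "(w - z) *\<^sub>C d"] scaleC_scaleC q scaleC_one ..
      then show ?case by simp
    qed
  qed
  then show ?thesis unfolding diff_at_def by blast
qed

section \<open>The coefficients as bounded linear functionals, and their uniqueness\<close>

lemma pairing_add:
  assumes "\<theta> \<in> test_functions" "\<bar>Re (csqrt \<alpha>)\<bar> < 1"
  shows "pairing \<alpha> \<theta> (f + f') (g + g') = pairing \<alpha> \<theta> f g + pairing \<alpha> \<theta> f' g'"
  unfolding pairing_def hardy_add[OF assms(2)]
  by (simp add: distribution_of_add assms(1) mult_test[OF assms(1) smooth_square])

lemma pairing_scale:
  assumes "\<theta> \<in> test_functions" "\<bar>Re (csqrt \<alpha>)\<bar> < 1"
  shows "pairing \<alpha> \<theta> (c *\<^sub>C f) (c *\<^sub>C g) = c * pairing \<alpha> \<theta> f g"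
  unfolding pairing_def hardy_scale[OF assms(2)]
    distribution_of_scale[OF test_measurable[OF assms(1)]]
    distribution_of_scale[OF test_measurable[OF mult_test[OF assms(1) smooth_square]]]
  by (simp add: right_diff_distrib)

lemma pairing_bound:
  assumes t: "\<theta> \<in> test_functions" and \<alpha>: "\<bar>Re (csqrt \<alpha>)\<bar> < 1"
  obtains C where "\<And>f g. norm (pairing \<alpha> \<theta> f g) \<le> C * (norm f + norm g)"
proof -
  obtain H where H: "0 < H" "\<And>g. norm (hardy \<alpha> g) \<le> H * norm g" by (rule hardy_bound[OF \<alpha>]) (rule that)
  have t2: "(\<lambda>x. (complex_of_real x)\<^sup>2 * \<theta> x) \<in> test_functions" by (rule mult_test[OF t smooth_square])
  let ?A = "norm (abs_L2 \<theta>)" and ?B = "norm (abs_L2 (\<lambda>x. (complex_of_real x)\<^sup>2 * \<theta> x))"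
  have "norm (pairing \<alpha> \<theta> f g) \<le> (?A + H * ?B) * (norm f + norm g)" for f g
  proof -
    have "norm (pairing \<alpha> \<theta> f g) \<le> norm f * ?A + norm (hardy \<alpha> g) * ?B"
      unfolding pairing_def
      by (rule order_trans[OF norm_triangle_ineq4 add_mono[OF norm_distribution_of_le[OF t] norm_distribution_of_le[OF t2]]])
    also have "\<dots> \<le> norm f * ?A + (H * norm g) * ?B" by (intro add_left_mono mult_right_mono H(2)) simp
    also have "\<dots> \<le> (?A + H * ?B) * (norm f + norm g)"
      using H(1) by (simp add: algebra_simps)
    finally show ?thesis .
  qed
  then show thesis by (rule that)
qed

lemma coef_add:
  assumes "\<bar>Re (csqrt \<alpha>)\<bar> < 1"
  shows "coef1 \<alpha> (f + f') (g + g') = coef1 \<alpha> f g + coef1 \<alpha> f' g'"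
    "coef2 \<alpha> (f + f') (g + g') = coef2 \<alpha> f g + coef2 \<alpha> f' g'"
  unfolding coef1_def coef2_def pairing_add[OF bessel_cut1 assms] pairing_add[OF bessel_cut2 assms] by simp_all

lemma coef_scale:
  assumes "\<bar>Re (csqrt \<alpha>)\<bar> < 1"
  shows "coef1 \<alpha> (c *\<^sub>C f) (c *\<^sub>C g) = c * coef1 \<alpha> f g" "coef2 \<alpha> (c *\<^sub>C f) (c *\<^sub>C g) = c * coef2 \<alpha> f g"
  unfolding coef1_def coef2_def pairing_scale[OF bessel_cut1 assms] pairing_scale[OF bessel_cut2 assms] by simp_all

text \<open>Near zero two decompositions of f differ by integrals of order x^(3/2), so their
  solution parts agree. The parametrization needs this to reach prescribed coefficients.\<close>

lemma coef_quarter_unique: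
  assumes h: "h \<in> H2_0" and f: "f = h + a *\<^sub>C cut1 (1/4) + b *\<^sub>C cut2 (1/4)" and g: "(f, g) \<in> L_max (1/4)"
  shows "coef1 (1/4) f g = a \<and> coef2 (1/4) f g = b"
proof -
  obtain k where k: "(h, k) \<in> L_max (1/4)" using H2_0_L_max[OF h] by blast
  let ?A = "coef1 (1/4) f g - a" and ?B = "coef2 (1/4) f g - b"
  obtain C where C: "0 < C" "\<And>g x. square_integrable g \<Longrightarrow> 0 < x \<Longrightarrow> norm (green_op (1/4) g x) \<le> C * x powr (3/2) * norm (abs_L2 g)"
    by (rule green_op_bound[OF quarter_admissible]) (rule that)
  have hf: "h = f - a *\<^sub>C cut1 (1/4) - b *\<^sub>C cut2 (1/4)" using f by simp
  have "?A = 0 \<and> ?B = 0"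
  proof (rule solutions_near_zero[where \<delta> = \<epsilon> and r = "\<lambda>x. (C * norm k + C * norm g) * x powr (3/2)"])
    have "AE x in half_line. 0 < x" by (rule AE_I2) simp
    with representation[OF quarter_admissible g] H2_0_green[OF h k] AE_rep_remainder[OF quarter_admissible, of f a b, folded hf]
    show "AE x in half_line. x < \<epsilon> \<longrightarrow> norm (?A * sol1 (1/4) x + ?B * sol2 (1/4) x) \<le> (C * norm k + C * norm g) * x powr (3/2)"
    proof eventually_elim
      case (elim x)
      show ?case
      proof
        assume "x < \<epsilon>"
        then have "\<xi> x = 1" using one elim(4) by blast
        then have "?A * sol1 (1/4) x + ?B * sol2 (1/4) x = green_op (1/4) (rep_L2 k) x - green_op (1/4) (rep_L2 g) x"
          using elim(1-3) by (simp add: algebra_simps)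
        then have "norm (?A * sol1 (1/4) x + ?B * sol2 (1/4) x)
            \<le> norm (green_op (1/4) (rep_L2 k) x) + norm (green_op (1/4) (rep_L2 g) x)"
          by (simp only: norm_triangle_ineq4)
        also have "\<dots> \<le> C * x powr (3/2) * norm (abs_L2 (rep_L2 k)) + C * x powr (3/2) * norm (abs_L2 (rep_L2 g))"
          by (rule add_mono[OF C(2)[OF square_integrable_rep elim(4)] C(2)[OF square_integrable_rep elim(4)]])
        also have "\<dots> = (C * norm k + C * norm g) * x powr (3/2)" by (simp add: abs_rep_L2 algebra_simps)
        finally show "norm (?A * sol1 (1/4) x + ?B * sol2 (1/4) x) \<le> (C * norm k + C * norm g) * x powr (3/2)" .
      qed
    qed
    show "\<exists>d>0. \<forall>x. 0 < x \<longrightarrow> x < d \<longrightarrow> (C * norm k + C * norm g) * x powr (3/2) \<le> e * x" if "0 < e" for e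
      by (rule powr_three_halves_small[OF _ that]) (use C(1) in simp)
  qed (rule eps)
  then show ?thesis by simp
qed

theorem holomorphic_family_L_max:
  "holomorphic_family_closed TYPE(L2) {\<alpha>. \<bar>Re (csqrt \<alpha>)\<bar> < 1} L_max"
proof -
  let ?\<Theta> = "{\<alpha>. \<bar>Re (csqrt \<alpha>)\<bar> < 1}"
  let ?T = "L_max (1/4)"
  let ?K = "graph_space ?T"
  note T = closed_operator_L_max[of "1/4"]
  note qa = quarter_admissible
  have K: "normed_structure_banach ?K" by (rule graph_space_banach[OF T])
  have eqs: "carr ?K = Domain ?T" "add ?K = (+)" "scl ?K = scaleC" "nrm ?K = (\<lambda>x. norm x + norm (op_apply ?T x))"
    by (simp_all add: graph_space_def)
  \<comment> \<open>The functionals that read off the coefficients of the two cut off solutions,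
    bounded in the graph norm.\<close>
  define a where "a x = coef1 (1/4) x (op_apply ?T x)" for x
  define b where "b x = coef2 (1/4) x (op_apply ?T x)" for x
  obtain Ca where "\<And>f g. norm (pairing (1/4) (bessel (1/4) (\<lambda>x. sol2 (1/4) x * \<xi> x)) f g) \<le> Ca * (norm f + norm g)"
    by (rule pairing_bound[OF bessel_cut2 qa]) (rule that)
  then have Ca: "norm (coef1 (1/4) f g) \<le> Ca * (norm f + norm g)" for f g by (simp only: coef1_def)
  obtain Cb where "\<And>f g. norm (pairing (1/4) (bessel (1/4) (\<lambda>x. sol1 (1/4) x * \<xi> x)) f g) \<le> Cb * (norm f + norm g)"
    by (rule pairing_bound[OF bessel_cut1 qa]) (rule that)
  then have Cb: "norm (coef2 (1/4) f g) \<le> Cb * (norm f + norm g)" for f g by (simp only: coef2_def norm_minus_cancel)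
  have a: "a (add ?K x y) = a x + a y" "b (add ?K x y) = b x + b y" if "x \<in> carr ?K" "y \<in> carr ?K" for x y
    using that by (simp_all add: eqs a_def b_def op_apply_add[OF T] coef_add[OF qa])
  have s: "a (scl ?K c x) = c * a x" "b (scl ?K c x) = c * b x" if "x \<in> carr ?K" for c x
    using that by (simp_all add: eqs a_def b_def op_apply_scale[OF T] coef_scale[OF qa])
  have n: "cmod (a x) \<le> Ca * nrm ?K x" "cmod (b x) \<le> Cb * nrm ?K x" for x
    using Ca Cb by (simp_all add: eqs a_def b_def)
  define A where "A z x = x + a x *\<^sub>C (cut1 z - cut1 (1/4)) + b x *\<^sub>C (cut2 z - cut2 (1/4))" for z x
  define hT where "hT x = hardy (1/4) (op_apply ?T x)" for x
  \<comment> \<open>The operator maps \<open>A z x\<close> to \<open>k + (z - 1/4) hardy k\<close>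
    plus the images of the cut off solutions for z. Expressing \<open>k\<close> through the image of
    x and sorting by \<open>a x\<close> and \<open>b x\<close> leaves these vectors.\<close>
  define P where "P z = Lcut1 z - Lcut1 (1/4) - (z - 1/4) *\<^sub>C hardy (1/4) (Lcut1 (1/4))" for z
  define Q where "Q z = Lcut2 z - Lcut2 (1/4) - (z - 1/4) *\<^sub>C hardy (1/4) (Lcut2 (1/4))" for z
  define HA where "HA z x = (op_apply ?T x - (1/4) *\<^sub>C hT x) + z *\<^sub>C hT x + a x *\<^sub>C P z + b x *\<^sub>C Q z" for z x
  have hardy_diff: "hardy (1/4) (u - v) = hardy (1/4) u - hardy (1/4) v" for u v
    using hardy_add[OF qa, of "u - v" v] by simp
  obtain H where H: "0 < H" "\<And>g. norm (hardy (1/4) g) \<le> H * norm g" by (rule hardy_bound[OF qa]) (rule that)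
  have in_L: "(A z x, HA z x) \<in> L_max z" if z: "z \<in> ?\<Theta>" and x: "x \<in> Domain ?T" for z x
  proof -
    have z': "\<bar>Re (csqrt z)\<bar> < 1" using z by simp
    note xg = op_apply_in[OF T x]
    define h where "h = x - a x *\<^sub>C cut1 (1/4) - b x *\<^sub>C cut2 (1/4)"
    define k where "k = op_apply ?T x - a x *\<^sub>C Lcut1 (1/4) - b x *\<^sub>C Lcut2 (1/4)"
    have h: "h \<in> H2_0" unfolding h_def a_def b_def by (rule remainder_in_H2_0[OF qa xg])
    have hk: "(h, k) \<in> ?T" unfolding h_def k_def by (intro L_max_diff L_max_scale cut_in_L_max qa xg)
    have Az: "A z x = h + a x *\<^sub>C cut1 z + b x *\<^sub>C cut2 z"
      by (simp add: A_def h_def scaleC_diff_right)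
    have m: "(A z x, (k + (z - 1/4) *\<^sub>C hardy (1/4) k) + a x *\<^sub>C Lcut1 z + b x *\<^sub>C Lcut2 z) \<in> L_max z"
      unfolding Az by (intro L_max_add H2_0_in_L_max h hk L_max_scale cut_in_L_max z')
    have kk: "hardy (1/4) k = hT x - a x *\<^sub>C hardy (1/4) (Lcut1 (1/4)) - b x *\<^sub>C hardy (1/4) (Lcut2 (1/4))"
      by (simp only: k_def hT_def hardy_diff hardy_scale[OF qa])
    have e: "(k + (z - 1/4) *\<^sub>C hardy (1/4) k) + a x *\<^sub>C Lcut1 z + b x *\<^sub>C Lcut2 z = HA z x"
      unfolding kk by (simp add: HA_def P_def Q_def k_def scaleC_diff_right scaleC_diff_left scaleC_add_right
          scaleC_scaleC algebra_simps)
    show "(A z x, HA z x) \<in> L_max z" using m unfolding e .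
  qed
  have "holomorphic_bounded_family ?K ?\<Theta> A"
  proof (rule holomorphic_bounded_familyI[OF K _ _ a(1) s(1) n(1) a(2) s(2) n(2)])
    show "bounded_operator ?K (\<lambda>x. x)" by (rule bounded_operator_graph_spaceI[where B = 1]) auto
    show "bounded_operator ?K (\<lambda>x. 0 :: L2)"
      by (rule bounded_operator_graph_spaceI[where B = 0]) (auto simp: scaleC_zero_right)
    show "\<exists>D. ((\<lambda>w. norm (inverse (w - z) *\<^sub>C ((cut1 w - cut1 (1/4)) - (cut1 z - cut1 (1/4))) - D)) \<longlongrightarrow> 0) (at z)"
      "\<exists>D. ((\<lambda>w. norm (inverse (w - z) *\<^sub>C ((cut2 w - cut2 (1/4)) - (cut2 z - cut2 (1/4))) - D)) \<longlongrightarrow> 0) (at z)"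
      if "z \<in> ?\<Theta>" for z
      using cut_differentiable[of z] that by (simp_all add: diff_at_def)
    show "open ?\<Theta>" by (rule open_admissible)
    show "A z x = x + z *\<^sub>C 0 + a x *\<^sub>C (cut1 z - cut1 (1/4)) + b x *\<^sub>C (cut2 z - cut2 (1/4))" for z x
      by (simp add: A_def scaleC_zero_right)
  qed
  moreover have "holomorphic_bounded_family ?K ?\<Theta> (\<lambda>z x. op_apply (L_max z) (A z x))"
  proof (rule holomorphic_bounded_familyI[OF K _ _ a(1) s(1) n(1) a(2) s(2) n(2)])
    have add: "hT (x + y) = hT x + hT y" if "x \<in> Domain ?T" "y \<in> Domain ?T" for x y
      by (simp add: hT_def op_apply_add[OF T that] hardy_add[OF qa])
    have scl: "hT (c *\<^sub>C x) = c *\<^sub>C hT x" if "x \<in> Domain ?T" for c x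
      by (simp add: hT_def op_apply_scale[OF T that] hardy_scale[OF qa])
    have le: "norm (hT x) \<le> H * (norm x + norm (op_apply ?T x))" for x
      using order_trans[OF H(2) mult_left_mono[of _ "norm x + norm (op_apply ?T x)" H]] H(1) by (simp add: hT_def)
    show "bounded_operator ?K (\<lambda>x. op_apply ?T x - (1/4) *\<^sub>C hT x)"
    proof (rule bounded_operator_graph_spaceI[where B = "1 + H"])
      show "op_apply ?T (x + y) - (1/4) *\<^sub>C hT (x + y) = (op_apply ?T x - (1/4) *\<^sub>C hT x) + (op_apply ?T y - (1/4) *\<^sub>C hT y)"
        if "x \<in> Domain ?T" "y \<in> Domain ?T" for x y
        by (simp add: add[OF that] op_apply_add[OF T that] scaleC_add_right)
      show "op_apply ?T (c *\<^sub>C x) - (1/4) *\<^sub>C hT (c *\<^sub>C x) = c *\<^sub>C (op_apply ?T x - (1/4) *\<^sub>C hT x)"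
        if "x \<in> Domain ?T" for c x
        by (simp add: scl[OF that] op_apply_scale[OF T that] scaleC_diff_right scaleC_scaleC mult.commute)
      show "norm (op_apply ?T x - (1/4) *\<^sub>C hT x) \<le> (1 + H) * (norm x + norm (op_apply ?T x))" for x
      proof -
        have "norm ((1/4) *\<^sub>C hT x) \<le> norm (hT x)" by (simp add: norm_scaleC)
        then have "norm (op_apply ?T x - (1/4) *\<^sub>C hT x) \<le> norm (op_apply ?T x) + norm (hT x)"
          by (rule order_trans[OF norm_triangle_ineq4 add_left_mono])
        also have "\<dots> \<le> (norm x + norm (op_apply ?T x)) + H * (norm x + norm (op_apply ?T x))"
          by (rule add_mono[OF _ le]) simp
        finally show ?thesis by (simp add: distrib_right)
      qed
    qed
    show "bounded_operator ?K hT" by (rule bounded_operator_graph_spaceI[OF add scl le])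
    show "\<exists>D. ((\<lambda>w. norm (inverse (w - z) *\<^sub>C (P w - P z) - D)) \<longlongrightarrow> 0) (at z)"
      if "z \<in> ?\<Theta>" for z
    proof -
      have "diff_at Lcut1 z" by (rule Lcut_differentiable) (use that in simp)
      from diff_at_affine[OF this] show ?thesis unfolding diff_at_def P_def .
    qed
    show "\<exists>D. ((\<lambda>w. norm (inverse (w - z) *\<^sub>C (Q w - Q z) - D)) \<longlongrightarrow> 0) (at z)"
      if "z \<in> ?\<Theta>" for z
    proof -
      have "diff_at Lcut2 z" by (rule Lcut_differentiable) (use that in simp)
      from diff_at_affine[OF this] show ?thesis unfolding diff_at_def Q_def .
    qed
    show "open ?\<Theta>" by (rule open_admissible)
    show "op_apply (L_max z) (A z x) = (op_apply ?T x - (1/4) *\<^sub>C hT x) + z *\<^sub>C hT x + a x *\<^sub>C P z + b x *\<^sub>C Q z"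
      if "z \<in> ?\<Theta>" "x \<in> carr ?K" for z x
      using op_apply_L_max[OF in_L[OF that(1)]] that(2) by (simp add: eqs HA_def)
  qed
  moreover have "A z ` carr ?K = Domain (L_max z)" if z: "z \<in> ?\<Theta>" for z
  proof
    show "A z ` carr ?K \<subseteq> Domain (L_max z)" using in_L[OF z] unfolding eqs by blast
    show "Domain (L_max z) \<subseteq> A z ` carr ?K"
    proof
      fix f assume "f \<in> Domain (L_max z)"
      then obtain h c d where h: "h \<in> H2_0" and f: "f = h + c *\<^sub>C cut1 z + d *\<^sub>C cut2 z"
        using Domain_L_max[of z f] z by blast
      \<comment> \<open>The preimage keeps the remainder and the coefficients and exchanges only the
        solutions.\<close>
      define x where "x = h + c *\<^sub>C cut1 (1/4) + d *\<^sub>C cut2 (1/4)"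
      have x: "x \<in> Domain ?T" using Domain_L_max[OF qa, of x] h x_def by blast
      have ab: "a x = c" "b x = d"
        using coef_quarter_unique[OF h x_def op_apply_in[OF T x]] by (simp_all add: a_def b_def)
      have "A z x = f" unfolding A_def ab by (simp add: x_def f scaleC_diff_right)
      then show "f \<in> A z ` carr ?K" using x unfolding eqs by blast
    qed
  qed
  \<comment> \<open>The parametrization is global: one space and one family serve every base point,
    with the whole region as neighbourhood.\<close>
  ultimately show ?thesis
    unfolding holomorphic_family_closed_def
    by (intro conjI ballI open_admissible closed_operator_L_max exI[of _ ?\<Theta>] exI[of _ ?K] exI[of _ A] K) auto
qed

end

section \<open>Comparison of the domains\<close>

lemma nn_integral_inverse_near_zero:
  assumes "0 < \<delta>"
  shows "(\<integral>\<^sup>+x. (if x < \<delta> then ennreal (1 / x) else 0) \<partial>half_line) = \<infinity>"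
proof -
  have "ennreal (real n) \<le> (\<integral>\<^sup>+x. (if x < \<delta> then ennreal (1 / x) else 0) \<partial>half_line)" for n
  proof -
    define c where "c = \<delta> / 2"
    \<comment> \<open>Chosen such that the integral of 1/x over \<open>{d..c}\<close>, which is ln c
      - ln d, equals n.\<close>
    define d where "d = c * exp (- real n)"
    have c: "0 < c" "c < \<delta>" "0 < d" "d \<le> c" using assms by (auto simp: c_def d_def)
    have "((\<lambda>x. 1 / x) has_integral ln c - ln d) {d..c}"
    proof (rule fundamental_theorem_of_calculus)
      fix x assume "x \<in> {d..c}"
      then have "(ln has_real_derivative 1 / x) (at x within {d..c})"
        using c by (auto intro!: derivative_eq_intros)
      then show "(ln has_vector_derivative 1 / x) (at x within {d..c})"
        by (simp add: has_real_derivative_iff_has_vector_derivative)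
    qed (rule c)
    moreover have "ln c - ln d = real n" using c by (simp add: d_def ln_mult)
    ultimately have "((\<lambda>x. 1 / x) has_integral real n) {d..c}" by simp
    then have "ennreal (real n) = (\<integral>\<^sup>+x. ennreal (1 / x) * indicator {d..c} x \<partial>lborel)"
      by (intro nn_integral_has_integral_lebesgue'[symmetric]) (use c in auto)
    also have "\<dots> \<le> (\<integral>\<^sup>+x. (if x < \<delta> then ennreal (1 / x) else 0) \<partial>half_line)"
      unfolding nn_integral_half_line using c by (intro nn_integral_mono) (auto simp: indicator_def)
    finally show ?thesis .
  qed
  note lower = this
  show ?thesis
  proof (rule ccontr)
    assume "\<not> ?thesis"
    then have "(\<integral>\<^sup>+x. (if x < \<delta> then ennreal (1 / x) else 0) \<partial>half_line) < top"
      by (simp add: less_top)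
    then obtain n where "(\<integral>\<^sup>+x. (if x < \<delta> then ennreal (1 / x) else 0) \<partial>half_line) < of_nat n"
      by (auto dest: ennreal_Ex_less_of_nat)
    then show False using lower[of n] by (simp add: ennreal_of_nat_eq_real_of_nat)
  qed
qed

text \<open>This is exp = cosh + sinh at m ln x, valid for either root m of \<alpha>, so replacing m
  by -m yields the second power.\<close>

lemma powr_solutions:
  assumes m: "m\<^sup>2 = \<alpha>" and x: "0 < x"
  shows "complex_of_real x powr (1/2 + m) = sol1 \<alpha> x + m * sol2 \<alpha> x"
proof -
  have "complex_of_real x powr (1/2 + m) = exp (complex_of_real (ln x) / 2) * exp (m * complex_of_real (ln x))"
    using x by (simp add: powr_def Ln_of_real distrib_right exp_add)
  also have "exp (m * complex_of_real (ln x)) = ch \<alpha> (ln x) + m * sh \<alpha> (ln x)"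
  proof (cases "m = 0")
    case True
    then show ?thesis using ch_square[OF m] by simp
  next
    case False
    then show ?thesis using ch_square[OF m] sh_square[OF m False] by (simp add: cosh_plus_sinh)
  qed
  finally show ?thesis using x by (simp add: exp_half_ln sol1_def sol2_def distrib_left mult.left_commute)
qed

context cutoff
begin

lemma abs_powr_cut:
  assumes m: "m\<^sup>2 = \<alpha>" and \<alpha>: "\<bar>Re (csqrt \<alpha>)\<bar> < 1"
  shows "square_integrable (\<lambda>x. complex_of_real x powr (1/2 + m) * \<xi> x)"
    and "abs_L2 (\<lambda>x. complex_of_real x powr (1/2 + m) * \<xi> x) = cut1 \<alpha> + m *\<^sub>C cut2 \<alpha>"
proof -
  note s = square_integrable_cut_solutions[OF \<alpha>]
  have s': "square_integrable (\<lambda>x. sol1 \<alpha> x * \<xi> x + m * (sol2 \<alpha> x * \<xi> x))"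
    by (rule square_integrable_add[OF s(1) square_integrable_scale[OF s(2)]])
  have eq: "complex_of_real x powr (1/2 + m) * \<xi> x = sol1 \<alpha> x * \<xi> x + m * (sol2 \<alpha> x * \<xi> x)" if "0 < x" for x
    by (simp only: powr_solutions[OF m that] distrib_right mult.assoc)
  have meas: "(\<lambda>x. complex_of_real x powr (1/2 + m) * \<xi> x) \<in> borel_measurable half_line
      \<longleftrightarrow> (\<lambda>x. sol1 \<alpha> x * \<xi> x + m * (sol2 \<alpha> x * \<xi> x)) \<in> borel_measurable half_line"
    by (rule measurable_cong) (simp add: eq)
  show sq: "square_integrable (\<lambda>x. complex_of_real x powr (1/2 + m) * \<xi> x)"
    by (rule square_integrable_cong_AE[OF s' meas[THEN iffD2]])
      (use s' eq in \<open>auto simp: square_integrable_def intro!: AE_I2\<close>)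
  have "abs_L2 (\<lambda>x. complex_of_real x powr (1/2 + m) * \<xi> x) = abs_L2 (\<lambda>x. sol1 \<alpha> x * \<xi> x + m * (sol2 \<alpha> x * \<xi> x))"
    by (rule abs_L2_eqI[OF sq s']) (rule AE_I2, simp add: eq)
  then show "abs_L2 (\<lambda>x. complex_of_real x powr (1/2 + m) * \<xi> x) = cut1 \<alpha> + m *\<^sub>C cut2 \<alpha>"
    by (simp only: cut1_def cut2_def abs_L2_scale[OF s(2)] abs_L2_add[OF s(1) square_integrable_scale[OF s(2)]])
qed

text \<open>The two expressions differ by multiplication with (\<alpha>1 - \<alpha>2)/x^2; the
  fundamental lemma turns the resulting identity of integrals into one almost everywhere.\<close>

lemma L_max_domains_quotient:
  assumes f: "(f, g1) \<in> L_max \<alpha>1" "(f, g2) \<in> L_max \<alpha>2"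
  shows "AE x in half_line. (\<alpha>1 - \<alpha>2) * (rep_L2 f x / (complex_of_real x)\<^sup>2) = rep_L2 g1 x - rep_L2 g2 x"
proof -
  note l = square_integrable_imp_locally_integrable[OF square_integrable_rep]
  have lv: "locally_integrable (\<lambda>x. rep_L2 f x * (1 / (complex_of_real x)\<^sup>2))"
    by (intro locally_integrable_mult_continuous l smooth_on_imp_continuous_on smooth_inverse_square)
  let ?w = "\<lambda>x. (\<alpha>1 - \<alpha>2) * (rep_L2 f x * (1 / (complex_of_real x)\<^sup>2)) - (rep_L2 g1 x - rep_L2 g2 x)"
  have "AE x in half_line. ?w x = 0"
  proof (rule fundamental_lemma)
    show "locally_integrable ?w" by (intro locally_integrable_diff locally_integrable_scale lv l)
    fix \<phi> assume t: "\<phi> \<in> test_functions"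
    have i: "integrable half_line (\<lambda>x. rep_L2 f x * bessel \<alpha>1 \<phi> x)" "integrable half_line (\<lambda>x. rep_L2 f x * bessel \<alpha>2 \<phi> x)"
      "integrable half_line (\<lambda>x. rep_L2 g1 x * \<phi> x)" "integrable half_line (\<lambda>x. rep_L2 g2 x * \<phi> x)"
      by (intro integrable_mult_test l bessel_test t)+
    have e: "?w x * \<phi> x = (rep_L2 f x * bessel \<alpha>1 \<phi> x - rep_L2 f x * bessel \<alpha>2 \<phi> x)
        - (rep_L2 g1 x * \<phi> x - rep_L2 g2 x * \<phi> x)" for x
    proof -
      have "(c * (p * q) - (g - h)) * y = (p * (d + c * (q * y)) - p * d) - (g * y - h * y)" for c p q g h y d :: complex
        by (simp add: algebra_simps)
      then show ?thesis unfolding bessel_change[of \<alpha>1 \<phi> x \<alpha>2] .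
    qed
    have "(\<integral>x. ?w x * \<phi> x \<partial>half_line) = (distribution_of f (bessel \<alpha>1 \<phi>) - distribution_of f (bessel \<alpha>2 \<phi>))
        - (distribution_of g1 \<phi> - distribution_of g2 \<phi>)"
      unfolding e distribution_of_def using i by simp
    also have "\<dots> = 0" using f t unfolding L_max_iff by simp
    finally show "(\<integral>x. ?w x * \<phi> x \<partial>half_line) = 0" .
  qed
  then show ?thesis by eventually_elim simp
qed

lemma Domain_L_max_neq:
  assumes \<alpha>: "\<bar>Re (csqrt \<alpha>1)\<bar> < 1" and neq: "\<alpha>1 \<noteq> \<alpha>2"
  shows "Domain (L_max \<alpha>1) \<noteq> Domain (L_max \<alpha>2)"
proof
  assume eq: "Domain (L_max \<alpha>1) = Domain (L_max \<alpha>2)"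
  define m where "m = csqrt \<alpha>1"
  have m: "m\<^sup>2 = \<alpha>1" by (simp only: m_def power2_csqrt)
  have Re_m: "Re m < 1" unfolding m_def using \<alpha> by linarith
  define f where "f = abs_L2 (\<lambda>x. complex_of_real x powr (1/2 + m) * \<xi> x)"
  have "f = cut1 \<alpha>1 + m *\<^sub>C cut2 \<alpha>1" unfolding f_def by (rule abs_powr_cut(2)[OF m \<alpha>])
  then have "(f, Lcut1 \<alpha>1 + m *\<^sub>C Lcut2 \<alpha>1) \<in> L_max \<alpha>1"
    by (simp only:) (intro L_max_add L_max_scale cut_in_L_max \<alpha>)
  then obtain g1 where g1: "(f, g1) \<in> L_max \<alpha>1" by blast
  then obtain g2 where g2: "(f, g2) \<in> L_max \<alpha>2" using eq by blast
  have sq: "square_integrable (\<lambda>x. rep_L2 g1 x - rep_L2 g2 x)"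
    by (rule square_integrable_diff[OF square_integrable_rep square_integrable_rep])
  define K where "K = (cmod (\<alpha>1 - \<alpha>2))\<^sup>2"
  have K: "0 < K" using neq by (simp add: K_def)
  \<comment> \<open>Below \<open>\<epsilon>\<close> the cutoff is 1, and below 1 powers of x
    decrease in the exponent.\<close>
  define \<delta> where "\<delta> = min \<epsilon> 1"
  have \<delta>: "0 < \<delta>" using eps by (simp add: \<delta>_def)
  have "AE x in half_line. rep_L2 f x = complex_of_real x powr (1/2 + m) * \<xi> x"
    unfolding f_def by (rule AE_rep_abs_L2[OF abs_powr_cut(1)[OF m \<alpha>]])
  moreover have "AE x in half_line. 0 < x" by (rule AE_I2) simp
  ultimately have "AE x in half_line. ennreal K * (if x < \<delta> then ennreal (1 / x) else 0) \<le> ennreal ((cmod (rep_L2 g1 x - rep_L2 g2 x))\<^sup>2)"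
    using L_max_domains_quotient[OF g1 g2]
  proof eventually_elim
    case (elim x)
    show ?case
    proof (cases "x < \<delta>")
      case True
      have "\<xi> x = 1" using one[OF elim(2)] True by (simp add: \<delta>_def)
      then have "norm (rep_L2 f x) = x powr (1/2 + Re m)"
        using elim(1,2) by (simp add: norm_powr_real_powr)
      moreover have "norm (complex_of_real x) ^ 2 = x powr 2" using elim(2) by (simp add: powr_numeral)
      ultimately have "norm (rep_L2 f x / (complex_of_real x)\<^sup>2) = x powr (1/2 + Re m - 2)"
        by (simp only: norm_divide norm_power powr_diff)
      then have "(norm (rep_L2 f x / (complex_of_real x)\<^sup>2))\<^sup>2 = x powr (2 * Re m - 3)"
        by (simp add: power2_eq_square algebra_simps flip: powr_add)
      \<comment> \<open>Re m < 1 puts the exponent below -1, so the squared quotient dominates 1/x,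
        which is not integrable at zero.\<close>
      moreover have "x powr (- 1) \<le> x powr (2 * Re m - 3)"
        using elim(2) True Re_m by (intro powr_mono') (auto simp: \<delta>_def)
      ultimately have "1 / x \<le> (norm (rep_L2 f x / (complex_of_real x)\<^sup>2))\<^sup>2"
        using elim(2) by (simp add: powr_minus_divide)
      then have "K * (1 / x) \<le> K * (norm (rep_L2 f x / (complex_of_real x)\<^sup>2))\<^sup>2" using K by (intro mult_left_mono) auto
      also have "\<dots> = (norm ((\<alpha>1 - \<alpha>2) * (rep_L2 f x / (complex_of_real x)\<^sup>2)))\<^sup>2"
        by (simp only: K_def norm_mult power_mult_distrib)
      finally have "K * (1 / x) \<le> (norm (rep_L2 g1 x - rep_L2 g2 x))\<^sup>2" by (simp only: elim(3))
      then have "ennreal (K * (1 / x)) \<le> ennreal ((norm (rep_L2 g1 x - rep_L2 g2 x))\<^sup>2)" by (rule ennreal_leI)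
      moreover have "ennreal (K * (1 / x)) = ennreal K * ennreal (1 / x)"
        using K elim(2) by (intro ennreal_mult) auto
      ultimately show ?thesis using True by (simp only: if_True)
    qed simp
  qed
  then have "(\<integral>\<^sup>+x. ennreal K * (if x < \<delta> then ennreal (1 / x) else 0) \<partial>half_line)
      \<le> (\<integral>\<^sup>+x. ennreal ((cmod (rep_L2 g1 x - rep_L2 g2 x))\<^sup>2) \<partial>half_line)"
    by (rule nn_integral_mono_AE)
  also have "\<dots> < \<infinity>" unfolding nn_integral_L2[OF sq] by simp
  finally have fin: "(\<integral>\<^sup>+x. ennreal K * (if x < \<delta> then ennreal (1 / x) else 0) \<partial>half_line) < \<infinity>" .
  have "(\<integral>\<^sup>+x. ennreal K * (if x < \<delta> then ennreal (1 / x) else 0) \<partial>half_line)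
      = ennreal K * (\<integral>\<^sup>+x. (if x < \<delta> then ennreal (1 / x) else 0) \<partial>half_line)"
    by (rule nn_integral_cmult) measurable
  also have "\<dots> = \<infinity>" unfolding nn_integral_inverse_near_zero[OF \<delta>] using K by (simp add: ennreal_mult_eq_top_iff)
  finally show False using fin by simp
qed

end

lemma mem_set_plus_ranges:
  fixes f :: L2
  shows "f \<in> S + range (\<lambda>c. c *\<^sub>C u) + range (\<lambda>c. c *\<^sub>C v) \<longleftrightarrow> (\<exists>h\<in>S. \<exists>a b. f = h + a *\<^sub>C u + b *\<^sub>C v)"
  unfolding set_plus_def by blast

lemma cutoff_exists:
  assumes "\<xi> \<in> smooth_compact_support {0..}" "\<exists>\<epsilon>>0. \<forall>x\<in>{0..<\<epsilon>}. \<xi> x = 1"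
  obtains \<epsilon> R where "cutoff \<xi> \<epsilon> R"
proof -
  have s: "smooth_on {0..} \<xi>" and K: "compact (closure {x\<in>{0..}. \<xi> x \<noteq> 0})"
    using assms(1) by (auto simp: smooth_compact_support_def)
  obtain \<epsilon> where e: "0 < \<epsilon>" "\<forall>x\<in>{0..<\<epsilon>}. \<xi> x = 1" using assms(2) by blast
  have "bounded {x\<in>{0..}. \<xi> x \<noteq> 0}"
    using compact_imp_bounded[OF K] bounded_subset closure_subset by blast
  then obtain B where B: "\<And>x. x \<in> {x\<in>{0..}. \<xi> x \<noteq> 0} \<Longrightarrow> norm x \<le> B" unfolding bounded_iff by blast
  \<comment> \<open>Beyond the support of \<open>\<xi>\<close>, and larger than
    \<open>\<epsilon>\<close> as the locale requires.\<close>
  define R where "R = max B \<epsilon> + 1"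
  have "\<xi> x = 0" if "R \<le> x" for x
  proof (rule ccontr)
    assume "\<xi> x \<noteq> 0"
    moreover have "0 \<le> x" "B < x" using that e(1) by (auto simp: R_def)
    ultimately show False using B[of x] by simp
  qed
  then have "cutoff \<xi> \<epsilon> R"
    using e by unfold_locales (auto simp: R_def intro: smooth_on_subset[OF s])
  then show thesis by (rule that)
qed

theorem theorem4p3:
  fixes \<xi> :: "real \<Rightarrow> complex"
  assumes "\<xi> \<in> smooth_compact_support {0..}"
    and "\<exists>\<epsilon>>0. \<forall>x\<in>{0..<\<epsilon>}. \<xi> x = 1"
  shows
    "(\<forall>\<alpha> m. \<alpha> = m\<^sup>2 \<and> \<bar>Re (csqrt \<alpha>)\<bar> < 1 \<and> \<alpha> \<noteq> 0 \<longrightarrow>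
        Domain (L_max \<alpha>) = H2_0
          + range (\<lambda>c. c *\<^sub>C abs_L2 (\<lambda>x. complex_of_real x powr (1/2 + m) * \<xi> x))
          + range (\<lambda>c. c *\<^sub>C abs_L2 (\<lambda>x. complex_of_real x powr (1/2 - m) * \<xi> x)))
     \<and> Domain (L_max 0) = H2_0
          + range (\<lambda>c. c *\<^sub>C abs_L2 (\<lambda>x. complex_of_real x powr (1/2) * \<xi> x))
          + range (\<lambda>c. c *\<^sub>C abs_L2 (\<lambda>x. complex_of_real x powr (1/2) * complex_of_real (ln x) * \<xi> x))
     \<and> (\<forall>\<alpha>\<^sub>1 \<alpha>\<^sub>2. \<alpha>\<^sub>1 \<noteq> \<alpha>\<^sub>2 \<and> \<bar>Re (csqrt \<alpha>\<^sub>1)\<bar> < 1 \<and> \<bar>Re (csqrt \<alpha>\<^sub>2)\<bar> < 1 \<longrightarrow>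
          Domain (L_max \<alpha>\<^sub>1) \<noteq> Domain (L_max \<alpha>\<^sub>2))
     \<and> holomorphic_family_closed TYPE(L2) {\<alpha>. \<bar>Re (csqrt \<alpha>)\<bar> < 1} L_max"
proof -
  obtain \<epsilon> R where "cutoff \<xi> \<epsilon> R" by (rule cutoff_exists[OF assms])
  then interpret cutoff \<xi> \<epsilon> R .
  have nonzero: "Domain (L_max \<alpha>) = H2_0
      + range (\<lambda>c. c *\<^sub>C abs_L2 (\<lambda>x. complex_of_real x powr (1/2 + m) * \<xi> x))
      + range (\<lambda>c. c *\<^sub>C abs_L2 (\<lambda>x. complex_of_real x powr (1/2 - m) * \<xi> x))"
    if m: "\<alpha> = m\<^sup>2" and \<alpha>: "\<bar>Re (csqrt \<alpha>)\<bar> < 1" "\<alpha> \<noteq> 0" for \<alpha> m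
  proof -
    have m0: "m \<noteq> 0" using m \<alpha>(2) by auto
    have p: "abs_L2 (\<lambda>x. complex_of_real x powr (1/2 + m) * \<xi> x) = cut1 \<alpha> + m *\<^sub>C cut2 \<alpha>"
      by (rule abs_powr_cut(2)[OF m[symmetric] \<alpha>(1)])
    have "(- m)\<^sup>2 = \<alpha>" using m by simp
    from abs_powr_cut(2)[OF this \<alpha>(1)]
    have n: "abs_L2 (\<lambda>x. complex_of_real x powr (1/2 - m) * \<xi> x) = cut1 \<alpha> - m *\<^sub>C cut2 \<alpha>"
      by (simp add: scaleC_uminus)
    have comb: "c *\<^sub>C (cut1 \<alpha> + m *\<^sub>C cut2 \<alpha>) + d *\<^sub>C (cut1 \<alpha> - m *\<^sub>C cut2 \<alpha>)
        = (c + d) *\<^sub>C cut1 \<alpha> + ((c - d) * m) *\<^sub>C cut2 \<alpha>" for c d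
      by (simp add: scaleC_add_right scaleC_diff_right scaleC_add_left scaleC_diff_left scaleC_scaleC left_diff_distrib)
    have "f \<in> Domain (L_max \<alpha>) \<longleftrightarrow> (\<exists>h\<in>H2_0. \<exists>c d. f = h + c *\<^sub>C (cut1 \<alpha> + m *\<^sub>C cut2 \<alpha>) + d *\<^sub>C (cut1 \<alpha> - m *\<^sub>C cut2 \<alpha>))" for f
      unfolding Domain_L_max[OF \<alpha>(1)]
    proof (rule bex_cong[OF refl], rule iffI)
      fix h assume "\<exists>a b. f = h + a *\<^sub>C cut1 \<alpha> + b *\<^sub>C cut2 \<alpha>"
      then obtain a b where f: "f = h + a *\<^sub>C cut1 \<alpha> + b *\<^sub>C cut2 \<alpha>" by blast
      \<comment> \<open>The solution of c + d = a and (c - d) m = b, which exists since m is not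
        0.\<close>
      define c where "c = (a + b / m) / 2"
      define d where "d = (a - b / m) / 2"
      have "c + d = a" "(c - d) * m = b" using m0 by (simp_all add: c_def d_def field_simps)
      then have "f = h + c *\<^sub>C (cut1 \<alpha> + m *\<^sub>C cut2 \<alpha>) + d *\<^sub>C (cut1 \<alpha> - m *\<^sub>C cut2 \<alpha>)"
        using comb[of c d] f by (simp only: add.assoc)
      then show "\<exists>c d. f = h + c *\<^sub>C (cut1 \<alpha> + m *\<^sub>C cut2 \<alpha>) + d *\<^sub>C (cut1 \<alpha> - m *\<^sub>C cut2 \<alpha>)" by blast
    next
      fix h assume "\<exists>c d. f = h + c *\<^sub>C (cut1 \<alpha> + m *\<^sub>C cut2 \<alpha>) + d *\<^sub>C (cut1 \<alpha> - m *\<^sub>C cut2 \<alpha>)"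
      then show "\<exists>a b. f = h + a *\<^sub>C cut1 \<alpha> + b *\<^sub>C cut2 \<alpha>"
        by (auto simp: add.assoc comb)
    qed
    then show ?thesis unfolding p n by (intro set_eqI) (simp only: mem_set_plus_ranges)
  qed
  have z: "\<bar>Re (csqrt 0)\<bar> < 1" by simp
  have p0: "abs_L2 (\<lambda>x. complex_of_real x powr (1/2) * \<xi> x) = cut1 0"
    using abs_powr_cut(2)[of 0 0] scaleC_zero_right[of 0] scaleC_of_real[of 0 "cut2 0"] by simp
  have q0: "abs_L2 (\<lambda>x. complex_of_real x powr (1/2) * complex_of_real (ln x) * \<xi> x) = cut2 0"
  proof -
    \<comment> \<open>For \<alpha> = 0 both powers collapse to \<open>sol1\<close>; the logarithmic
      solution is \<open>sol2\<close>, because \<open>sh 0\<close> is the identity.\<close>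
    have eq: "complex_of_real x powr (1/2) * complex_of_real (ln x) * \<xi> x = sol2 0 x * \<xi> x" if "0 < x" for x
      using powr_solutions[of 0 0 x] that by (simp add: sol1_def sol2_def ch_def sh_def)
    have meas: "(\<lambda>x. complex_of_real x powr (1/2) * complex_of_real (ln x) * \<xi> x) \<in> borel_measurable half_line
        \<longleftrightarrow> (\<lambda>x. sol2 0 x * \<xi> x) \<in> borel_measurable half_line"
      by (rule measurable_cong) (simp add: eq)
    have sq: "square_integrable (\<lambda>x. complex_of_real x powr (1/2) * complex_of_real (ln x) * \<xi> x)"
      by (rule square_integrable_cong_AE[OF square_integrable_cut_solutions(2)[OF z] meas[THEN iffD2]])
        (rule cut_solutions_measurable, rule AE_I2, simp add: eq)
    show ?thesis unfolding cut2_def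
      by (rule abs_L2_eqI[OF sq square_integrable_cut_solutions(2)[OF z]]) (rule AE_I2, simp add: eq)
  qed
  have "Domain (L_max 0) = H2_0
      + range (\<lambda>c. c *\<^sub>C abs_L2 (\<lambda>x. complex_of_real x powr (1/2) * \<xi> x))
      + range (\<lambda>c. c *\<^sub>C abs_L2 (\<lambda>x. complex_of_real x powr (1/2) * complex_of_real (ln x) * \<xi> x))"
    unfolding p0 q0 by (intro set_eqI) (simp only: mem_set_plus_ranges Domain_L_max[OF z])
  then show ?thesis
    using nonzero Domain_L_max_neq holomorphic_family_L_max by blast
qed

end
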